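(* Let $X$ be an SCLCS, let $n\ge2$, let $f:[0,+\infty)^n\to X$ be locally integrable and let $v_j\in\mathbb N_0$ for all $1\le j\le n$. Write $F:=\mathcal Lf$ and let $f_v(t_1,\dots,t_n):=\frac{t_1^{v_1}}{v_1!}\cdots\frac{t_n^{v_n}}{v_n!}f(t_1,\dots,t_n)$ for $(t_1,\dots,t_n)\in[0,+\infty)^n$. Then: (i) Let $\emptyset\ne\Omega\subseteq\Omega(f)\cap\Omega_b(f)$ be open in $\mathbb C^n$ and let $(\lambda_1,\dots,\lambda_n)\in\Omega$. Then the mapping $F:\Omega\to X$ is analytic, $(\lambda_1,\dots,\lambda_n)\in\Omega(f_v)$, and $$F^{(v_1,\dots,v_n)}(\lambda_1,\dots,\lambda_n)=(-1)^{v_1+\dots+v_n}\lim_{k_1\to+\infty;\dots;k_n\to+\infty;\ (k_1,\dots,k_n)\in\mathbb N_0^n}\int_0^{k_1}\!\!\cdots\int_0^{k_n}e^{-\lambda_1t_1-\dots-\lambda_nt_n}\,\frac{t_1^{v_1}}{v_1!}\cdots\frac{t_n^{v_n}}{v_n!}f(t_1,\dots,t_n)\,dt_1\cdots dt_n .$$ (ii) Let $\emptyset\ne\Omega\subseteq\Omega_{abs}(f)$ be open in $\mathbb C^n$ and let $(\lambda_1,\dots,\lambda_n)\in\Omega$. Then the mapping $F:\Omega\to X$ is analytic, $(\lambda_1,\dots,\lambda_n)\in\Omega_{abs}(f_v)$, and $$F^{(v_1,\dots,v_n)}(\lambda_1,\dots,\lambda_n)=(-1)^{v_1+\dots+v_n}\bigl(\mathcal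 L f_v\bigr)(\lambda_1,\dots,\lambda_n).$$
   Context: An SCLCS is a Hausdorff sequentially complete locally convex space over $\mathbb C$; $\circledast$ denotes a fundamental system of seminorms defining the topology of $X$. Integration (with respect to Lebesgue measure): for a compact set $K$, a function $f:K\to X$ is integrable if there is a sequence $(f_k)$ of simple functions with $f_k(t)\to f(t)$ for a.e. $t\in K$ and such that for every $\epsilon>0$ and $p\in\circledast$ there is $k_0$ with $\int_K p(f_k-f_m)\le\epsilon$ for all $k,m\ge k_0$; then $\int_K f:=\lim_k\int_K f_k$. A function $f:[0,+\infty)^n\to X$ is locally integrable if its restriction to every compact subset is integrable. For locally integrable $f$ and $\lambda=(\lambda_1,\dots,\lambda_n)\in\mathbb C^n$ put $I_\lambda(t_1,\dots,t_n):=\int_0^{t_1}\cdots\int_0^{t_n}e^{-\lambda_1s_1-\dots-\lambda_ns_n}f(s_1,\dots,s_n)\,ds_1\cdots ds_n$. $\Omega(f)$ is the set of all $\lambda$ for which the joint limit $(\mathcal Lf)(\lambda):=\lim_{t_1\to+\infty;\dots;t_n\to+\infty}I_\lambda(t_1,\dots,t_n)$ exists in $X$ (for every $\epsilon>0$ and $p\in\circledast$ there is $M>0$ with $p(I_\lambda(t_1,\dots,t_n)-(\mathcal Lf)(\lambda))<\epsilon$ whenever all $t_j>M$). $\Omega_{abs}(f)$ is the set of all $\lambda$ with $\int_{[0,+\infty)^n}p(e^{-\lambda_1t_1-\dots-\lambda_nt_n}f(t_1,\dots,t_n))\,dt_1\cdots dt_n<+\infty$ for every $p\in\circledast$; one has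 $\Omega_{abs}(f)\subseteq\Omega(f)$. $\Omega_b(f)$ is the set of all $\lambda$ such that $\{I_\lambda(t_1,\dots,t_n):t_1\ge0,\dots,t_n\ge0\}$ is bounded in $X$. A function from an open subset of $\mathbb C^n$ to $X$ is analytic if near each point (on a polydisc) it is the sum of a power series with coefficients in $X$ which converges absolutely with respect to every $p\in\circledast$. $F^{(v_1,\dots,v_n)}$ is the partial derivative $\partial^{v_1+\dots+v_n}F/\partial\lambda_1^{v_1}\cdots\partial\lambda_n^{v_n}$.
   Formalization: In both derivative formulas, (i) and (ii), the right-hand side carries the additional factor v_1!⋯v_n!; without it they fail once some v_j ≥ 2 (e.g. f = 1, n = 2, v = (2,0)). *)

theory Defs
  imports "HOL-Analysis.Analysis"
begin

section \<open>Sequentially complete locally convex spaces\<close>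

text \<open>
  A Hausdorff sequentially complete locally convex space over the complex numbers is a type with a
  Hausdorff topology (class \<^class>\<open>t2_space\<close>), a complex scalar multiplication \<open>smul\<close>, and a
  fundamental system \<open>P\<close> of seminorms: the balls of the single \<open>p \<in> P\<close> form neighbourhood bases
  of the topology.
\<close>

locale sclcs = vector_space smul
  for smul :: "complex \<Rightarrow> 'x::{ab_group_add,t2_space} \<Rightarrow> 'x" +
  fixes P :: "('x \<Rightarrow> real) set"
  assumes seminorm_nonneg: "p \<in> P \<Longrightarrow> 0 \<le> p x"
    and seminorm_triangle: "p \<in> P \<Longrightarrow> p (x + y) \<le> p x + p y"
    and seminorm_scale: "p \<in> P \<Longrightarrow> p (smul c x) = cmod c * p x"
    and open_iff_seminorms:
      "open U \<longleftrightarrow> (\<forall>x\<in>U. \<exists>p\<in>P. \<exists>e>0. \<forall>y. p (y - x) < e \<longrightarrow> y \<in> U)"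
    and sequentially_complete:
      "(\<forall>p\<in>P. \<forall>e>0. \<exists>N. \<forall>k\<ge>N. \<forall>m\<ge>N. p (X k - X m) < e) \<Longrightarrow> \<exists>l. (X :: nat \<Rightarrow> 'x) \<longlonglongrightarrow> l"
begin

lemma tendsto_iff_seminorms:
  "(f \<longlongrightarrow> l) F \<longleftrightarrow> (\<forall>p\<in>P. \<forall>e>0. eventually (\<lambda>t. p (f t - l) < e) F)"
proof (intro iffI ballI allI impI)
  fix p and e :: real
  assume lim: "(f \<longlongrightarrow> l) F" and p: "p \<in> P" and e: "e > 0"
  have "open {y. p (y - l) < e}"
  proof (subst open_iff_seminorms, intro ballI)
    fix x assume "x \<in> {y. p (y - l) < e}"
    moreover have "p (y - l) \<le> p (y - x) + p (x - l)" for y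
      using seminorm_triangle[OF p, of "y - x" "x - l"] by simp
    ultimately show "\<exists>q\<in>P. \<exists>d>0. \<forall>y. q (y - x) < d \<longrightarrow> y \<in> {y. p (y - l) < e}"
      using p by (intro bexI[of _ p] exI[of _ "e - p (x - l)"]) (force intro: le_less_trans)+
  qed
  moreover have "p (l - l) = 0"
    using seminorm_scale[OF p, of 0 0] by simp
  ultimately show "eventually (\<lambda>t. p (f t - l) < e) F"
    using topological_tendstoD[OF lim, of "{y. p (y - l) < e}"] e by simp
next
  assume R: "\<forall>p\<in>P. \<forall>e>0. eventually (\<lambda>t. p (f t - l) < e) F"
  show "(f \<longlongrightarrow> l) F"
  proof (rule topological_tendstoI)
    fix S assume "open S" "l \<in> S"
    then obtain p e where "p \<in> P" "e > 0" and S: "\<And>y. p (y - l) < e \<Longrightarrow> y \<in> S"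
      using open_iff_seminorms by meson
    then have "eventually (\<lambda>t. p (f t - l) < e) F"
      using R by blast
    then show "eventually (\<lambda>t. f t \<in> S) F"
      by (rule eventually_mono) (rule S)
  qed
qed

end

definition seminorm_bounded :: "('x \<Rightarrow> real) set \<Rightarrow> 'x set \<Rightarrow> bool" where
  "seminorm_bounded P S \<longleftrightarrow> (\<forall>p\<in>P. bdd_above (p ` S))"


section \<open>Integration over compact sets\<close>

definition simple_on :: "(real^'n) set \<Rightarrow> (real^'n \<Rightarrow> 'x) \<Rightarrow> bool" where
  "simple_on K s \<longleftrightarrow> finite (s ` K) \<and> (\<forall>x. {t\<in>K. s t = x} \<in> sets lebesgue)"

definition simple_integral_on ::
    "(complex \<Rightarrow> 'x::ab_group_add \<Rightarrow> 'x) \<Rightarrow> (real^'n) set \<Rightarrow> (real^'n \<Rightarrow> 'x) \<Rightarrow> 'x" where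
  "simple_integral_on smul K s =
     (\<Sum>x\<in>s ` K. smul (of_real (measure lebesgue {t\<in>K. s t = x})) x)"

definition approximates_on ::
    "('x::{ab_group_add,t2_space} \<Rightarrow> real) set \<Rightarrow> (real^'n) set \<Rightarrow> (nat \<Rightarrow> real^'n \<Rightarrow> 'x) \<Rightarrow>
      (real^'n \<Rightarrow> 'x) \<Rightarrow> bool" where
  "approximates_on P K s f \<longleftrightarrow>
     (\<forall>k. simple_on K (s k)) \<and>
     (AE t in lebesgue. t \<in> K \<longrightarrow> (\<lambda>k. s k t) \<longlonglongrightarrow> f t) \<and>
     (\<forall>e>0. \<forall>p\<in>P. \<exists>k0. \<forall>k\<ge>k0. \<forall>m\<ge>k0.
        (\<integral>\<^sup>+t\<in>K. ennreal (p (s k t - s m t)) \<partial>lebesgue) \<le> ennreal e)"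

definition integrable_over ::
    "('x::{ab_group_add,t2_space} \<Rightarrow> real) set \<Rightarrow> (real^'n) set \<Rightarrow> (real^'n \<Rightarrow> 'x) \<Rightarrow> bool" where
  "integrable_over P K f \<longleftrightarrow> (\<exists>s. approximates_on P K s f)"

text \<open>For integrable \<open>f\<close> the limit below exists (sequential completeness) and does not depend on
  the approximating sequence.\<close>

definition integral_over ::
    "(complex \<Rightarrow> 'x \<Rightarrow> 'x) \<Rightarrow> ('x::{ab_group_add,t2_space} \<Rightarrow> real) set \<Rightarrow> (real^'n) set \<Rightarrow>
      (real^'n \<Rightarrow> 'x) \<Rightarrow> 'x" where
  "integral_over smul P K f =
     (THE I. \<exists>s. approximates_on P K s f \<and> (\<lambda>k. simple_integral_on smul K (s k)) \<longlonglongrightarrow> I)"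

text \<open>The order on \<^typ>\<open>real^'n\<close> is componentwise, so \<open>{0..}\<close> is the closed orthant
  \<open>[0,\<infinity>)\<^sup>n\<close> and \<open>{0..t}\<close> the box \<open>[0,t\<^sub>1] \<times> \<dots> \<times> [0,t\<^sub>n]\<close>. Functions on the orthant are total
  functions whose values elsewhere are never used.\<close>

definition locally_integrable_orthant ::
    "('x::{ab_group_add,t2_space} \<Rightarrow> real) set \<Rightarrow> (real^'n \<Rightarrow> 'x) \<Rightarrow> bool" where
  "locally_integrable_orthant P f \<longleftrightarrow> (\<forall>K. compact K \<and> K \<subseteq> {0..} \<longrightarrow> integrable_over P K f)"


section \<open>The multidimensional Laplace transform\<close>

definition laplace_kernel :: "complex^'n \<Rightarrow> real^'n \<Rightarrow> complex" where
  "laplace_kernel l t = exp (- (\<Sum>j\<in>UNIV. l $ j * of_real (t $ j)))"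

definition partial_laplace ::
    "(complex \<Rightarrow> 'x \<Rightarrow> 'x) \<Rightarrow> ('x::{ab_group_add,t2_space} \<Rightarrow> real) set \<Rightarrow> (real^'n \<Rightarrow> 'x) \<Rightarrow>
      complex^'n \<Rightarrow> real^'n \<Rightarrow> 'x" where
  "partial_laplace smul P f l t =
     integral_over smul P {0..t} (\<lambda>s. smul (laplace_kernel l s) (f s))"

text \<open>With respect to the componentwise order, the filter \<^const>\<open>at_top\<close> on vectors is the joint
  limit in which all components tend to infinity independently of each other.\<close>

lemma eventually_at_top_vec:
  fixes Q :: "'a::{linorder,no_top} ^'n \<Rightarrow> bool"
  shows "eventually Q at_top \<longleftrightarrow> (\<exists>M. \<forall>t. (\<forall>j. M < t $ j) \<longrightarrow> Q t)"
proof -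
  have "eventually Q at_top \<longleftrightarrow> (\<exists>k\<in>UNIV. eventually Q (principal {k..}))"
    unfolding at_top_def
  proof (rule eventually_INF_base)
    fix a b :: "'a^'n"
    have "{\<chi> j. max (a $ j) (b $ j)..} \<subseteq> {a..} \<inter> {b..}"
      by (auto simp: less_eq_vec_def)
    then show "\<exists>x\<in>UNIV. principal {x..} \<le> inf (principal {a..}) (principal {b..})"
      by auto
  qed simp
  also have "\<dots> \<longleftrightarrow> (\<exists>k. \<forall>t\<ge>k. Q t)"
    by (auto simp: eventually_principal)
  also have "\<dots> \<longleftrightarrow> (\<exists>M. \<forall>t. (\<forall>j. M < t $ j) \<longrightarrow> Q t)"
  proof
    assume "\<exists>k. \<forall>t\<ge>k. Q t"
    then obtain k where k: "\<And>t. k \<le> t \<Longrightarrow> Q t" by blast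
    have "k $ j \<le> Max (range (($) k))" for j by (rule Max_ge) auto
    then have "Q t" if "\<forall>j. Max (range (($) k)) < t $ j" for t
      using that by (intro k) (auto simp: less_eq_vec_def intro: order.trans less_imp_le)
    then show "\<exists>M. \<forall>t. (\<forall>j. M < t $ j) \<longrightarrow> Q t" by blast
  next
    assume "\<exists>M. \<forall>t. (\<forall>j. M < t $ j) \<longrightarrow> Q t"
    then obtain M where M: "\<And>t. (\<forall>j. M < t $ j) \<Longrightarrow> Q t" by blast
    obtain N where "M < N" using gt_ex by blast
    then have "Q t" if "(\<chi> j. N) \<le> t" for t
      using that by (intro M) (auto simp: less_eq_vec_def intro: less_le_trans)
    then show "\<exists>k. \<forall>t\<ge>k. Q t" by blast
  qed
  finally show ?thesis .
qed

definition laplace_region ::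
    "(complex \<Rightarrow> 'x \<Rightarrow> 'x) \<Rightarrow> ('x::{ab_group_add,t2_space} \<Rightarrow> real) set \<Rightarrow> (real^'n \<Rightarrow> 'x) \<Rightarrow>
      (complex^'n) set" where
  "laplace_region smul P f = {l. \<exists>L. (partial_laplace smul P f l \<longlongrightarrow> L) at_top}"

definition laplace ::
    "(complex \<Rightarrow> 'x \<Rightarrow> 'x) \<Rightarrow> ('x::{ab_group_add,t2_space} \<Rightarrow> real) set \<Rightarrow> (real^'n \<Rightarrow> 'x) \<Rightarrow>
      complex^'n \<Rightarrow> 'x" where
  "laplace smul P f l = Lim at_top (partial_laplace smul P f l)"

definition laplace_region_abs ::
    "(complex \<Rightarrow> 'x \<Rightarrow> 'x) \<Rightarrow> ('x \<Rightarrow> real) set \<Rightarrow> (real^'n \<Rightarrow> 'x) \<Rightarrow> (complex^'n) set" where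
  "laplace_region_abs smul P f =
     {l. \<forall>p\<in>P. (\<integral>\<^sup>+t\<in>{0..}. ennreal (p (smul (laplace_kernel l t) (f t))) \<partial>lebesgue) < \<infinity>}"

definition laplace_region_bounded ::
    "(complex \<Rightarrow> 'x \<Rightarrow> 'x) \<Rightarrow> ('x::{ab_group_add,t2_space} \<Rightarrow> real) set \<Rightarrow> (real^'n \<Rightarrow> 'x) \<Rightarrow>
      (complex^'n) set" where
  "laplace_region_bounded smul P f =
     {l. seminorm_bounded P (partial_laplace smul P f l ` {0..})}"

text \<open>The weight carries the divisors \<open>v\<^sub>j!\<close>. Differentiating the kernel \<open>v\<^sub>j\<close> times in the
  \<open>j\<close>-th variable produces the plain monomials \<open>t\<^sub>j^v\<^sub>j\<close>, so a formula for the ordinary partial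
  derivatives of the Laplace transform of \<open>f\<close> in terms of \<open>monomial_weight smul v f\<close> must
  contain the compensating factor \<open>v\<^sub>1! \<dots> v\<^sub>n!\<close>.\<close>

definition monomial_weight ::
    "(complex \<Rightarrow> 'x \<Rightarrow> 'x) \<Rightarrow> nat^'n \<Rightarrow> (real^'n \<Rightarrow> 'x) \<Rightarrow> real^'n \<Rightarrow> 'x" where
  "monomial_weight smul v f t = smul (of_real (\<Prod>j\<in>UNIV. t $ j ^ (v $ j) / fact (v $ j))) (f t)"


section \<open>Analytic functions and partial derivatives\<close>

definition polydisc :: "complex^'n \<Rightarrow> real \<Rightarrow> (complex^'n) set" where
  "polydisc z r = {w. \<forall>j. cmod (w $ j - z $ j) < r}"

definition analytic_vec_on ::
    "(complex \<Rightarrow> 'x \<Rightarrow> 'x) \<Rightarrow> ('x::{ab_group_add,t2_space} \<Rightarrow> real) set \<Rightarrow> (complex^'n) set \<Rightarrow>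
      (complex^'n \<Rightarrow> 'x) \<Rightarrow> bool" where
  "analytic_vec_on smul P U F \<longleftrightarrow>
     (\<forall>z\<in>U. \<exists>r>0. polydisc z r \<subseteq> U \<and>
        (\<exists>a :: nat^'n \<Rightarrow> 'x. \<forall>w\<in>polydisc z r.
           (let u = (\<lambda>m. smul (\<Prod>j\<in>UNIV. (w $ j - z $ j) ^ (m $ j)) (a m)) in
             (\<forall>p\<in>P. (\<lambda>m. p (u m)) summable_on UNIV) \<and> (u has_sum F w) UNIV)))"

definition has_partial_derivative ::
    "(complex \<Rightarrow> 'x \<Rightarrow> 'x) \<Rightarrow> 'n \<Rightarrow> (complex^'n \<Rightarrow> 'x::{ab_group_add,t2_space}) \<Rightarrow> complex^'n \<Rightarrow>
      'x \<Rightarrow> bool" where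
  "has_partial_derivative smul j F z D \<longleftrightarrow>
     ((\<lambda>h. smul (inverse h) (F (z + axis j h) - F z)) \<longlongrightarrow> D) (at 0)"

text \<open>The list gives the variables of differentiation, the head being the outermost; the
  intermediate derivatives have to exist in a neighbourhood of the point.\<close>

primrec has_iterated_partial ::
    "(complex \<Rightarrow> 'x \<Rightarrow> 'x) \<Rightarrow> 'n list \<Rightarrow> (complex^'n \<Rightarrow> 'x::{ab_group_add,t2_space}) \<Rightarrow> complex^'n \<Rightarrow>
      'x \<Rightarrow> bool" where
  "has_iterated_partial smul [] F z D \<longleftrightarrow> D = F z"
| "has_iterated_partial smul (j # js) F z D \<longleftrightarrow>
     (\<exists>G. (\<forall>\<^sub>F w in nhds z. has_iterated_partial smul js F w (G w)) \<and>
          has_partial_derivative smul j G z D)"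

text \<open>The finite index type carries no order; the derivative of multi-order \<open>v\<close> is required to
  exist, with the same value, for every order of differentiation.\<close>

definition has_mixed_partial ::
    "(complex \<Rightarrow> 'x \<Rightarrow> 'x) \<Rightarrow> nat^'n \<Rightarrow> (complex^'n \<Rightarrow> 'x::{ab_group_add,t2_space}) \<Rightarrow> complex^'n \<Rightarrow>
      'x \<Rightarrow> bool" where
  "has_mixed_partial smul v F z D \<longleftrightarrow>
     (\<forall>js. (\<forall>j. count_list js j = v $ j) \<longrightarrow> has_iterated_partial smul js F z D)"

end

theory Submission
  imports Defs
begin

text \<open>
  Only boundedness of the partial integrals matters. Suppose the integrals of \<open>exp(-\<mu>s) f(s)\<close> over
  the boxes \<open>[0,t]\<close> are bounded, and let \<open>z = \<mu> + (e,\<dots>,e)\<close> with \<open>e > 0\<close>. Passing from \<open>\<mu>\<close> to \<open>z\<close>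
  and inserting the weights \<open>s\<^sub>j^m\<^sub>j/m\<^sub>j!\<close> multiplies the integrand by one-variable functions
  \<open>exp(-ex) x^k/k!\<close>; each of these is \<open>1/e^k\<close> times a difference of two Poisson distribution functions, which
  decrease from 1. A decreasing function is a uniform limit of positive combinations of
  indicators of intervals \<open>[0,a]\<close>, and such an indicator merely shrinks the box, so the new
  integrals are bounded by a constant times the product of the \<open>2/e^m\<^sub>j\<close>, uniformly in \<open>t\<close>; applied to the part
  of the box beyond \<open>T\<close> the same argument gives convergence. These are Cauchy estimates for the
  Taylor coefficients at \<open>z\<close> of the partial Laplace integrals, which are entire in the parameter,
  so the Taylor series passes to the limit. The derivatives are read off the resulting power
  series, applied in turn to each \<open>f\<^sub>v\<close>. Absolute convergence is a special case of boundedness.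
\<close>

text \<open>The improper integrals may converge only conditionally, so on the orthant there is no
  integrable majorant under which to differentiate or to exchange limits. Estimates uniform in
  \<open>t\<close> must therefore bound the seminorm of an integral over a box rather than the
  integral of a seminorm. Such bounds are inherited by weights that decrease in each coordinate; the
  weight \<open>x^k exp(-e x)\<close> does not decrease, which is why distribution functions come
  in. Openness is used to push a point z of the set back along the diagonal to a point \<mu> = z -
  (e,...,e) of the same set, so that every point of the set has gained decay over another one in all
  coordinates. The constant in the resulting estimate depends on the seminorm, but the radius e does
  not; hence one polydisc serves all seminorms. Every weighted function has bounded partial
  integrals on the same open set, without shrinking it, so it is enough to find first derivatives at
  the centre of an expansion and to iterate. As the weights contain the factors 1/m!, Taylor
  coefficients are transforms up to sign, and the factorials return in the derivatives.\<close>

section \<open>Seminorms and limits in \<open>X\<close>\<close>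

context sclcs
begin

lemma seminorm_zero: "p \<in> P \<Longrightarrow> p 0 = 0"
  using seminorm_scale[of p 0 0] by simp

lemma seminorm_minus: "p \<in> P \<Longrightarrow> p (- x) = p x"
  using seminorm_scale[of p "-1" x] by simp

lemma seminorm_commute: "p \<in> P \<Longrightarrow> p (x - y) = p (y - x)"
  using seminorm_minus[of p "x - y"] by simp

lemma seminorm_diff_triangle: "p \<in> P \<Longrightarrow> p (x - z) \<le> p (x - y) + p (y - z)"
  using seminorm_triangle[of p "x - y" "y - z"] by simp

lemma seminorm_diff_le: "p \<in> P \<Longrightarrow> p (x - y) \<le> p x + p y"
  using seminorm_triangle[of p x "- y"] seminorm_minus[of p y] by simp

lemma seminorm_abs_diff: "p \<in> P \<Longrightarrow> \<bar>p x - p y\<bar> \<le> p (x - y)"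
  using seminorm_triangle[of p "x - y" y] seminorm_triangle[of p "y - x" x]
    seminorm_commute[of p x y] by (simp add: abs_le_iff)

lemma seminorm_sum: "p \<in> P \<Longrightarrow> p (\<Sum>i\<in>A. f i) \<le> (\<Sum>i\<in>A. p (f i))"
proof (induction A rule: infinite_finite_induct)
  case (insert i A)
  then show ?case
    using seminorm_triangle[of p "f i" "sum f A"] by simp
qed (simp_all add: seminorm_zero)

lemma tendsto_iff_seminorm_diff:
  "(f \<longlongrightarrow> l) F \<longleftrightarrow> (\<forall>p\<in>P. ((\<lambda>t. p (f t - l)) \<longlongrightarrow> 0) F)"
  unfolding tendsto_iff_seminorms tendsto_iff
  by (intro ball_cong refl) (simp add: seminorm_nonneg)

lemma tendsto_seminorm_diff: "(f \<longlongrightarrow> l) F \<Longrightarrow> p \<in> P \<Longrightarrow> ((\<lambda>t. p (f t - l)) \<longlongrightarrow> 0) F"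
  unfolding tendsto_iff_seminorm_diff by blast

lemma tendsto_seminormI:
  assumes "\<And>p. p \<in> P \<Longrightarrow> (g p \<longlongrightarrow> 0) F"
    and "\<And>p. p \<in> P \<Longrightarrow> eventually (\<lambda>t. p (f t - l) \<le> g p t) F"
  shows "(f \<longlongrightarrow> l) F"
  unfolding tendsto_iff_seminorm_diff
proof
  fix p assume p: "p \<in> P"
  show "((\<lambda>t. p (f t - l)) \<longlongrightarrow> 0) F"
    by (rule tendsto_sandwich[OF _ assms(2)[OF p] tendsto_const assms(1)[OF p]])
      (simp add: seminorm_nonneg p)
qed

text \<open>The type classes supply a group and a Hausdorff topology but no link between them;
  continuity of the operations has to be derived from the seminorms.\<close>

lemma tendsto_add_sclcs:
  fixes f g :: "'b \<Rightarrow> 'x"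
  assumes "(f \<longlongrightarrow> l) F" "(g \<longlongrightarrow> m) F"
  shows "((\<lambda>t. f t + g t) \<longlongrightarrow> l + m) F"
proof (rule tendsto_seminormI[where g = "\<lambda>p t. p (f t - l) + p (g t - m)"])
  fix p assume p: "p \<in> P"
  show "((\<lambda>t. p (f t - l) + p (g t - m)) \<longlongrightarrow> 0) F"
    using tendsto_add[OF assms[THEN tendsto_seminorm_diff, OF p]] by simp
  show "\<forall>\<^sub>F t in F. p (f t + g t - (l + m)) \<le> p (f t - l) + p (g t - m)"
    using seminorm_triangle[OF p, of "f _ - l" "g _ - m"]
    by (simp add: algebra_simps)
qed

lemma tendsto_scale_sclcs:
  fixes f :: "'b \<Rightarrow> 'x"
  assumes c: "(c \<longlongrightarrow> d) F" and f: "(f \<longlongrightarrow> l) F"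
  shows "((\<lambda>t. smul (c t) (f t)) \<longlongrightarrow> smul d l) F"
proof (rule tendsto_seminormI[where g = "\<lambda>p t. cmod (c t) * p (f t - l) + cmod (c t - d) * p l"])
  fix p assume p: "p \<in> P"
  have "((\<lambda>t. cmod (c t) * p (f t - l) + cmod (c t - d) * p l) \<longlongrightarrow> cmod d * 0 + cmod (d - d) * p l) F"
    by (intro tendsto_intros c tendsto_seminorm_diff[OF f p])
  then show "((\<lambda>t. cmod (c t) * p (f t - l) + cmod (c t - d) * p l) \<longlongrightarrow> 0) F"
    by simp
  have "smul (c t) (f t) - smul d l = smul (c t) (f t - l) + smul (c t - d) l" for t
    by (simp add: scale_right_diff_distrib scale_left_diff_distrib)
  then show "\<forall>\<^sub>F t in F. p (smul (c t) (f t) - smul d l)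
      \<le> cmod (c t) * p (f t - l) + cmod (c t - d) * p l"
    using seminorm_triangle[OF p] by (simp add: seminorm_scale[OF p, symmetric])
qed

lemma tendsto_diff_sclcs:
  fixes f g :: "'b \<Rightarrow> 'x"
  assumes "(f \<longlongrightarrow> l) F" "(g \<longlongrightarrow> m) F"
  shows "((\<lambda>t. f t - g t) \<longlongrightarrow> l - m) F"
  using tendsto_add_sclcs[OF assms(1) tendsto_scale_sclcs[OF tendsto_const[of "-1"] assms(2)]]
  by simp

lemma tendsto_seminorm:
  assumes "(f \<longlongrightarrow> l) F" "p \<in> P"
  shows "((\<lambda>t. p (f t)) \<longlongrightarrow> p l) F"
proof -
  have "((\<lambda>t. p (f t) - p l) \<longlongrightarrow> 0) F"
    by (rule Lim_null_comparison[OF _ tendsto_seminorm_diff[OF assms]])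
      (simp add: seminorm_abs_diff assms)
  then show ?thesis
    by (simp add: LIM_zero_iff)
qed

end

section \<open>Simple functions\<close>

text \<open>A level set of the combination is a finite union of intersections of level sets. The
  operation \<open>h\<close> is arbitrary: besides differences and scalings it is used with
  \<open>Pair\<close>, which produces the common refinement of two partitions.\<close>

lemma simple_on_comb:
  assumes "simple_on K s" "simple_on K r"
  shows "simple_on K (\<lambda>t. h (s t) (r t))"
proof -
  let ?A = "s ` K \<times> r ` K"
  have fin: "finite ?A"
    using assms by (simp add: simple_on_def)
  have "(\<lambda>t. h (s t) (r t)) ` K \<subseteq> (\<lambda>(a, b). h a b) ` ?A"
    by (auto simp: image_iff)+
  then have "finite ((\<lambda>t. h (s t) (r t)) ` K)"
    by (rule finite_subset[OF _ finite_imageI[OF fin]])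
  moreover have "{t\<in>K. h (s t) (r t) = x} \<in> sets lebesgue" for x
  proof -
    have "{t\<in>K. h (s t) (r t) = x} =
        (\<Union>y\<in>{y\<in>?A. h (fst y) (snd y) = x}. {t\<in>K. s t = fst y} \<inter> {t\<in>K. r t = snd y})"
      by fastforce
    moreover have "\<dots> \<in> sets lebesgue"
      using assms fin unfolding simple_on_def by (intro sets.finite_UN sets.Int) auto
    ultimately show ?thesis
      by (simp only:)
  qed
  ultimately show ?thesis
    by (simp add: simple_on_def)
qed

lemma simple_on_compose: "simple_on K s \<Longrightarrow> simple_on K (\<lambda>t. h (s t))"
  using simple_on_comb[of K s s "\<lambda>x _. h x"] by simp

lemma simple_on_subset:
  assumes "simple_on K s" "J \<subseteq> K" "J \<in> sets lebesgue"
  shows "simple_on J s"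
proof -
  have "{t\<in>J. s t = x} = J \<inter> {t\<in>K. s t = x}" for x
    using assms by auto
  moreover have "finite (s ` J)"
    using assms(1) finite_subset[OF image_mono[OF assms(2)], of s] by (simp add: simple_on_def)
  ultimately show ?thesis
    using assms by (auto simp: simple_on_def intro!: sets.Int)
qed

lemma simple_on_indicator:
  assumes K: "K \<in> sets lebesgue" and J: "J \<subseteq> K" "J \<in> sets lebesgue"
  shows "simple_on K (indicator J :: _ \<Rightarrow> complex)"
proof -
  have "{t\<in>K. indicator J t = x} = (if x = 1 then J else if x = 0 then K - J else {})"
    for x :: complex
    using J(1) by (auto simp: indicator_def)
  then show ?thesis
    using J K unfolding simple_on_def
    by (auto intro: finite_subset[of _ "{0,1}"] simp: indicator_def)
qed

text \<open>Reduces \<open>q (s t)\<close> to indicators of level sets, so that it can be measured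
  and integrated although \<open>q\<close> is an arbitrary function on a type without a
  sigma-algebra.\<close>

lemma simple_on_indicator_expansion:
  fixes q :: "'y \<Rightarrow> ennreal"
  assumes "simple_on K s"
  shows "q (s t) * indicator K t = (\<Sum>y\<in>s ` K. q y * indicator {t\<in>K. s t = y} t)"
proof (cases "t \<in> K")
  case True
  have "(\<Sum>y\<in>s ` K. q y * indicator {t\<in>K. s t = y} t)
      = (\<Sum>y\<in>s ` K. if y = s t then q y else 0)"
    using True by (intro sum.cong) (auto simp: indicator_def)
  then show ?thesis
    using True assms by (simp add: simple_on_def)
qed simp

lemma simple_on_measurable:
  fixes q :: "'y \<Rightarrow> ennreal"
  assumes s: "simple_on K s"
  shows "(\<lambda>t. q (s t) * indicator K t) \<in> borel_measurable lebesgue"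
  unfolding simple_on_indicator_expansion[OF s, of q]
  using s by (intro borel_measurable_sum borel_measurable_times_ennreal borel_measurable_const
      borel_measurable_indicator) (auto simp: simple_on_def)

lemma nn_integral_simple_on:
  fixes q :: "'y \<Rightarrow> ennreal"
  assumes s: "simple_on K s"
  shows "(\<integral>\<^sup>+t\<in>K. q (s t) \<partial>lebesgue) = (\<Sum>y\<in>s ` K. q y * emeasure lebesgue {t\<in>K. s t = y})"
  unfolding simple_on_indicator_expansion[OF s, of q]
  using s by (subst nn_integral_sum)
    (auto simp: simple_on_def nn_integral_cmult_indicator
      intro!: borel_measurable_times_ennreal borel_measurable_indicator)

context sclcs
begin

text \<open>The integral may be computed over any partition finer than that into level sets: group
  the values \<open>y\<close> of \<open>r\<close> by \<open>h y\<close>. With a pair for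
  \<open>r\<close> this yields additivity.\<close>

lemma simple_integral_compose:
  assumes r: "simple_on K r" and K: "K \<in> lmeasurable"
  shows "simple_integral_on smul K (\<lambda>t. h (r t))
    = (\<Sum>y\<in>r ` K. smul (of_real (measure lebesgue {t\<in>K. r t = y})) (h y))"
proof -
  have fin: "finite (r ` K)" and ms: "\<And>y. {t\<in>K. r t = y} \<in> sets lebesgue"
    using r by (auto simp: simple_on_def)
  have lm: "{t\<in>K. r t = y} \<in> lmeasurable" for y
    by (rule fmeasurableI2[OF K _ ms]) auto
  have m: "measure lebesgue {t\<in>K. h (r t) = x}
      = (\<Sum>y\<in>{y\<in>r ` K. h y = x}. measure lebesgue {t\<in>K. r t = y})" for x
  proof -
    have "{t\<in>K. h (r t) = x} = (\<Union>y\<in>{y\<in>r ` K. h y = x}. {t\<in>K. r t = y})"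
      by auto
    then show ?thesis
      using measure_finite_Union[of "{y\<in>r ` K. h y = x}" "\<lambda>y. {t\<in>K. r t = y}" lebesgue] fin ms
        fmeasurableD2[OF lm] by (auto simp: disjoint_family_on_def)
  qed
  have "simple_integral_on smul K (\<lambda>t. h (r t)) =
      (\<Sum>x\<in>h ` (r ` K). \<Sum>y\<in>{y\<in>r ` K. h y = x}.
         smul (of_real (measure lebesgue {t\<in>K. r t = y})) (h y))"
    unfolding simple_integral_on_def m
    by (intro sum.cong) (auto simp: scale_sum_left image_image)
  also have "\<dots> = (\<Sum>y\<in>r ` K. smul (of_real (measure lebesgue {t\<in>K. r t = y})) (h y))"
    using sum.group[OF fin finite_imageI[OF fin] subset_refl,
      where g = h and h = "\<lambda>y. smul (of_real (measure lebesgue {t\<in>K. r t = y})) (h y)"]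
    by (simp add: image_image)
  finally show ?thesis .
qed

lemma simple_integral_add:
  assumes "simple_on K s" "simple_on K r" and K: "K \<in> lmeasurable"
  shows "simple_integral_on smul K (\<lambda>t. s t + r t)
    = simple_integral_on smul K s + simple_integral_on smul K r"
proof -
  have sr: "simple_on K (\<lambda>t. (s t, r t))"
    by (rule simple_on_comb[OF assms(1,2)])
  show ?thesis
    using simple_integral_compose[OF sr K, of "\<lambda>y. fst y + snd y"]
      simple_integral_compose[OF sr K, of fst] simple_integral_compose[OF sr K, of snd]
    by (simp add: sum.distrib scale_right_distrib)
qed

lemma simple_integral_scale:
  assumes s: "simple_on K s" and K: "K \<in> lmeasurable"
  shows "simple_integral_on smul K (\<lambda>t. smul c (s t)) = smul c (simple_integral_on smul K s)"
  using simple_integral_compose[OF s K, of "smul c"] simple_integral_compose[OF s K, of "\<lambda>x. x"]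
  by (simp add: scale_sum_right mult.commute)

lemma simple_integral_diff:
  assumes "simple_on K s" "simple_on K r" and K: "K \<in> lmeasurable"
  shows "simple_integral_on smul K (\<lambda>t. s t - r t)
    = simple_integral_on smul K s - simple_integral_on smul K r"
  using simple_integral_add[OF assms(1) simple_on_compose[OF assms(2), of "smul (-1)"] K]
    simple_integral_scale[OF assms(2) K, of "-1"] by simp

lemma seminorm_simple_integral:
  assumes s: "simple_on K s" and K: "K \<in> lmeasurable" and p: "p \<in> P"
  shows "ennreal (p (simple_integral_on smul K s)) \<le> (\<integral>\<^sup>+t\<in>K. ennreal (p (s t)) \<partial>lebesgue)"
proof -
  have lm: "{t\<in>K. s t = y} \<in> lmeasurable" for y
    by (rule fmeasurableI2[OF K]) (use s in \<open>auto simp: simple_on_def\<close>)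
  have "p (simple_integral_on smul K s) \<le> (\<Sum>y\<in>s ` K. measure lebesgue {t\<in>K. s t = y} * p y)"
    unfolding simple_integral_on_def
    by (rule order.trans[OF seminorm_sum[OF p]]) (simp add: seminorm_scale[OF p])
  then have "ennreal (p (simple_integral_on smul K s))
      \<le> ennreal (\<Sum>y\<in>s ` K. measure lebesgue {t\<in>K. s t = y} * p y)"
    by (rule ennreal_leI)
  also have "\<dots> = (\<Sum>y\<in>s ` K. ennreal (p y) * emeasure lebesgue {t\<in>K. s t = y})"
    by (subst sum_ennreal[symmetric])
      (auto simp: seminorm_nonneg[OF p] ennreal_mult emeasure_eq_measure2 lm mult.commute
        intro!: sum.cong)
  also have "\<dots> = (\<integral>\<^sup>+t\<in>K. ennreal (p (s t)) \<partial>lebesgue)"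
    by (rule nn_integral_simple_on[OF s, symmetric])
  finally show ?thesis .
qed

lemma simple_integral_subset:
  assumes s: "simple_on K s" and J: "J \<subseteq> K" "J \<in> sets lebesgue" and K: "K \<in> lmeasurable"
  shows "simple_integral_on smul K (\<lambda>t. smul (indicator J t) (s t)) = simple_integral_on smul J s"
proof -
  have sJ: "simple_on K (\<lambda>t. (s t, indicator J t :: complex))"
    by (rule simple_on_comb[where h = Pair, OF s simple_on_indicator[OF fmeasurableD[OF K] J]])
  have fin: "finite ((\<lambda>t. (s t, indicator J t :: complex)) ` K)"
    using sJ by (simp add: simple_on_def)
  have "simple_integral_on smul K (\<lambda>t. smul (indicator J t) (s t))
    = (\<Sum>y\<in>(\<lambda>t. (s t, indicator J t)) ` K.
        smul (of_real (measure lebesgue {t\<in>K. (s t, indicator J t) = y})) (smul (snd y) (fst y)))"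
    using simple_integral_compose[OF sJ K, of "\<lambda>y. smul (snd y) (fst y)"] by simp
  \<comment> \<open>Pairs with second component 0 come from points outside \<open>J\<close> and
    contribute nothing.\<close>
  also have "\<dots> = (\<Sum>y\<in>(\<lambda>t. (s t, 1 :: complex)) ` J.
        smul (of_real (measure lebesgue {t\<in>K. (s t, indicator J t) = y})) (smul (snd y) (fst y)))"
    using J(1) by (intro sum.mono_neutral_right fin) (auto simp: indicator_def image_iff)
  also have "\<dots> = (\<Sum>y\<in>(\<lambda>t. (s t, 1 :: complex)) ` J.
        smul (of_real (measure lebesgue {t\<in>J. s t = fst y})) (fst y))"
  proof (intro sum.cong refl)
    fix y :: "'x \<times> complex" assume "y \<in> (\<lambda>t. (s t, 1 :: complex)) ` J"
    then have "snd y = 1" "{t\<in>K. (s t, indicator J t) = y} = {t\<in>J. s t = fst y}"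
      using J(1) by (auto simp: indicator_def split: if_splits)
    then show "smul (of_real (measure lebesgue {t\<in>K. (s t, indicator J t) = y})) (smul (snd y) (fst y))
        = smul (of_real (measure lebesgue {t\<in>J. s t = fst y})) (fst y)"
      by simp
  qed
  also have "\<dots> = simple_integral_on smul J s"
    unfolding simple_integral_on_def
    by (rule sum.reindex_cong[of "\<lambda>x. (x, 1)"]) (auto simp: inj_on_def image_iff)
  finally show ?thesis .
qed

end

section \<open>The integral\<close>

text \<open>Completeness of Lebesgue measure: the preimages under \<open>f\<close> and
  \<open>g\<close> differ by a null set.\<close>

lemma borel_measurable_lebesgue_AE_eq:
  fixes f g :: "'a::euclidean_space \<Rightarrow> 'b::topological_space"
  assumes g: "g \<in> borel_measurable lebesgue" and ae: "AE x in lebesgue. f x = g x"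
  shows "f \<in> borel_measurable lebesgue"
proof (rule measurableI)
  fix A :: "'b set" assume "A \<in> sets borel"
  then have 1: "g -` A \<inter> space lebesgue \<in> sets lebesgue"
    by (rule measurable_sets[OF g])
  have 2: "AE x in lebesgue. x \<in> g -` A \<inter> space lebesgue \<longleftrightarrow> x \<in> f -` A \<inter> space lebesgue"
    using ae by eventually_elim simp
  show "f -` A \<inter> space lebesgue \<in> sets lebesgue"
    by (rule completion.in_sets_AE[OF 2 1]) simp
qed simp

text \<open>Rounding to the Gaussian integers divided by \<open>k + 1\<close>. After a bounded
  measurable function it gives simple functions that converge uniformly.\<close>

definition round_down :: "nat \<Rightarrow> complex \<Rightarrow> complex" where
  "round_down k z =
     Complex (of_int \<lfloor>real (Suc k) * Re z\<rfloor> / real (Suc k)) (of_int \<lfloor>real (Suc k) * Im z\<rfloor> / real (Suc k))"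

lemma round_down_error: "cmod (round_down k z - z) \<le> 2 / real (Suc k)"
proof -
  have *: "\<bar>of_int \<lfloor>real (Suc k) * x\<rfloor> / real (Suc k) - x\<bar> \<le> 1 / real (Suc k)" for x
  proof -
    have "\<bar>of_int \<lfloor>real (Suc k) * x\<rfloor> - real (Suc k) * x\<bar> \<le> 1"
      by linarith
    then have "\<bar>of_int \<lfloor>real (Suc k) * x\<rfloor> - real (Suc k) * x\<bar> / real (Suc k) \<le> 1 / real (Suc k)"
      by (rule divide_right_mono) simp
    also have "\<bar>of_int \<lfloor>real (Suc k) * x\<rfloor> - real (Suc k) * x\<bar> / real (Suc k)
        = \<bar>(of_int \<lfloor>real (Suc k) * x\<rfloor> - real (Suc k) * x) / real (Suc k)\<bar>"
      by (simp add: abs_divide)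
    also have "(of_int \<lfloor>real (Suc k) * x\<rfloor> - real (Suc k) * x) / real (Suc k)
        = of_int \<lfloor>real (Suc k) * x\<rfloor> / real (Suc k) - x"
      by (simp add: diff_divide_distrib)
    finally show ?thesis .
  qed
  have "cmod (round_down k z - z) \<le> 1 / real (Suc k) + 1 / real (Suc k)"
    using cmod_le[of "round_down k z - z"] *[of "Re z"] *[of "Im z"]
    by (simp add: round_down_def)
  then show ?thesis by simp
qed

lemma round_down_tendsto: "(\<lambda>k. round_down k z) \<longlonglongrightarrow> z"
proof -
  have "(\<lambda>k. 2 / real (Suc k)) \<longlonglongrightarrow> 0"
    using tendsto_mult[OF tendsto_const[of 2] LIMSEQ_inverse_real_of_nat] by (simp add: divide_inverse)
  then have "(\<lambda>k. round_down k z - z) \<longlonglongrightarrow> 0"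
    by (rule Lim_null_comparison[rotated]) (intro always_eventually allI round_down_error)
  then show ?thesis
    by (simp add: LIM_zero_iff)
qed

lemma round_down_measurable: "round_down k \<in> borel_measurable borel"
  unfolding round_down_def Complex_eq by measurable

lemma simple_on_round_down:
  assumes phi: "\<phi> \<in> borel_measurable lebesgue" and K: "K \<in> sets lebesgue"
    and B: "\<And>t. t \<in> K \<Longrightarrow> cmod (\<phi> t) \<le> B"
  shows "simple_on K (\<lambda>t. round_down k (\<phi> t))"
  unfolding simple_on_def
proof
  define c where "c = \<lceil>real (Suc k) * B\<rceil> + 1"
  have fl: "\<lfloor>real (Suc k) * x\<rfloor> \<in> {-c..c}" if "\<bar>x\<bar> \<le> B" for x
  proof -
    have "real (Suc k) * \<bar>x\<bar> \<le> real (Suc k) * B"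
      using that by (intro mult_left_mono) auto
    then have "\<bar>real (Suc k) * x\<bar> \<le> real (Suc k) * B"
      by (simp add: abs_mult)
    then show ?thesis
      unfolding c_def atLeastAtMost_iff by linarith
  qed
  have "(\<lambda>t. round_down k (\<phi> t)) ` K \<subseteq>
      (\<lambda>(a, b). Complex (of_int a / real (Suc k)) (of_int b / real (Suc k))) ` ({-c..c} \<times> {-c..c})"
  proof
    fix z assume "z \<in> (\<lambda>t. round_down k (\<phi> t)) ` K"
    then obtain t where t: "t \<in> K" "z = round_down k (\<phi> t)" by auto
    have "\<bar>Re (\<phi> t)\<bar> \<le> B" "\<bar>Im (\<phi> t)\<bar> \<le> B"
      using B[OF t(1)] abs_Re_le_cmod[of "\<phi> t"] abs_Im_le_cmod[of "\<phi> t"] by linarith+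
    then have "(\<lfloor>real (Suc k) * Re (\<phi> t)\<rfloor>, \<lfloor>real (Suc k) * Im (\<phi> t)\<rfloor>) \<in> {-c..c} \<times> {-c..c}"
      using fl by blast
    then show "z \<in> (\<lambda>(a, b). Complex (of_int a / real (Suc k)) (of_int b / real (Suc k))) ` ({-c..c} \<times> {-c..c})"
      unfolding t(2) round_down_def by (rule rev_image_eqI) simp
  qed
  then show "finite ((\<lambda>t. round_down k (\<phi> t)) ` K)"
    by (rule finite_subset) simp
  show "\<forall>x. {t\<in>K. round_down k (\<phi> t) = x} \<in> sets lebesgue"
  proof
    fix x
    have "(\<lambda>t. round_down k (\<phi> t)) \<in> borel_measurable lebesgue"
      using measurable_compose[OF phi round_down_measurable] .
    then have "(\<lambda>t. round_down k (\<phi> t)) -` {x} \<inter> space lebesgue \<in> sets lebesgue"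
      by (rule measurable_sets) simp
    then have "K \<inter> ((\<lambda>t. round_down k (\<phi> t)) -` {x} \<inter> space lebesgue) \<in> sets lebesgue"
      using K by (rule sets.Int[rotated])
    also have "K \<inter> ((\<lambda>t. round_down k (\<phi> t)) -` {x} \<inter> space lebesgue) = {t\<in>K. round_down k (\<phi> t) = x}"
      by auto
    finally show "{t\<in>K. round_down k (\<phi> t) = x} \<in> sets lebesgue" .
  qed
qed

section \<open>Existence, uniqueness and seminorm bounds of the integral\<close>

context sclcs
begin

text \<open>Almost everywhere on \<open>K\<close>, \<open>p (g t)\<close> is the limit inferior of
  the measurable functions \<open>p (d m t)\<close>. This settles measurability with no measurable
  structure on the space, and Fatou's lemma gives the bound.\<close>

lemma seminorm_limit_simple:
  assumes d: "\<And>m. simple_on K (d m)" and lim: "AE t in lebesgue. t \<in> K \<longrightarrow> (\<lambda>m. d m t) \<longlonglongrightarrow> g t"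
    and p: "p \<in> P"
  shows "(\<lambda>t. ennreal (p (g t)) * indicator K t) \<in> borel_measurable lebesgue"
    and "(\<And>m. m \<ge> m0 \<Longrightarrow> (\<integral>\<^sup>+t\<in>K. ennreal (p (d m t)) \<partial>lebesgue) \<le> e) \<Longrightarrow>
      (\<integral>\<^sup>+t\<in>K. ennreal (p (g t)) \<partial>lebesgue) \<le> e"
proof -
  define u where "u = (\<lambda>m t. ennreal (p (d m t)) * indicator K t)"
  have u: "u m \<in> borel_measurable lebesgue" for m
    unfolding u_def by (rule simple_on_measurable[OF d])
  have ae: "AE t in lebesgue. ennreal (p (g t)) * indicator K t = liminf (\<lambda>m. u m t)"
    using lim
  proof eventually_elim
    case (elim t)
    have "(\<lambda>m. u m t) \<longlonglongrightarrow> ennreal (p (g t)) * indicator K t"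
    proof (cases "t \<in> K")
      case True
      then have "(\<lambda>m. p (d m t)) \<longlonglongrightarrow> p (g t)"
        using elim by (intro tendsto_seminorm[OF _ p]) simp
      then show ?thesis
        using True by (simp add: u_def tendsto_ennrealI)
    qed (simp add: u_def)
    then show ?case
      by (simp add: lim_imp_Liminf)
  qed
  have "(\<lambda>t. liminf (\<lambda>m. u m t)) \<in> borel_measurable lebesgue"
    using u by measurable
  then show "(\<lambda>t. ennreal (p (g t)) * indicator K t) \<in> borel_measurable lebesgue"
    using ae by (rule borel_measurable_lebesgue_AE_eq)
  assume le: "\<And>m. m \<ge> m0 \<Longrightarrow> (\<integral>\<^sup>+t\<in>K. ennreal (p (d m t)) \<partial>lebesgue) \<le> e"
  have "(\<integral>\<^sup>+t\<in>K. ennreal (p (g t)) \<partial>lebesgue) = (\<integral>\<^sup>+t. liminf (\<lambda>m. u m t) \<partial>lebesgue)"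
    using ae by (rule nn_integral_cong_AE)
  also have "\<dots> \<le> liminf (\<lambda>m. integral\<^sup>N lebesgue (u m))"
    by (rule nn_integral_liminf[OF u])
  also have "\<dots> \<le> liminf (\<lambda>m. e)"
    by (rule Liminf_mono) (use le in \<open>auto simp: u_def eventually_sequentially\<close>)
  also have "\<dots> = e"
    by (simp add: Liminf_const)
  finally show "(\<integral>\<^sup>+t\<in>K. ennreal (p (g t)) \<partial>lebesgue) \<le> e" .
qed

lemma approximates_seminorm_measurable:
  assumes "approximates_on P K s f" "p \<in> P"
  shows "(\<lambda>t. ennreal (p (f t)) * indicator K t) \<in> borel_measurable lebesgue"
  by (rule seminorm_limit_simple(1)[of _ s]) (use assms in \<open>auto simp: approximates_on_def\<close>)

lemma approximates_diff_measurable: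
  assumes a: "approximates_on P K s f" and p: "p \<in> P"
  shows "(\<lambda>t. ennreal (p (f t - s k t)) * indicator K t) \<in> borel_measurable lebesgue"
proof (rule seminorm_limit_simple(1)[OF _ _ p, of K "\<lambda>m t. s m t - s k t"])
  show "simple_on K (\<lambda>t. s m t - s k t)" for m
    using a by (intro simple_on_comb[where h = "(-)"]) (auto simp: approximates_on_def)
  have "AE t in lebesgue. t \<in> K \<longrightarrow> (\<lambda>m. s m t) \<longlonglongrightarrow> f t"
    using a by (simp add: approximates_on_def)
  then show "AE t in lebesgue. t \<in> K \<longrightarrow> (\<lambda>m. s m t - s k t) \<longlonglongrightarrow> f t - s k t"
    by eventually_elim (auto intro: tendsto_diff_sclcs)
qed

text \<open>Letting one index of the Cauchy condition tend to infinity, by Fatou's lemma, turns it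
  into convergence in mean to \<open>f\<close>.\<close>

lemma approximates_L1:
  assumes a: "approximates_on P K s f" and p: "p \<in> P" and e: "e > 0"
  shows "\<exists>k0. \<forall>k\<ge>k0. (\<integral>\<^sup>+t\<in>K. ennreal (p (f t - s k t)) \<partial>lebesgue) \<le> ennreal e"
proof -
  obtain k0 where k0: "\<And>k m. k \<ge> k0 \<Longrightarrow> m \<ge> k0 \<Longrightarrow>
      (\<integral>\<^sup>+t\<in>K. ennreal (p (s k t - s m t)) \<partial>lebesgue) \<le> ennreal e"
    using a p e unfolding approximates_on_def by meson
  have "(\<integral>\<^sup>+t\<in>K. ennreal (p (f t - s k t)) \<partial>lebesgue) \<le> ennreal e" if k: "k \<ge> k0" for k
  proof (rule seminorm_limit_simple(2)[OF _ _ p, of K "\<lambda>m t. s m t - s k t" _ k0])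
    show "simple_on K (\<lambda>t. s m t - s k t)" for m
      using a by (intro simple_on_comb[where h = "(-)"]) (auto simp: approximates_on_def)
    have "AE t in lebesgue. t \<in> K \<longrightarrow> (\<lambda>m. s m t) \<longlonglongrightarrow> f t"
      using a by (simp add: approximates_on_def)
    then show "AE t in lebesgue. t \<in> K \<longrightarrow> (\<lambda>m. s m t - s k t) \<longlonglongrightarrow> f t - s k t"
      by eventually_elim (auto intro: tendsto_diff_sclcs)
  qed (use k0 k in blast)
  then show ?thesis by blast
qed

lemma nn_integral_seminorm_triangle:
  assumes p: "p \<in> P" and le: "\<And>t. t \<in> K \<Longrightarrow> p (h t) \<le> p (f t) + p (g t)"
    and f: "(\<lambda>t. ennreal (p (f t)) * indicator K t) \<in> borel_measurable lebesgue"
    and g: "(\<lambda>t. ennreal (p (g t)) * indicator K t) \<in> borel_measurable lebesgue"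
  shows "(\<integral>\<^sup>+t\<in>K. ennreal (p (h t)) \<partial>lebesgue)
    \<le> (\<integral>\<^sup>+t\<in>K. ennreal (p (f t)) \<partial>lebesgue) + (\<integral>\<^sup>+t\<in>K. ennreal (p (g t)) \<partial>lebesgue)"
proof -
  have "(\<integral>\<^sup>+t\<in>K. ennreal (p (h t)) \<partial>lebesgue)
    \<le> (\<integral>\<^sup>+t. ennreal (p (f t)) * indicator K t + ennreal (p (g t)) * indicator K t \<partial>lebesgue)"
    using ennreal_leI[OF le]
    by (intro nn_integral_mono) (auto simp: indicator_def ennreal_plus[symmetric] seminorm_nonneg[OF p]
        simp del: ennreal_plus)
  then show ?thesis
    by (simp add: nn_integral_add[OF f g])
qed

text \<open>Both sequences converge in mean to \<open>f\<close>, so their integrals differ by a null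
  sequence. Two errors \<open>e/3\<close> leave room for the strict inequality.\<close>

lemma approximates_unique:
  assumes s: "approximates_on P K s f" and r: "approximates_on P K r f" and K: "K \<in> lmeasurable"
    and I: "(\<lambda>k. simple_integral_on smul K (s k)) \<longlonglongrightarrow> I"
  shows "(\<lambda>k. simple_integral_on smul K (r k)) \<longlonglongrightarrow> I"
proof -
  have simp_s: "simple_on K (s k)" and simp_r: "simple_on K (r k)" for k
    using s r by (auto simp: approximates_on_def)
  have "(\<lambda>k. simple_integral_on smul K (r k) - simple_integral_on smul K (s k)) \<longlonglongrightarrow> 0"
    unfolding tendsto_iff_seminorms
  proof (intro ballI allI impI)
    fix p and e :: real assume p: "p \<in> P" and e: "e > 0"
    obtain k1 where k1: "\<And>k. k \<ge> k1 \<Longrightarrow> (\<integral>\<^sup>+t\<in>K. ennreal (p (f t - s k t)) \<partial>lebesgue) \<le> ennreal (e/3)"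
      using approximates_L1[OF s p, of "e/3"] e by auto
    obtain k2 where k2: "\<And>k. k \<ge> k2 \<Longrightarrow> (\<integral>\<^sup>+t\<in>K. ennreal (p (f t - r k t)) \<partial>lebesgue) \<le> ennreal (e/3)"
      using approximates_L1[OF r p, of "e/3"] e by auto
    have "p (simple_integral_on smul K (r k) - simple_integral_on smul K (s k) - 0) < e"
      if k: "k \<ge> max k1 k2" for k
    proof -
      have "ennreal (p (simple_integral_on smul K (r k) - simple_integral_on smul K (s k)))
          \<le> (\<integral>\<^sup>+t\<in>K. ennreal (p (r k t - s k t)) \<partial>lebesgue)"
        using seminorm_simple_integral[OF simple_on_comb[where h = "(-)", OF simp_r simp_s] K p] simple_integral_diff[OF simp_r simp_s K] by simp
      also have "\<dots> \<le> (\<integral>\<^sup>+t\<in>K. ennreal (p (f t - s k t)) \<partial>lebesgue)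
          + (\<integral>\<^sup>+t\<in>K. ennreal (p (f t - r k t)) \<partial>lebesgue)"
        using seminorm_diff_triangle[OF p, of "r k t" "s k t" "f t" for t] seminorm_commute[OF p, of "r k t" "f t" for t]
        by (intro nn_integral_seminorm_triangle p approximates_diff_measurable s r)
          (simp add: add.commute)
      also have "\<dots> \<le> ennreal (e/3) + ennreal (e/3)"
        using k by (intro add_mono k1 k2) auto
      also have "\<dots> = ennreal (e/3 + e/3)"
        using e by (intro ennreal_plus[symmetric]) auto
      finally have "p (simple_integral_on smul K (r k) - simple_integral_on smul K (s k)) \<le> e/3 + e/3"
        using e by (subst (asm) ennreal_le_iff) auto
      then show ?thesis using e by simp
    qed
    then show "\<forall>\<^sub>F k in sequentially.
        p (simple_integral_on smul K (r k) - simple_integral_on smul K (s k) - 0) < e"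
      unfolding eventually_sequentially by blast
  qed
  from tendsto_add_sclcs[OF this I] show ?thesis by simp
qed

text \<open>The seminorm of a difference of simple integrals is at most the mean distance of the
  simple functions, so the integrals are Cauchy and sequential completeness applies.\<close>

lemma approximates_convergent:
  assumes s: "approximates_on P K s f" and K: "K \<in> lmeasurable"
  shows "\<exists>I. (\<lambda>k. simple_integral_on smul K (s k)) \<longlonglongrightarrow> I"
proof (rule sequentially_complete, intro ballI allI impI)
  have simp_s: "simple_on K (s k)" for k
    using s by (auto simp: approximates_on_def)
  fix p and e :: real assume p: "p \<in> P" and e: "e > 0"
  then have "e / 2 > 0" by simp
  then obtain k0 where k0: "\<And>k m. k \<ge> k0 \<Longrightarrow> m \<ge> k0 \<Longrightarrow>
      (\<integral>\<^sup>+t\<in>K. ennreal (p (s k t - s m t)) \<partial>lebesgue) \<le> ennreal (e / 2)"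
    using s p unfolding approximates_on_def by meson
  have "p (simple_integral_on smul K (s k) - simple_integral_on smul K (s m)) < e"
    if "k \<ge> k0" "m \<ge> k0" for k m
  proof -
    have "ennreal (p (simple_integral_on smul K (s k) - simple_integral_on smul K (s m)))
        \<le> (\<integral>\<^sup>+t\<in>K. ennreal (p (s k t - s m t)) \<partial>lebesgue)"
      using seminorm_simple_integral[OF simple_on_comb[where h = "(-)", OF simp_s simp_s] K p] simple_integral_diff[OF simp_s simp_s K] by simp
    also have "\<dots> \<le> ennreal (e / 2)"
      by (rule k0[OF that])
    finally show ?thesis
      using e by (subst (asm) ennreal_le_iff) auto
  qed
  then show "\<exists>N. \<forall>k\<ge>N. \<forall>m\<ge>N. p (simple_integral_on smul K (s k) - simple_integral_on smul K (s m)) < e"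
    by blast
qed

lemma integral_over_tendsto:
  assumes s: "approximates_on P K s f" and K: "K \<in> lmeasurable"
  shows "(\<lambda>k. simple_integral_on smul K (s k)) \<longlonglongrightarrow> integral_over smul P K f"
proof -
  obtain I where I: "(\<lambda>k. simple_integral_on smul K (s k)) \<longlonglongrightarrow> I"
    using approximates_convergent[OF s K] by blast
  have "integral_over smul P K f = I"
    unfolding integral_over_def
  proof (rule the_equality)
    show "\<exists>s. approximates_on P K s f \<and> (\<lambda>k. simple_integral_on smul K (s k)) \<longlonglongrightarrow> I"
      using s I by blast
    fix I' assume "\<exists>s. approximates_on P K s f \<and> (\<lambda>k. simple_integral_on smul K (s k)) \<longlonglongrightarrow> I'"
    then obtain r where r: "approximates_on P K r f" and I': "(\<lambda>k. simple_integral_on smul K (r k)) \<longlonglongrightarrow> I'"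
      by blast
    show "I' = I"
      by (rule LIMSEQ_unique[OF I' approximates_unique[OF s r K I]])
  qed
  then show ?thesis using I by simp
qed

lemma integral_over_eqI:
  assumes "approximates_on P K s f" "K \<in> lmeasurable"
    and "(\<lambda>k. simple_integral_on smul K (s k)) \<longlonglongrightarrow> I"
  shows "integral_over smul P K f = I"
  by (rule LIMSEQ_unique[OF integral_over_tendsto[OF assms(1,2)] assms(3)])

lemma seminorm_integral_le:
  assumes f: "integrable_over P K f" and K: "K \<in> lmeasurable" and p: "p \<in> P"
  shows "ennreal (p (integral_over smul P K f)) \<le> (\<integral>\<^sup>+t\<in>K. ennreal (p (f t)) \<partial>lebesgue)"
proof (rule ennreal_le_epsilon)
  fix e :: real assume e: "0 < e"
    and fin: "(\<integral>\<^sup>+t\<in>K. ennreal (p (f t)) \<partial>lebesgue) < top"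
  obtain s where s: "approximates_on P K s f"
    using f by (auto simp: integrable_over_def)
  have simp_s: "simple_on K (s k)" for k
    using s by (auto simp: approximates_on_def)
  obtain k0 where k0: "\<And>k. k \<ge> k0 \<Longrightarrow> (\<integral>\<^sup>+t\<in>K. ennreal (p (f t - s k t)) \<partial>lebesgue) \<le> ennreal e"
    using approximates_L1[OF s p e] by auto
  have "(\<lambda>k. ennreal (p (simple_integral_on smul K (s k)))) \<longlonglongrightarrow> ennreal (p (integral_over smul P K f))"
    by (intro tendsto_ennrealI tendsto_seminorm[OF integral_over_tendsto[OF s K] p])
  moreover have "ennreal (p (simple_integral_on smul K (s k)))
      \<le> (\<integral>\<^sup>+t\<in>K. ennreal (p (f t)) \<partial>lebesgue) + ennreal e" if k: "k \<ge> k0" for k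
  proof -
    have "ennreal (p (simple_integral_on smul K (s k))) \<le> (\<integral>\<^sup>+t\<in>K. ennreal (p (s k t)) \<partial>lebesgue)"
      by (rule seminorm_simple_integral[OF simp_s K p])
    also have "\<dots> \<le> (\<integral>\<^sup>+t\<in>K. ennreal (p (f t)) \<partial>lebesgue)
        + (\<integral>\<^sup>+t\<in>K. ennreal (p (f t - s k t)) \<partial>lebesgue)"
      using seminorm_diff_le[OF p, of "f t" "f t - s k t" for t]
      by (intro nn_integral_seminorm_triangle p approximates_diff_measurable[OF s]
          approximates_seminorm_measurable[OF s]) simp
    also have "\<dots> \<le> (\<integral>\<^sup>+t\<in>K. ennreal (p (f t)) \<partial>lebesgue) + ennreal e"
      by (intro add_mono k0 k order.refl)
    finally show ?thesis .
  qed
  ultimately show "ennreal (p (integral_over smul P K f))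
      \<le> (\<integral>\<^sup>+t\<in>K. ennreal (p (f t)) \<partial>lebesgue) + ennreal e"
    by (intro Lim_bounded[where M = k0]) auto
qed

lemma integrable_seminorm_measurable:
  assumes "integrable_over P K f" "p \<in> P"
  shows "(\<lambda>t. ennreal (p (f t)) * indicator K t) \<in> borel_measurable lebesgue"
  using assms by (auto simp: integrable_over_def intro: approximates_seminorm_measurable)

text \<open>\<open>f\<close> is within mean distance 1 of a simple function, which takes finitely
  many values on a set of finite measure.\<close>

lemma integrable_seminorm_finite:
  assumes f: "integrable_over P K f" and K: "K \<in> lmeasurable" and p: "p \<in> P"
  shows "(\<integral>\<^sup>+t\<in>K. ennreal (p (f t)) \<partial>lebesgue) < \<infinity>"
proof -
  obtain s where s: "approximates_on P K s f"
    using f by (auto simp: integrable_over_def)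
  have simp_s: "simple_on K (s k)" for k
    using s by (auto simp: approximates_on_def)
  obtain k where k: "(\<integral>\<^sup>+t\<in>K. ennreal (p (f t - s k t)) \<partial>lebesgue) \<le> ennreal 1"
    using approximates_L1[OF s p zero_less_one] by auto
  have fin: "finite (s k ` K)" and ms: "\<And>y. {t\<in>K. s k t = y} \<in> sets lebesgue"
    using simp_s[of k] by (auto simp: simple_on_def)
  have "emeasure lebesgue {t\<in>K. s k t = y} < \<infinity>" for y
    unfolding infinity_ennreal_def less_top[symmetric]
    by (rule fmeasurableD2[OF fmeasurableI2[OF K _ ms]]) auto
  then have "(\<integral>\<^sup>+t\<in>K. ennreal (p (s k t)) \<partial>lebesgue) < \<infinity>"
    unfolding nn_integral_simple_on[OF simp_s, of "\<lambda>x. ennreal (p x)"]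
    using fin by (simp add: ennreal_mult_less_top del: emeasure_completion)
  moreover have "(\<integral>\<^sup>+t\<in>K. ennreal (p (f t)) \<partial>lebesgue) \<le> (\<integral>\<^sup>+t\<in>K. ennreal (p (f t - s k t)) \<partial>lebesgue)
      + (\<integral>\<^sup>+t\<in>K. ennreal (p (s k t)) \<partial>lebesgue)"
    using seminorm_triangle[OF p, of "f t - s k t" "s k t" for t]
    by (intro nn_integral_seminorm_triangle p approximates_diff_measurable[OF s]
        simple_on_measurable[OF simp_s]) simp
  ultimately show ?thesis
    using k by (auto simp: less_top[symmetric] top_unique)
qed

section \<open>Linearity, bounded multipliers and restriction\<close>

lemma approximates_on_cong:
  assumes "\<And>t. t \<in> K \<Longrightarrow> f t = g t"
  shows "approximates_on P K s f \<longleftrightarrow> approximates_on P K s g"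
proof -
  have "(AE t in lebesgue. t \<in> K \<longrightarrow> (\<lambda>k. s k t) \<longlonglongrightarrow> f t)
      \<longleftrightarrow> (AE t in lebesgue. t \<in> K \<longrightarrow> (\<lambda>k. s k t) \<longlonglongrightarrow> g t)"
    using assms by (intro eventually_cong always_eventually) auto
  then show ?thesis
    by (simp add: approximates_on_def)
qed

lemma integral_over_cong:
  "(\<And>t. t \<in> K \<Longrightarrow> f t = g t) \<Longrightarrow> integral_over smul P K f = integral_over smul P K g"
  using approximates_on_cong[of K f g] by (simp add: integral_over_def)

lemma approximates_on_add:
  assumes s: "approximates_on P K s f" and r: "approximates_on P K r g"
  shows "approximates_on P K (\<lambda>k t. s k t + r k t) (\<lambda>t. f t + g t)"
  unfolding approximates_on_def
proof (intro conjI allI ballI impI)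
  have simp_s: "simple_on K (s k)" and simp_r: "simple_on K (r k)" for k
    using s r by (auto simp: approximates_on_def)
  show "simple_on K (\<lambda>t. s k t + r k t)" for k
    by (rule simple_on_comb[where h = "(+)", OF simp_s simp_r])
  have "AE t in lebesgue. t \<in> K \<longrightarrow> (\<lambda>m. s m t) \<longlonglongrightarrow> f t"
    "AE t in lebesgue. t \<in> K \<longrightarrow> (\<lambda>m. r m t) \<longlonglongrightarrow> g t"
    using s r by (simp_all add: approximates_on_def)
  then show "AE t in lebesgue. t \<in> K \<longrightarrow> (\<lambda>k. s k t + r k t) \<longlonglongrightarrow> f t + g t"
    by eventually_elim (auto intro: tendsto_add_sclcs)
  fix p and e :: real assume p: "p \<in> P" and e: "e > 0"
  then have e2: "e / 2 > 0" by simp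
  obtain k1 where k1: "\<And>k m. k \<ge> k1 \<Longrightarrow> m \<ge> k1 \<Longrightarrow>
      (\<integral>\<^sup>+t\<in>K. ennreal (p (s k t - s m t)) \<partial>lebesgue) \<le> ennreal (e / 2)"
    using s p e2 unfolding approximates_on_def by meson
  obtain k2 where k2: "\<And>k m. k \<ge> k2 \<Longrightarrow> m \<ge> k2 \<Longrightarrow>
      (\<integral>\<^sup>+t\<in>K. ennreal (p (r k t - r m t)) \<partial>lebesgue) \<le> ennreal (e / 2)"
    using r p e2 unfolding approximates_on_def by meson
  have "(\<integral>\<^sup>+t\<in>K. ennreal (p (s k t + r k t - (s m t + r m t))) \<partial>lebesgue) \<le> ennreal e"
    if k: "k \<ge> max k1 k2" and m: "m \<ge> max k1 k2" for k m
  proof -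
    have "(\<integral>\<^sup>+t\<in>K. ennreal (p (s k t + r k t - (s m t + r m t))) \<partial>lebesgue)
        \<le> (\<integral>\<^sup>+t\<in>K. ennreal (p (s k t - s m t)) \<partial>lebesgue) + (\<integral>\<^sup>+t\<in>K. ennreal (p (r k t - r m t)) \<partial>lebesgue)"
    proof (rule nn_integral_seminorm_triangle[OF p])
      show "(\<lambda>t. ennreal (p (s k t - s m t)) * indicator K t) \<in> borel_measurable lebesgue"
        by (rule simple_on_measurable[OF simple_on_comb[where h = "(-)", OF simp_s simp_s]])
      show "(\<lambda>t. ennreal (p (r k t - r m t)) * indicator K t) \<in> borel_measurable lebesgue"
        by (rule simple_on_measurable[OF simple_on_comb[where h = "(-)", OF simp_r simp_r]])
      show "p (s k t + r k t - (s m t + r m t)) \<le> p (s k t - s m t) + p (r k t - r m t)" for t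
        using seminorm_triangle[OF p, of "s k t - s m t" "r k t - r m t"] by (simp add: algebra_simps)
    qed
    also have "\<dots> \<le> ennreal (e / 2) + ennreal (e / 2)"
      using k m by (intro add_mono k1 k2) auto
    also have "\<dots> = ennreal (e / 2 + e / 2)"
      using e2 by (intro ennreal_plus[symmetric]) auto
    finally show ?thesis by simp
  qed
  then show "\<exists>k0. \<forall>k\<ge>k0. \<forall>m\<ge>k0.
      (\<integral>\<^sup>+t\<in>K. ennreal (p (s k t + r k t - (s m t + r m t))) \<partial>lebesgue) \<le> ennreal e"
    by blast
qed

lemma integral_over_add:
  assumes f: "integrable_over P K f" and g: "integrable_over P K g" and K: "K \<in> lmeasurable"
  shows "integral_over smul P K (\<lambda>t. f t + g t) = integral_over smul P K f + integral_over smul P K g"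
proof -
  obtain s r where s: "approximates_on P K s f" and r: "approximates_on P K r g"
    using f g by (auto simp: integrable_over_def)
  have eq: "simple_integral_on smul K (\<lambda>t. s k t + r k t)
      = simple_integral_on smul K (s k) + simple_integral_on smul K (r k)" for k
    using s r by (intro simple_integral_add K) (auto simp: approximates_on_def)
  show ?thesis
    by (rule integral_over_eqI[OF approximates_on_add[OF s r] K])
      (unfold eq, intro tendsto_add_sclcs integral_over_tendsto s r K)
qed

text \<open>The rounded multipliers converge uniformly and are uniformly bounded; together with the
  mean Cauchy property of \<open>s\<close> this makes the products Cauchy in mean.\<close>

lemma approximates_on_times:
  assumes s: "approximates_on P K s f" and K: "K \<in> lmeasurable"
    and phi: "\<phi> \<in> borel_measurable lebesgue" and B: "\<And>t. t \<in> K \<Longrightarrow> cmod (\<phi> t) \<le> B"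
  shows "approximates_on P K (\<lambda>k t. smul (round_down k (\<phi> t)) (s k t)) (\<lambda>t. smul (\<phi> t) (f t))"
  unfolding approximates_on_def
proof (intro conjI allI ballI impI)
  have KS: "K \<in> sets lebesgue"
    using K by (rule fmeasurableD)
  have simp_s: "simple_on K (s k)" for k
    using s by (auto simp: approximates_on_def)
  have simp_r: "simple_on K (\<lambda>t. round_down k (\<phi> t))" for k
    by (rule simple_on_round_down[OF phi KS B])
  show simp_rs: "simple_on K (\<lambda>t. smul (round_down k (\<phi> t)) (s k t))" for k
    by (rule simple_on_comb[where h = smul, OF simp_r simp_s])
  have "AE t in lebesgue. t \<in> K \<longrightarrow> (\<lambda>m. s m t) \<longlonglongrightarrow> f t"
    using s by (simp_all add: approximates_on_def)
  then show "AE t in lebesgue. t \<in> K \<longrightarrow>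
      (\<lambda>k. smul (round_down k (\<phi> t)) (s k t)) \<longlonglongrightarrow> smul (\<phi> t) (f t)"
    by eventually_elim (auto intro: tendsto_scale_sclcs round_down_tendsto)
  fix p and e :: real assume p: "p \<in> P" and e: "e > 0"
  \<comment> \<open>A common bound for all rounded multipliers: the rounding error is at most 2. The
    absolute value covers an empty \<open>K\<close>, where \<open>B\<close> may be negative.\<close>
  define B' where "B' = \<bar>B\<bar> + 2"
  have B': "cmod (round_down k (\<phi> t)) \<le> B'" if "t \<in> K" for k t
  proof -
    have "cmod (round_down k (\<phi> t)) \<le> cmod (round_down k (\<phi> t) - \<phi> t) + cmod (\<phi> t)"
      using norm_triangle_ineq[of "round_down k (\<phi> t) - \<phi> t" "\<phi> t"] by simp
    also have "\<dots> \<le> 2 / real (Suc k) + B"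
      by (intro add_mono round_down_error B that)
    also have "\<dots> \<le> B'"
      unfolding B'_def using divide_left_mono[of 1 "real (Suc k)" 2] by simp
    finally show ?thesis .
  qed
  have "B' > 0" by (simp add: B'_def)
  text \<open>Split \<open>\<phi>\<^sub>k s\<^sub>k - \<phi>\<^sub>m s\<^sub>m\<close> through the fixed function \<open>s\<^sub>k\<^sub>1\<close>, whose mass is finite.\<close>
  define d where "d = e / (4 * B')"
  have d: "d > 0" "2 * B' * d = e / 2"
    using e \<open>B' > 0\<close> by (simp_all add: d_def)
  obtain k1 where k1: "\<And>k m. k \<ge> k1 \<Longrightarrow> m \<ge> k1 \<Longrightarrow>
      (\<integral>\<^sup>+t\<in>K. ennreal (p (s k t - s m t)) \<partial>lebesgue) \<le> ennreal d"
    using s p d(1) unfolding approximates_on_def by meson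
  have "integrable_over P K (s k1)"
    unfolding integrable_over_def approximates_on_def
    by (intro exI[of _ "\<lambda>_. s k1"]) (auto simp: simp_s seminorm_zero)
  then have "(\<integral>\<^sup>+t\<in>K. ennreal (p (s k1 t)) \<partial>lebesgue) < top"
    using integrable_seminorm_finite[OF _ K p] by simp
  then obtain N where N: "N \<ge> 0" "(\<integral>\<^sup>+t\<in>K. ennreal (p (s k1 t)) \<partial>lebesgue) = ennreal N"
    by (cases "\<integral>\<^sup>+t\<in>K. ennreal (p (s k1 t)) \<partial>lebesgue") auto
  \<comment> \<open>Two rounding errors amount to at most \<open>4 / (k2 + 1)\<close>; multiplied by
    the mass \<open>N\<close> of \<open>s k1\<close> this has to stay below
    \<open>e / 2\<close>.\<close>
  obtain k2 where k2: "8 * (N + 1) / e < real k2"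
    using reals_Archimedean2 by blast
  have small: "(\<integral>\<^sup>+t\<in>K. ennreal (p (smul (round_down k (\<phi> t)) (s k t) - smul (round_down m (\<phi> t)) (s m t))) \<partial>lebesgue)
      \<le> ennreal e" if k: "k \<ge> max k1 k2" and m: "m \<ge> max k1 k2" for k m
  proof -
    have c: "4 / real (Suc k2) * N \<le> e / 2"
    proof -
      have "8 * (N + 1) < real (Suc k2) * e"
        using k2 e by (simp add: field_simps)
      then show ?thesis
        using e N(1) by (simp add: field_simps)
    qed
    have rr: "cmod (round_down k (\<phi> t) - round_down m (\<phi> t)) \<le> 4 / real (Suc k2)" for t
    proof -
      have "cmod (round_down k (\<phi> t) - round_down m (\<phi> t))
          \<le> cmod (round_down k (\<phi> t) - \<phi> t) + cmod (round_down m (\<phi> t) - \<phi> t)"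
        using norm_triangle_ineq4[of "round_down k (\<phi> t) - \<phi> t" "round_down m (\<phi> t) - \<phi> t"] by simp
      also have "\<dots> \<le> 2 / real (Suc k) + 2 / real (Suc m)"
        by (intro add_mono round_down_error)
      also have "\<dots> \<le> 2 / real (Suc k2) + 2 / real (Suc k2)"
        using k m by (intro add_mono divide_left_mono) auto
      finally show ?thesis by simp
    qed
    have mk: "(\<lambda>t. ennreal (p (s i t - s k1 t)) * indicator K t) \<in> borel_measurable lebesgue" for i
      by (rule simple_on_measurable[OF simple_on_comb[where h = "(-)", OF simp_s simp_s]])
    have m1: "(\<lambda>t. ennreal (p (s k1 t)) * indicator K t) \<in> borel_measurable lebesgue"
      by (rule simple_on_measurable[OF simp_s])
    have "p (smul (round_down k (\<phi> t)) (s k t) - smul (round_down m (\<phi> t)) (s m t))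
        \<le> B' * p (s k t - s k1 t) + B' * p (s m t - s k1 t) + 4 / real (Suc k2) * p (s k1 t)"
      if t: "t \<in> K" for t
    proof -
      have "smul (round_down k (\<phi> t)) (s k t) - smul (round_down m (\<phi> t)) (s m t)
        = (smul (round_down k (\<phi> t)) (s k t - s k1 t) - smul (round_down m (\<phi> t)) (s m t - s k1 t))
          + smul (round_down k (\<phi> t) - round_down m (\<phi> t)) (s k1 t)"
        by (simp add: scale_right_diff_distrib scale_left_diff_distrib algebra_simps)
      also have "p \<dots> \<le> (p (smul (round_down k (\<phi> t)) (s k t - s k1 t))
          + p (smul (round_down m (\<phi> t)) (s m t - s k1 t)))
          + p (smul (round_down k (\<phi> t) - round_down m (\<phi> t)) (s k1 t))"
        by (rule order.trans[OF seminorm_triangle[OF p]]) (simp add: seminorm_diff_le[OF p])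
      also have "\<dots> \<le> B' * p (s k t - s k1 t) + B' * p (s m t - s k1 t) + 4 / real (Suc k2) * p (s k1 t)"
        unfolding seminorm_scale[OF p]
        by (intro add_mono mult_right_mono B' t rr seminorm_nonneg p)
      finally show ?thesis .
    qed
    then have "(\<integral>\<^sup>+t\<in>K. ennreal (p (smul (round_down k (\<phi> t)) (s k t) - smul (round_down m (\<phi> t)) (s m t))) \<partial>lebesgue)
      \<le> (\<integral>\<^sup>+t. ennreal B' * (ennreal (p (s k t - s k1 t)) * indicator K t)
           + ennreal B' * (ennreal (p (s m t - s k1 t)) * indicator K t)
           + ennreal (4 / real (Suc k2)) * (ennreal (p (s k1 t)) * indicator K t) \<partial>lebesgue)"
      using \<open>B' > 0\<close> N(1)
      by (intro nn_integral_mono)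
        (auto simp: indicator_def seminorm_nonneg[OF p] ennreal_mult[symmetric] ennreal_plus[symmetric]
          simp del: ennreal_plus intro!: ennreal_leI)
    also have "\<dots> = ennreal B' * (\<integral>\<^sup>+t\<in>K. ennreal (p (s k t - s k1 t)) \<partial>lebesgue)
        + ennreal B' * (\<integral>\<^sup>+t\<in>K. ennreal (p (s m t - s k1 t)) \<partial>lebesgue)
        + ennreal (4 / real (Suc k2)) * (\<integral>\<^sup>+t\<in>K. ennreal (p (s k1 t)) \<partial>lebesgue)"
      by (simp add: nn_integral_add nn_integral_cmult mk m1 borel_measurable_times_ennreal
          borel_measurable_add)
    also have "\<dots> \<le> ennreal B' * ennreal d + ennreal B' * ennreal d + ennreal (4 / real (Suc k2)) * ennreal N"
      unfolding N(2) using k m by (intro add_mono mult_left_mono k1 order.refl) auto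
    also have "\<dots> = ennreal (2 * B' * d + 4 / real (Suc k2) * N)"
      using \<open>B' > 0\<close> d(1) N(1)
      by (simp add: ennreal_mult[symmetric] ennreal_plus[symmetric] del: ennreal_plus)
    also have "\<dots> \<le> ennreal e"
      using c d(2) by (intro ennreal_leI) linarith
    finally show ?thesis .
  qed
  then show "\<exists>k0. \<forall>k\<ge>k0. \<forall>m\<ge>k0. (\<integral>\<^sup>+t\<in>K. ennreal
      (p (smul (round_down k (\<phi> t)) (s k t) - smul (round_down m (\<phi> t)) (s m t))) \<partial>lebesgue) \<le> ennreal e"
    by blast
qed

lemma integrable_over_times:
  assumes "integrable_over P K f" "K \<in> lmeasurable" "\<phi> \<in> borel_measurable lebesgue"
    and "\<And>t. t \<in> K \<Longrightarrow> cmod (\<phi> t) \<le> B"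
  shows "integrable_over P K (\<lambda>t. smul (\<phi> t) (f t))"
proof -
  obtain s where "approximates_on P K s f"
    using assms(1) by (auto simp: integrable_over_def)
  from approximates_on_times[OF this assms(2-4)] show ?thesis
    unfolding integrable_over_def by blast
qed

lemma approximates_on_scale:
  assumes s: "approximates_on P K s f"
  shows "approximates_on P K (\<lambda>k t. smul c (s k t)) (\<lambda>t. smul c (f t))"
  unfolding approximates_on_def
proof (intro conjI allI ballI impI)
  have simp_s: "simple_on K (s k)" for k
    using s by (auto simp: approximates_on_def)
  show "simple_on K (\<lambda>t. smul c (s k t))" for k
    by (rule simple_on_compose[OF simp_s])
  have "AE t in lebesgue. t \<in> K \<longrightarrow> (\<lambda>m. s m t) \<longlonglongrightarrow> f t"
    using s by (simp_all add: approximates_on_def)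
  then show "AE t in lebesgue. t \<in> K \<longrightarrow> (\<lambda>k. smul c (s k t)) \<longlonglongrightarrow> smul c (f t)"
    by eventually_elim (auto intro: tendsto_scale_sclcs)
  fix p and e :: real assume p: "p \<in> P" and e: "e > 0"
  define d where "d = e / (cmod c + 1)"
  have d: "d > 0" "cmod c * d \<le> e"
    using e by (simp_all add: d_def field_simps add_pos_nonneg)
  obtain k1 where k1: "\<And>k m. k \<ge> k1 \<Longrightarrow> m \<ge> k1 \<Longrightarrow>
      (\<integral>\<^sup>+t\<in>K. ennreal (p (s k t - s m t)) \<partial>lebesgue) \<le> ennreal d"
    using s p d(1) unfolding approximates_on_def by meson
  have "(\<integral>\<^sup>+t\<in>K. ennreal (p (smul c (s k t) - smul c (s m t))) \<partial>lebesgue) \<le> ennreal e"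
    if "k \<ge> k1" "m \<ge> k1" for k m
  proof -
    have "ennreal (p (smul c (s k t) - smul c (s m t))) = ennreal (cmod c) * ennreal (p (s k t - s m t))" for t
      by (simp add: scale_right_diff_distrib[symmetric] seminorm_scale[OF p] ennreal_mult seminorm_nonneg[OF p])
    then have "(\<integral>\<^sup>+t\<in>K. ennreal (p (smul c (s k t) - smul c (s m t))) \<partial>lebesgue)
        = ennreal (cmod c) * (\<integral>\<^sup>+t\<in>K. ennreal (p (s k t - s m t)) \<partial>lebesgue)"
      using nn_integral_cmult[OF simple_on_measurable[where q = "\<lambda>x. ennreal (p x)",
            OF simple_on_comb[where h = "(-)", OF simp_s[of k] simp_s[of m]]], of "ennreal (cmod c)"]
      by (simp add: mult.assoc)
    also have "\<dots> \<le> ennreal (cmod c) * ennreal d"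
      by (intro mult_left_mono k1 that) simp
    also have "\<dots> \<le> ennreal e"
      using d by (simp add: ennreal_mult[symmetric] ennreal_leI)
    finally show ?thesis .
  qed
  then show "\<exists>k0. \<forall>k\<ge>k0. \<forall>m\<ge>k0.
      (\<integral>\<^sup>+t\<in>K. ennreal (p (smul c (s k t) - smul c (s m t))) \<partial>lebesgue) \<le> ennreal e"
    by blast
qed

lemma integrable_over_scale: "integrable_over P K f \<Longrightarrow> integrable_over P K (\<lambda>t. smul c (f t))"
  using approximates_on_scale unfolding integrable_over_def by blast

lemma integral_over_scale:
  assumes f: "integrable_over P K f" and K: "K \<in> lmeasurable"
  shows "integral_over smul P K (\<lambda>t. smul c (f t)) = smul c (integral_over smul P K f)"
proof -
  obtain s where s: "approximates_on P K s f"
    using f by (auto simp: integrable_over_def)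
  have eq: "simple_integral_on smul K (\<lambda>t. smul c (s k t)) = smul c (simple_integral_on smul K (s k))" for k
    using s by (intro simple_integral_scale K) (auto simp: approximates_on_def)
  show ?thesis
    by (rule integral_over_eqI[OF approximates_on_scale[OF s] K])
      (unfold eq, intro tendsto_scale_sclcs tendsto_const integral_over_tendsto s K)
qed

lemma integral_over_diff:
  assumes f: "integrable_over P K f" and g: "integrable_over P K g" and K: "K \<in> lmeasurable"
  shows "integral_over smul P K (\<lambda>t. f t - g t) = integral_over smul P K f - integral_over smul P K g"
  using integral_over_add[OF f integrable_over_scale[OF g, of "-1"] K]
    integral_over_scale[OF g K, of "-1"] by simp

text \<open>One approximating sequence serves both sides, restricted to \<open>J\<close> on the
  right and multiplied by the indicator on the left; the simple integrals agree term by
  term.\<close>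

lemma integral_over_indicator:
  assumes f: "integrable_over P K f" and J: "J \<subseteq> K" "J \<in> sets lebesgue" and K: "K \<in> lmeasurable"
  shows "integral_over smul P K (\<lambda>t. smul (indicator J t) (f t)) = integral_over smul P J f"
proof -
  obtain s where s: "approximates_on P K s f"
    using f by (auto simp: integrable_over_def)
  have simp_s: "simple_on K (s k)" for k
    using s by (auto simp: approximates_on_def)
  have lim: "AE t in lebesgue. t \<in> K \<longrightarrow> (\<lambda>m. s m t) \<longlonglongrightarrow> f t"
    using s by (simp_all add: approximates_on_def)
  have ind: "simple_on K (indicator J :: _ \<Rightarrow> complex)"
    by (rule simple_on_indicator[OF fmeasurableD[OF K] J])
  have J': "J \<in> lmeasurable"
    by (rule fmeasurableI2[OF K J])
  have less: "(\<integral>\<^sup>+t\<in>J. ennreal (p (s k t - s m t)) \<partial>lebesgue) \<le> (\<integral>\<^sup>+t\<in>K. ennreal (p (s k t - s m t)) \<partial>lebesgue)"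
    "(\<integral>\<^sup>+t\<in>K. ennreal (p (smul (indicator J t) (s k t) - smul (indicator J t) (s m t))) \<partial>lebesgue)
      \<le> (\<integral>\<^sup>+t\<in>K. ennreal (p (s k t - s m t)) \<partial>lebesgue)" if "p \<in> P" for p k m
    using J(1) by (intro nn_integral_mono; auto simp: indicator_def seminorm_zero[OF that])+
  have 1: "approximates_on P J s f"
    unfolding approximates_on_def
  proof (intro conjI allI ballI impI)
    show "simple_on J (s k)" for k
      by (rule simple_on_subset[OF simp_s J])
    show "AE t in lebesgue. t \<in> J \<longrightarrow> (\<lambda>m. s m t) \<longlonglongrightarrow> f t"
      using lim by eventually_elim (use J(1) in auto)
    show "\<exists>k0. \<forall>k\<ge>k0. \<forall>m\<ge>k0. (\<integral>\<^sup>+t\<in>J. ennreal (p (s k t - s m t)) \<partial>lebesgue) \<le> ennreal e"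
      if "p \<in> P" "e > 0" for p e
      using s that less(1)[OF that(1)] unfolding approximates_on_def by (meson order.trans)
  qed
  have 2: "approximates_on P K (\<lambda>k t. smul (indicator J t) (s k t)) (\<lambda>t. smul (indicator J t) (f t))"
    unfolding approximates_on_def
  proof (intro conjI allI ballI impI)
    show "simple_on K (\<lambda>t. smul (indicator J t) (s k t))" for k
      by (rule simple_on_comb[where h = smul, OF ind simp_s])
    show "AE t in lebesgue. t \<in> K \<longrightarrow>
        (\<lambda>m. smul (indicator J t) (s m t)) \<longlonglongrightarrow> smul (indicator J t) (f t)"
      using lim by eventually_elim (auto intro: tendsto_scale_sclcs)
    show "\<exists>k0. \<forall>k\<ge>k0. \<forall>m\<ge>k0.
        (\<integral>\<^sup>+t\<in>K. ennreal (p (smul (indicator J t) (s k t) - smul (indicator J t) (s m t))) \<partial>lebesgue) \<le> ennreal e"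
      if "p \<in> P" "e > 0" for p e
      using s that less(2)[OF that(1)] unfolding approximates_on_def by (meson order.trans)
  qed
  show ?thesis
    by (rule integral_over_eqI[OF 2 K])
      (unfold simple_integral_subset[OF simp_s J K], rule integral_over_tendsto[OF 1 J'])
qed

lemma seminorm_integral_times_le:
  assumes f: "integrable_over P K f" and K: "K \<in> lmeasurable" and p: "p \<in> P"
    and phi: "\<phi> \<in> borel_measurable lebesgue" and B: "\<And>t. t \<in> K \<Longrightarrow> cmod (\<phi> t) \<le> B" "0 \<le> B"
  shows "p (integral_over smul P K (\<lambda>t. smul (\<phi> t) (f t)))
    \<le> B * enn2real (\<integral>\<^sup>+t\<in>K. ennreal (p (f t)) \<partial>lebesgue)"
proof -
  have fin: "(\<integral>\<^sup>+t\<in>K. ennreal (p (f t)) \<partial>lebesgue) < top"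
    using integrable_seminorm_finite[OF f K p] by simp
  have "ennreal (p (integral_over smul P K (\<lambda>t. smul (\<phi> t) (f t))))
      \<le> (\<integral>\<^sup>+t\<in>K. ennreal (p (smul (\<phi> t) (f t))) \<partial>lebesgue)"
    by (rule seminorm_integral_le[OF integrable_over_times[OF f K phi B(1)] K p])
  also have "\<dots> \<le> (\<integral>\<^sup>+t. ennreal B * (ennreal (p (f t)) * indicator K t) \<partial>lebesgue)"
    using B by (intro nn_integral_mono)
      (auto simp: indicator_def seminorm_scale[OF p] seminorm_nonneg[OF p] ennreal_mult[symmetric]
        intro!: ennreal_leI mult_right_mono)
  also have "\<dots> = ennreal B * (\<integral>\<^sup>+t\<in>K. ennreal (p (f t)) \<partial>lebesgue)"
    by (rule nn_integral_cmult[OF integrable_seminorm_measurable[OF f p]])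
  also have "\<dots> = ennreal (B * enn2real (\<integral>\<^sup>+t\<in>K. ennreal (p (f t)) \<partial>lebesgue))"
    using fin B(2) by (simp add: ennreal_mult)
  finally show ?thesis
    using B(2) by (simp add: ennreal_le_iff)
qed

end

section \<open>Weighted integrals over boxes\<close>

text \<open>Has to contain the discontinuous indicators of half-spaces, which cut boxes down, as
  well as monomials and kernels; the latter need not be bounded on the orthant, hence boundedness on
  boxes only.\<close>

definition admissible :: "(real^'n \<Rightarrow> complex) \<Rightarrow> bool" where
  "admissible \<Phi> \<longleftrightarrow> \<Phi> \<in> borel_measurable lebesgue \<and> (\<forall>t. \<exists>B\<ge>0. \<forall>s\<in>{0..t}. cmod (\<Phi> s) \<le> B)"

lemma admissible_continuous:
  fixes \<Phi> :: "real^'n \<Rightarrow> complex"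
  assumes "continuous_on UNIV \<Phi>"
  shows "admissible \<Phi>"
  unfolding admissible_def
proof (intro conjI allI)
  have "\<Phi> \<in> borel_measurable lborel"
    using borel_measurable_continuous_onI[OF assms] by simp
  then show "\<Phi> \<in> borel_measurable lebesgue"
    by (rule measurable_completion)
  fix t :: "real^'n"
  have "compact (\<Phi> ` {0..t})"
    by (intro compact_continuous_image continuous_on_subset[OF assms] compact_interval) auto
  then have "bounded (\<Phi> ` {0..t})"
    by (rule compact_imp_bounded)
  then obtain B where "B > 0" "\<forall>x\<in>\<Phi> ` {0..t}. cmod x \<le> B"
    unfolding bounded_pos by blast
  then show "\<exists>B\<ge>0. \<forall>s\<in>{0..t}. cmod (\<Phi> s) \<le> B"
    by (intro exI[of _ B]) auto
qed

lemma admissible_const: "admissible (\<lambda>_. c)"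
  by (rule admissible_continuous) simp

lemma admissible_halfspace: "admissible (\<lambda>s. of_real (indicator {..a} (s $ i)))"
  unfolding admissible_def
proof (intro conjI allI exI[of _ 1] ballI)
  have "(\<lambda>s. s $ i) \<in> borel_measurable lborel"
    using borel_measurable_continuous_onI[of "\<lambda>s. s $ i"] by (simp add: continuous_on_component)
  then have "(\<lambda>s. s $ i) \<in> borel_measurable lebesgue"
    by (rule measurable_completion)
  then show "(\<lambda>s. complex_of_real (indicator {..a} (s $ i))) \<in> borel_measurable lebesgue"
    by measurable
qed (auto simp: indicator_def)

lemma admissible_add:
  assumes "admissible \<Phi>" "admissible \<Psi>"
  shows "admissible (\<lambda>s. \<Phi> s + \<Psi> s)"
  unfolding admissible_def
proof (intro conjI allI)
  show "(\<lambda>s. \<Phi> s + \<Psi> s) \<in> borel_measurable lebesgue"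
    using assms by (simp add: admissible_def borel_measurable_add)
  fix t
  obtain B C where "B \<ge> 0" "C \<ge> 0" "\<And>s. s \<in> {0..t} \<Longrightarrow> cmod (\<Phi> s) \<le> B" "\<And>s. s \<in> {0..t} \<Longrightarrow> cmod (\<Psi> s) \<le> C"
    using assms unfolding admissible_def by meson
  then show "\<exists>B\<ge>0. \<forall>s\<in>{0..t}. cmod (\<Phi> s + \<Psi> s) \<le> B"
    by (intro exI[of _ "B + C"]) (auto intro!: order.trans[OF norm_triangle_ineq] add_mono)
qed

lemma admissible_mult:
  assumes "admissible \<Phi>" "admissible \<Psi>"
  shows "admissible (\<lambda>s. \<Phi> s * \<Psi> s)"
  unfolding admissible_def
proof (intro conjI allI)
  show "(\<lambda>s. \<Phi> s * \<Psi> s) \<in> borel_measurable lebesgue"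
    using assms by (simp add: admissible_def borel_measurable_times)
  fix t
  obtain B C where "B \<ge> 0" "C \<ge> 0" "\<And>s. s \<in> {0..t} \<Longrightarrow> cmod (\<Phi> s) \<le> B" "\<And>s. s \<in> {0..t} \<Longrightarrow> cmod (\<Psi> s) \<le> C"
    using assms unfolding admissible_def by meson
  then show "\<exists>B\<ge>0. \<forall>s\<in>{0..t}. cmod (\<Phi> s * \<Psi> s) \<le> B"
    by (intro exI[of _ "B * C"]) (auto simp: norm_mult intro!: mult_mono)
qed

lemma admissible_diff:
  assumes "admissible \<Phi>" "admissible \<Psi>"
  shows "admissible (\<lambda>s. \<Phi> s - \<Psi> s)"
  using admissible_add[OF assms(1) admissible_mult[OF admissible_const[of "-1"] assms(2)]] by simp

lemma admissible_sum: "(\<And>k. k \<in> A \<Longrightarrow> admissible (\<Phi> k)) \<Longrightarrow> admissible (\<lambda>s. \<Sum>k\<in>A. \<Phi> k s)"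
  by (induction A rule: infinite_finite_induct) (auto intro: admissible_const admissible_add)

lemma lmeasurable_box: "{a..b::real^'n} \<in> lmeasurable"
  by (simp add: interval_cbox)

context sclcs
begin

definition box_integral :: "(real^'n \<Rightarrow> 'x) \<Rightarrow> (real^'n \<Rightarrow> complex) \<Rightarrow> real^'n \<Rightarrow> 'x" where
  "box_integral g \<Phi> t = integral_over smul P {0..t} (\<lambda>s. smul (\<Phi> s) (g s))"

lemma box_integral_cong:
  "(\<And>s. s \<in> {0..t} \<Longrightarrow> \<Phi> s = \<Psi> s) \<Longrightarrow> box_integral g \<Phi> t = box_integral g \<Psi> t"
  unfolding box_integral_def by (rule integral_over_cong) simp

lemma integrable_box:
  assumes "locally_integrable_orthant P g"
  shows "integrable_over P {0..t} g"
  using assms compact_interval[of 0 t] unfolding locally_integrable_orthant_def by auto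

lemma integrable_box_times:
  assumes g: "locally_integrable_orthant P g" and "admissible \<Phi>"
  shows "integrable_over P {0..t} (\<lambda>s. smul (\<Phi> s) (g s))"
proof -
  obtain B where "\<And>s. s \<in> {0..t} \<Longrightarrow> cmod (\<Phi> s) \<le> B"
    using assms(2) unfolding admissible_def by meson
  then show ?thesis
    using assms(2) by (intro integrable_over_times[OF integrable_box[OF g] lmeasurable_box])
      (auto simp: admissible_def)
qed

lemma box_integral_add:
  assumes g: "locally_integrable_orthant P g" and "admissible \<Phi>" "admissible \<Psi>"
  shows "box_integral g (\<lambda>s. \<Phi> s + \<Psi> s) t = box_integral g \<Phi> t + box_integral g \<Psi> t"
  using integral_over_add[OF integrable_box_times[OF assms(1,2)] integrable_box_times[OF assms(1,3)]
      lmeasurable_box]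
  by (simp add: box_integral_def scale_left_distrib)

lemma box_integral_scale:
  assumes g: "locally_integrable_orthant P g" and "admissible \<Phi>"
  shows "box_integral g (\<lambda>s. c * \<Phi> s) t = smul c (box_integral g \<Phi> t)"
  using integral_over_scale[OF integrable_box_times[OF assms] lmeasurable_box]
  by (simp add: box_integral_def)

lemma box_integral_diff:
  assumes g: "locally_integrable_orthant P g" and "admissible \<Phi>" "admissible \<Psi>"
  shows "box_integral g (\<lambda>s. \<Phi> s - \<Psi> s) t = box_integral g \<Phi> t - box_integral g \<Psi> t"
  using integral_over_diff[OF integrable_box_times[OF assms(1,2)] integrable_box_times[OF assms(1,3)]
      lmeasurable_box]
  by (simp add: box_integral_def scale_left_diff_distrib)

lemma box_integral_sum:
  assumes g: "locally_integrable_orthant P g" and "finite A" "\<And>k. k \<in> A \<Longrightarrow> admissible (\<Phi> k)"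
  shows "box_integral g (\<lambda>s. \<Sum>k\<in>A. c k * \<Phi> k s) t = (\<Sum>k\<in>A. smul (c k) (box_integral g (\<Phi> k) t))"
  using assms(2,3)
proof (induction A)
  case empty
  have "box_integral g (\<lambda>s. 0 * 0) t = smul 0 (box_integral g (\<lambda>_. 0) t)"
    by (rule box_integral_scale[OF g admissible_const])
  then show ?case by simp
next
  case (insert k A)
  have "admissible (\<lambda>s. c k * \<Phi> k s)" "admissible (\<lambda>s. \<Sum>k\<in>A. c k * \<Phi> k s)"
    using insert.prems by (intro admissible_sum admissible_mult admissible_const; simp)+
  then show ?case
    using insert box_integral_add[OF g] box_integral_scale[OF g] by simp
qed

text \<open>Here \<open>N\<close>, the mass of \<open>p (g s)\<close> on the box, depends on
  \<open>t\<close> but not on the weight. The bound serves to make approximation errors vanish at a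
  fixed \<open>t\<close>; uniformity in \<open>t\<close> comes from \<open>tame\<close>.\<close>

lemma box_integral_bound:
  assumes g: "locally_integrable_orthant P g" and p: "p \<in> P"
  shows "\<exists>N\<ge>0. \<forall>\<Phi> B. admissible \<Phi> \<longrightarrow> 0 \<le> B \<longrightarrow> (\<forall>s\<in>{0..t}. cmod (\<Phi> s) \<le> B) \<longrightarrow>
    p (box_integral g \<Phi> t) \<le> B * N"
  unfolding box_integral_def
  by (intro exI[of _ "enn2real (\<integral>\<^sup>+s\<in>{0..t}. ennreal (p (g s)) \<partial>lebesgue)"] conjI allI impI
      seminorm_integral_times_le[OF integrable_box[OF g] lmeasurable_box p])
    (auto simp: admissible_def)

lemma box_integral_indicator:
  assumes g: "locally_integrable_orthant P g" and "admissible \<Phi>" and u: "u \<le> t"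
    and ind: "\<And>s. s \<in> {0..t} \<Longrightarrow> \<phi> s = indicator {0..u} s"
  shows "box_integral g (\<lambda>s. \<phi> s * \<Phi> s) t = box_integral g \<Phi> u"
proof -
  have "box_integral g (\<lambda>s. \<phi> s * \<Phi> s) t
      = integral_over smul P {0..t} (\<lambda>s. smul (indicator {0..u} s) (smul (\<Phi> s) (g s)))"
    unfolding box_integral_def using ind by (intro integral_over_cong) simp
  also have "\<dots> = box_integral g \<Phi> u"
    unfolding box_integral_def using u
    by (intro integral_over_indicator integrable_box_times assms lmeasurable_box
        fmeasurableD) auto
  finally show ?thesis .
qed

text \<open>This class replaces integration by parts: it is stable under multiplication by nonnegative
  decreasing functions of one coordinate (\<open>tame_antimono\<close>).\<close>

definition tame :: "('x \<Rightarrow> real) \<Rightarrow> (real^'n \<Rightarrow> 'x) \<Rightarrow> real \<Rightarrow> (real^'n \<Rightarrow> complex) \<Rightarrow> bool" where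
  "tame p g C \<Phi> \<longleftrightarrow> admissible \<Phi> \<and> (\<forall>t\<ge>0. p (box_integral g \<Phi> t) \<le> C)"

lemma tame_admissible: "tame p g C \<Phi> \<Longrightarrow> admissible \<Phi>"
  by (simp add: tame_def)

lemma tame_bound: "tame p g C \<Phi> \<Longrightarrow> 0 \<le> t \<Longrightarrow> p (box_integral g \<Phi> t) \<le> C"
  by (simp add: tame_def)

lemma tame_nonneg: "tame p g C \<Phi> \<Longrightarrow> p \<in> P \<Longrightarrow> 0 \<le> C"
  using seminorm_nonneg order.trans tame_bound[of p g C \<Phi> 0] by blast

lemma tame_mono: "tame p g C \<Phi> \<Longrightarrow> C \<le> D \<Longrightarrow> tame p g D \<Phi>"
  unfolding tame_def by (meson order.trans)

lemma tame_add:
  assumes "locally_integrable_orthant P g" "p \<in> P" "tame p g C \<Phi>" "tame p g D \<Psi>"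
  shows "tame p g (C + D) (\<lambda>s. \<Phi> s + \<Psi> s)"
  using assms unfolding tame_def
  by (auto simp: box_integral_add admissible_add
      intro!: order.trans[OF seminorm_triangle[OF assms(2)]] add_mono)

lemma tame_diff:
  assumes "locally_integrable_orthant P g" "p \<in> P" "tame p g C \<Phi>" "tame p g D \<Psi>"
  shows "tame p g (C + D) (\<lambda>s. \<Phi> s - \<Psi> s)"
  using assms unfolding tame_def
  by (auto simp: box_integral_diff admissible_diff
      intro!: order.trans[OF seminorm_diff_le[OF assms(2)]] add_mono)

lemma tame_scale:
  assumes "locally_integrable_orthant P g" "p \<in> P" "tame p g C \<Phi>"
  shows "tame p g (cmod c * C) (\<lambda>s. c * \<Phi> s)"
  using assms unfolding tame_def
  by (auto simp: box_integral_scale seminorm_scale admissible_mult admissible_const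
      intro: mult_left_mono)

text \<open>Cutting by a half-space turns the box up to \<open>t\<close> into the box up to
  \<open>u\<close>, and the bound holds for all boxes with the same constant. The assumption on
  \<open>a\<close> keeps \<open>u\<close> in the orthant.\<close>

lemma tame_halfspace:
  fixes i :: "'n::finite"
  assumes g: "locally_integrable_orthant P g" and "tame p g C \<Phi>" and a: "0 \<le> a"
  shows "tame p g C (\<lambda>s. of_real (indicator {..a} (s $ i)) * \<Phi> s)"
  unfolding tame_def
proof (intro conjI allI impI)
  have adm: "admissible \<Phi>"
    by (rule tame_admissible[OF assms(2)])
  show "admissible (\<lambda>s. of_real (indicator {..a} (s $ i)) * \<Phi> s)"
    by (intro admissible_mult admissible_halfspace adm)
  fix t :: "real^'n" assume t: "0 \<le> t"
  define u where "u = (\<chi> j. if j = i then min (t $ i) a else t $ j)"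
  have u: "0 \<le> u" "u \<le> t"
    using t a by (auto simp: u_def less_eq_vec_def)
  have "box_integral g (\<lambda>s. of_real (indicator {..a} (s $ i)) * \<Phi> s) t = box_integral g \<Phi> u"
  proof (rule box_integral_indicator[OF g adm u(2)])
    fix s assume s: "s \<in> {0..t}"
    have "s \<in> {0..u} \<longleftrightarrow> s $ i \<le> a"
    proof
      assume "s \<in> {0..u}"
      then have "s $ i \<le> u $ i" by (auto simp: less_eq_vec_def)
      then show "s $ i \<le> a" by (simp add: u_def)
    qed (use s in \<open>auto simp: u_def less_eq_vec_def\<close>)
    then show "complex_of_real (indicator {..a} (s $ i)) = indicator {0..u} s"
      by (simp add: indicator_def)
  qed
  then show "p (box_integral g (\<lambda>s. of_real (indicator {..a} (s $ i)) * \<Phi> s) t) \<le> C"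
    using tame_bound[OF assms(2) u(1)] by simp
qed

lemma tame_antimono:
  fixes i :: "'n::finite"
  assumes g: "locally_integrable_orthant P g" and p: "p \<in> P" and tame: "tame p g C \<Phi>"
    and cont: "continuous_on UNIV \<psi>" and anti: "antimono_on {0..} \<psi>"
    and nonneg: "\<And>x. x \<ge> 0 \<Longrightarrow> 0 \<le> \<psi> x"
  shows "tame p g (\<psi> 0 * C) (\<lambda>s. of_real (\<psi> (s $ i)) * \<Phi> s)"
  unfolding tame_def
proof (intro conjI allI impI)
  have adm: "admissible \<Phi>"
    by (rule tame_admissible[OF tame])
  have psi: "admissible (\<lambda>s. of_real (\<psi> (s $ i)))"
    by (intro admissible_continuous continuous_intros continuous_on_compose2[OF cont]) auto
  show adm': "admissible (\<lambda>s. of_real (\<psi> (s $ i)) * \<Phi> s)"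
    by (intro admissible_mult psi adm)
  fix t :: "real^'n" assume t: "0 \<le> t"
  then have ti: "0 \<le> t $ i" by (simp add: less_eq_vec_def)
  obtain N where N: "N \<ge> 0" "\<And>\<Phi> B. admissible \<Phi> \<Longrightarrow> 0 \<le> B \<Longrightarrow> (\<And>s. s \<in> {0..t} \<Longrightarrow> cmod (\<Phi> s) \<le> B) \<Longrightarrow>
      p (box_integral g \<Phi> t) \<le> B * N"
    using box_integral_bound[OF g p, of t] by meson
  obtain B where B: "B \<ge> 0" "\<And>s. s \<in> {0..t} \<Longrightarrow> cmod (\<Phi> s) \<le> B"
    using adm unfolding admissible_def by meson
  have psi0: "0 \<le> \<psi> 0" by (rule nonneg) simp
  \<comment> \<open>A step function with \<open>n + 1\<close> levels of height \<open>h\<close>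
    accounts for \<open>\<psi> 0 * C\<close>; the second summand is the discretisation error.
    \<open>B\<close> and \<open>N\<close> depend on \<open>t\<close>, but they disappear as
    \<open>n\<close> grows, so the final constant does not.\<close>
  have "p (box_integral g (\<lambda>s. of_real (\<psi> (s $ i)) * \<Phi> s) t) \<le> \<psi> 0 * C + (\<psi> 0 * B * N) / real (Suc n)" for n
  proof -
    define h where "h = \<psi> 0 / real (Suc n)"
    have h: "0 \<le> h" using psi0 by (simp add: h_def)
    have hn: "h * real (Suc n) = \<psi> 0"
      by (simp add: h_def)
    \<comment> \<open>The superlevel set contains 0 because \<open>k * h\<close> is at most
      \<open>\<psi> 0\<close>, is compact by continuity and downward closed by monotonicity; so it
      is an interval ending at its maximum \<open>a\<close>.\<close>
    have "\<exists>a\<ge>0. \<forall>x\<in>{0..t $ i}. real k * h \<le> \<psi> x \<longleftrightarrow> x \<le> a" if k: "k \<in> {1..Suc n}" for k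
    proof -
      let ?A = "{0..t $ i} \<inter> \<psi> -` {real k * h..}"
      have "real k * h \<le> \<psi> 0"
        using k mult_right_mono[of "real k" "real (Suc n)" h] h hn by (simp add: mult.commute)
      then have ne: "?A \<noteq> {}"
        using ti by auto
      have "closed (\<psi> -` {real k * h..})"
        by (rule continuous_closed_vimage) (use cont in \<open>auto simp: continuous_on_eq_continuous_at\<close>)
      then have "compact ?A"
        by (intro compact_Int_closed) auto
      from compact_attains_sup[OF this ne] obtain a where a: "a \<in> ?A" "\<And>x. x \<in> ?A \<Longrightarrow> x \<le> a"
        by auto
      have "real k * h \<le> \<psi> x" if "x \<in> {0..t $ i}" "x \<le> a" for x
        using monotone_onD[OF anti, of x a] that a(1) by auto
      moreover have "x \<le> a" if "x \<in> {0..t $ i}" "real k * h \<le> \<psi> x" for x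
        using that by (intro a(2)) simp
      ultimately show ?thesis
        using a(1) by (intro exI[of _ a] conjI ballI iffI) simp_all
    qed
    then obtain a where a: "\<And>k. k \<in> {1..Suc n} \<Longrightarrow> 0 \<le> a k"
      "\<And>k x. k \<in> {1..Suc n} \<Longrightarrow> x \<in> {0..t $ i} \<Longrightarrow> real k * h \<le> \<psi> x \<longleftrightarrow> x \<le> a k"
      by metis
    define \<phi> where "\<phi> x = (\<Sum>k\<in>{1..Suc n}. h * indicator {..a k} x)" for x :: real
    have err: "\<bar>\<psi> x - \<phi> x\<bar> \<le> h" if x: "x \<in> {0..t $ i}" for x
    proof (cases "\<psi> 0 = 0")
      case True
      then have "\<psi> x = 0"
        using monotone_onD[OF anti, of 0 x] x nonneg[of x] by auto
      then show ?thesis using True by (simp add: \<phi>_def h_def)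
    next
      case False
      then have hpos: "h > 0" using psi0 by (simp add: h_def)
      define q where "q = \<psi> x / h"
      have psix: "0 \<le> \<psi> x" "\<psi> x \<le> \<psi> 0"
        using nonneg[of x] monotone_onD[OF anti, of 0 x] x by auto
      have q: "0 \<le> q" "q \<le> real (Suc n)"
        using psix hpos hn by (auto simp: q_def pos_divide_le_eq mult.commute)
      \<comment> \<open>The levels reached at \<open>x\<close> are those with
        \<open>k \<le> q\<close>, so \<open>\<phi>\<close> rounds \<open>\<psi>\<close> down to a
        multiple of \<open>h\<close>. By \<open>q \<le> n + 1\<close> none of them is missing from
        the index range.\<close>
      have "{k\<in>{1..Suc n}. x \<le> a k} = {1..nat \<lfloor>q\<rfloor>}"
      proof -
        have "x \<le> a k \<longleftrightarrow> int k \<le> \<lfloor>q\<rfloor>" if "k \<in> {1..Suc n}" for k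
          using a(2)[OF that x] hpos by (simp add: q_def le_floor_iff pos_le_divide_eq)
        moreover have "k \<le> Suc n" if "int k \<le> \<lfloor>q\<rfloor>" for k
          using that q by (simp add: le_floor_iff)
        ultimately show ?thesis
          by (auto simp: le_nat_iff)
      qed
      moreover have "(\<Sum>k\<in>I. h * indicator {..a k} x) = h * real (card {k\<in>I. x \<le> a k})"
        if "finite I" for I
        using that unfolding sum_distrib_left[symmetric]
        by (simp add: indicator_def sum.If_cases Int_def)
      then have "\<phi> x = h * real (card {k\<in>{1..Suc n}. x \<le> a k})"
        unfolding \<phi>_def by blast
      ultimately have "\<phi> x = h * of_int \<lfloor>q\<rfloor>"
        using q by simp
      moreover have "\<psi> x = h * q"
        using hpos by (simp add: q_def)
      ultimately have "\<psi> x - \<phi> x = h * (q - of_int \<lfloor>q\<rfloor>)"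
        by (simp add: right_diff_distrib)
      moreover have "0 \<le> q - of_int \<lfloor>q\<rfloor>" "q - of_int \<lfloor>q\<rfloor> \<le> 1"
        by linarith+
      ultimately show ?thesis
        using hpos by (simp add: abs_mult)
    qed
    define \<Phi>' where "\<Phi>' = (\<lambda>s. \<Sum>k\<in>{1..Suc n}. of_real h * (of_real (indicator {..a k} (s $ i)) * \<Phi> s))"
    have adm1: "admissible (\<lambda>s. of_real (indicator {..a k} (s $ i)) * \<Phi> s)" for k
      by (intro admissible_mult admissible_halfspace adm)
    have adm2: "admissible \<Phi>'"
      unfolding \<Phi>'_def by (intro admissible_sum admissible_mult admissible_const adm1)
    have Phi': "\<Phi>' s = of_real (\<phi> (s $ i)) * \<Phi> s" for s
      by (simp only: \<Phi>'_def \<phi>_def of_real_sum of_real_mult sum_distrib_right mult.assoc)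
    have "p (box_integral g \<Phi>' t) \<le> (\<Sum>k\<in>{1..Suc n}. h * C)"
    proof -
      have "box_integral g \<Phi>' t = (\<Sum>k\<in>{1..Suc n}. smul (of_real h)
          (box_integral g (\<lambda>s. of_real (indicator {..a k} (s $ i)) * \<Phi> s) t))"
        unfolding \<Phi>'_def by (rule box_integral_sum[OF g _ adm1]) simp
      also have "p \<dots> \<le> (\<Sum>k\<in>{1..Suc n}. h * p (box_integral g (\<lambda>s. of_real (indicator {..a k} (s $ i)) * \<Phi> s) t))"
        by (rule order.trans[OF seminorm_sum[OF p]]) (simp add: seminorm_scale[OF p] h)
      also have "\<dots> \<le> (\<Sum>k\<in>{1..Suc n}. h * C)"
        using a(1) by (intro sum_mono mult_left_mono h tame_bound[OF tame_halfspace[OF g tame] t])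
      finally show ?thesis .
    qed
    also have "\<dots> = \<psi> 0 * C"
      unfolding hn[symmetric] by (simp add: algebra_simps)
    finally have 1: "p (box_integral g \<Phi>' t) \<le> \<psi> 0 * C" .
    have 2: "p (box_integral g (\<lambda>s. of_real (\<psi> (s $ i)) * \<Phi> s - \<Phi>' s) t) \<le> (h * B) * N"
    proof (rule N(2))
      show "admissible (\<lambda>s. of_real (\<psi> (s $ i)) * \<Phi> s - \<Phi>' s)"
        by (intro admissible_diff adm' adm2)
      fix s assume s: "s \<in> {0..t}"
      then have "s $ i \<in> {0..t $ i}" by (auto simp: less_eq_vec_def)
      then have "cmod (of_real (\<psi> (s $ i) - \<phi> (s $ i)) * \<Phi> s) \<le> h * B"
        unfolding norm_mult using err B s h by (intro mult_mono) (auto simp del: of_real_diff)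
      then show "cmod (of_real (\<psi> (s $ i)) * \<Phi> s - \<Phi>' s) \<le> h * B"
        by (simp add: Phi' left_diff_distrib)
    qed (use h B in simp)
    have "box_integral g (\<lambda>s. of_real (\<psi> (s $ i)) * \<Phi> s) t
        = box_integral g (\<lambda>s. of_real (\<psi> (s $ i)) * \<Phi> s - \<Phi>' s) t + box_integral g \<Phi>' t"
      by (simp add: box_integral_diff[OF g adm' adm2])
    then have "p (box_integral g (\<lambda>s. of_real (\<psi> (s $ i)) * \<Phi> s) t) \<le> h * B * N + \<psi> 0 * C"
      using seminorm_triangle[OF p] 1 2 by (smt (verit))
    then show ?thesis
      by (simp add: h_def)
  qed
  moreover have "(\<lambda>n. \<psi> 0 * C + (\<psi> 0 * B * N) / real (Suc n)) \<longlonglongrightarrow> \<psi> 0 * C + 0"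
    by (intro tendsto_add tendsto_const LIMSEQ_Suc lim_const_over_n)
  ultimately show "p (box_integral g (\<lambda>s. of_real (\<psi> (s $ i)) * \<Phi> s) t) \<le> \<psi> 0 * C"
    by (intro LIMSEQ_le_const) auto
qed

end

section \<open>Gamma weights\<close>

definition poisson_cdf :: "real \<Rightarrow> nat \<Rightarrow> real \<Rightarrow> real" where
  "poisson_cdf e m x = exp (- (e * x)) * (\<Sum>i\<le>m. (e * x) ^ i / fact i)"

lemma poisson_cdf_0: "poisson_cdf e m 0 = 1"
  by (simp add: poisson_cdf_def sum.atMost_shift)

lemma poisson_cdf_nonneg: "0 \<le> e \<Longrightarrow> 0 \<le> x \<Longrightarrow> 0 \<le> poisson_cdf e m x"
  by (simp add: poisson_cdf_def sum_nonneg)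

lemma poisson_cdf_Suc:
  "poisson_cdf e (Suc m) x - poisson_cdf e m x = exp (- (e * x)) * (e * x) ^ Suc m / fact (Suc m)"
  by (simp add: poisson_cdf_def algebra_simps)

text \<open>The derivative telescopes to minus the gamma density of shape \<open>m + 1\<close> and
  rate \<open>e\<close>; its sign gives monotonicity.\<close>

lemma poisson_cdf_deriv:
  "(poisson_cdf e m has_real_derivative - (e * exp (- (e * x)) * (e * x) ^ m / fact m)) (at x)"
proof (induction m)
  case 0
  show ?case
    unfolding poisson_cdf_def by (auto intro!: derivative_eq_intros)
next
  case (Suc m)
  have eq: "poisson_cdf e (Suc m) = (\<lambda>x. poisson_cdf e m x + exp (- (e * x)) * (e * x) ^ Suc m / fact (Suc m))"
    using poisson_cdf_Suc[of e m] by (auto simp: algebra_simps)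
  have "((\<lambda>x. exp (- (e * x)) * (e * x) ^ Suc m / fact (Suc m)) has_real_derivative
      (exp (- (e * x)) * (- e) * (e * x) ^ Suc m + (real (Suc m) * (e * x) ^ m * e) * exp (- (e * x))) / fact (Suc m)) (at x)"
    by (auto intro!: derivative_eq_intros simp del: power_Suc fact_Suc)
  moreover have "real (Suc m) * c / fact (Suc m) = c / fact m" for c :: real
    by (simp del: of_nat_Suc)
  then have "(exp (- (e * x)) * (- e) * (e * x) ^ Suc m + (real (Suc m) * (e * x) ^ m * e) * exp (- (e * x))) / fact (Suc m)
      = - (e * exp (- (e * x)) * (e * x) ^ Suc m / fact (Suc m)) + e * exp (- (e * x)) * (e * x) ^ m / fact m"
    unfolding add_divide_distrib mult.assoc by (simp only:) (simp add: mult_ac)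
  ultimately show ?case
    unfolding eq by (intro DERIV_cong[OF DERIV_add[OF Suc.IH]]) auto
qed

lemma poisson_cdf_antimono:
  assumes "0 \<le> e"
  shows "antimono_on {0..} (poisson_cdf e m)"
proof (rule monotone_onI)
  fix x y :: real assume x: "x \<in> {0..}" "y \<in> {0..}" "x \<le> y"
  show "poisson_cdf e m y \<le> poisson_cdf e m x"
  proof (rule DERIV_nonpos_imp_nonincreasing[OF x(3)])
    fix z assume "x \<le> z" "z \<le> y"
    then show "\<exists>d. (poisson_cdf e m has_real_derivative d) (at z) \<and> d \<le> 0"
      using x assms
      by (intro exI[of _ "- (e * exp (- (e * z)) * (e * z) ^ m / fact m)"] conjI poisson_cdf_deriv) auto
  qed
qed

lemma poisson_cdf_continuous: "continuous_on UNIV (poisson_cdf e m)"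
  unfolding poisson_cdf_def by (intro continuous_intros) auto

text \<open>For positive \<open>e\<close> and nonnegative \<open>x\<close>, \<open>e ^ m\<close>
  times this weight is the probability that a Poisson variable of mean \<open>e * x\<close> equals
  \<open>m\<close>; this is the origin of the powers \<open>1 / e ^ m\<close> in the bounds.\<close>

definition gamma_weight :: "real \<Rightarrow> nat \<Rightarrow> real \<Rightarrow> complex" where
  "gamma_weight e m x = of_real (exp (- (e * x)) * x ^ m / fact m)"

text \<open>Divides the decay in two: one half keeps control of the monomial, the other makes tails
  small.\<close>

lemma gamma_weight_half: "gamma_weight e m x = of_real (exp (- (e / 2 * x))) * gamma_weight (e / 2) m x"
proof -
  have "exp (- (e * x)) = exp (- (e / 2 * x)) * exp (- (e / 2 * x))"
    by (simp add: exp_add[symmetric])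
  then show ?thesis
    unfolding gamma_weight_def by simp
qed

definition diagonal :: "'a \<Rightarrow> 'a^'n" where
  "diagonal a = (\<chi> j. a)"

lemma diagonal_nth [simp]: "diagonal a $ j = a"
  by (simp add: diagonal_def)

context sclcs
begin

text \<open>For positive \<open>m\<close> the weight first increases, so
  \<open>tame_antimono\<close> is applied to the two distribution functions whose difference it is;
  this costs the factor 2. For \<open>m = 0\<close> the weight is itself a distribution function,
  and the 2 is kept for a uniform formula.\<close>

lemma tame_gamma_weight:
  fixes i :: "'n::finite"
  assumes g: "locally_integrable_orthant P g" and p: "p \<in> P" and tame: "tame p g C \<Phi>" and e: "0 < e"
  shows "tame p g (2 / e ^ m * C) (\<lambda>s. gamma_weight e m (s $ i) * \<Phi> s)"
proof -
  have C: "0 \<le> C" by (rule tame_nonneg[OF tame p])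
  have Q: "tame p g C (\<lambda>s. of_real (poisson_cdf e k (s $ i)) * \<Phi> s)" for k
  proof -
    have "tame p g (poisson_cdf e k 0 * C) (\<lambda>s. of_real (poisson_cdf e k (s $ i)) * \<Phi> s)"
      using e by (intro tame_antimono[OF g p tame] poisson_cdf_continuous poisson_cdf_antimono
          poisson_cdf_nonneg) auto
    then show ?thesis by (simp add: poisson_cdf_0)
  qed
  show ?thesis
  proof (cases m)
    case 0
    then have "gamma_weight e m x = of_real (poisson_cdf e 0 x)" for x
      by (simp add: gamma_weight_def poisson_cdf_def)
    then show ?thesis
      using tame_mono[OF Q[of 0], of "2 / e ^ m * C"] 0 C by simp
  next
    case (Suc k)
    have w: "gamma_weight e m x = of_real (1 / e ^ m) * (of_real (poisson_cdf e m x) - of_real (poisson_cdf e k x))" for x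
      unfolding of_real_diff[symmetric] Suc poisson_cdf_Suc of_real_mult[symmetric] gamma_weight_def
      using e by (simp add: power_mult_distrib field_simps del: of_real_mult of_real_divide)
    have "tame p g (cmod (of_real (1 / e ^ m)) * (C + C))
        (\<lambda>s. of_real (1 / e ^ m) * (of_real (poisson_cdf e m (s $ i)) * \<Phi> s - of_real (poisson_cdf e k (s $ i)) * \<Phi> s))"
      by (intro tame_scale tame_diff g p Q)
    then show ?thesis
      using e unfolding w by (simp add: algebra_simps norm_divide norm_power)
  qed
qed

lemma tame_exp:
  fixes i :: "'n::finite"
  assumes g: "locally_integrable_orthant P g" and p: "p \<in> P" and tame: "tame p g C \<Phi>" and e: "0 \<le> e"
  shows "tame p g C (\<lambda>s. of_real (exp (- (e * s $ i))) * \<Phi> s)"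
proof -
  have "tame p g (exp (- (e * 0)) * C) (\<lambda>s. of_real (exp (- (e * s $ i))) * \<Phi> s)"
    by (rule tame_antimono[OF g p tame])
      (use e in \<open>auto intro!: continuous_intros monotone_onI mult_left_mono\<close>)
  then show ?thesis by simp
qed

text \<open>The cut-off exponential jumps up at \<open>a\<close>, so it is not monotone. It equals
  the exponential frozen at its value at \<open>a\<close> up to \<open>a\<close>, minus that value
  times the indicator of \<open>{..a}\<close>. Both parts decrease and start at
  \<open>exp (- (e * a))\<close>.\<close>

lemma tame_exp_tail:
  fixes i :: "'n::finite"
  assumes g: "locally_integrable_orthant P g" and p: "p \<in> P" and tame: "tame p g C \<Phi>"
    and e: "0 \<le> e" and a: "0 \<le> a"
  shows "tame p g (2 * exp (- (e * a)) * C)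
    (\<lambda>s. (1 - of_real (indicator {..a} (s $ i))) * (of_real (exp (- (e * s $ i))) * \<Phi> s))"
proof -
  have 1: "tame p g (exp (- (e * max 0 a)) * C) (\<lambda>s. of_real (exp (- (e * max (s $ i) a))) * \<Phi> s)"
    by (rule tame_antimono[OF g p tame])
      (use e in \<open>auto intro!: continuous_intros monotone_onI mult_left_mono\<close>)
  have 2: "tame p g (cmod (of_real (exp (- (e * a)))) * C)
      (\<lambda>s. of_real (exp (- (e * a))) * (of_real (indicator {..a} (s $ i)) * \<Phi> s))"
    by (intro tame_scale tame_halfspace g p tame a)
  have eq: "(1 - of_real (indicator {..a} x)) * (of_real (exp (- (e * x))) * c)
      = of_real (exp (- (e * max x a))) * c - of_real (exp (- (e * a))) * (of_real (indicator {..a} x) * c)"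
    for x and c :: complex
    by (auto simp: indicator_def max_def algebra_simps)
  have "exp (- (e * max 0 a)) * C + cmod (of_real (exp (- (e * a)))) * C = 2 * exp (- (e * a)) * C"
    using a by (simp add: max_absorb2)
  then show ?thesis
    using tame_diff[OF g p 1 2] unfolding eq by (simp only:)
qed

lemma tame_prod:
  assumes "finite J" and tame: "tame p g C \<Phi>"
    and step: "\<And>i C \<Phi>. i \<in> J \<Longrightarrow> tame p g C \<Phi> \<Longrightarrow> tame p g (c i * C) (\<lambda>s. \<psi> i s * \<Phi> s)"
  shows "tame p g ((\<Prod>i\<in>J. c i) * C) (\<lambda>s. (\<Prod>i\<in>J. \<psi> i s) * \<Phi> s)"
  using assms(1) step
proof (induction J)
  case empty
  then show ?case using tame by simp
next
  case (insert i J)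
  then have "tame p g (c i * ((\<Prod>i\<in>J. c i) * C)) (\<lambda>s. \<psi> i s * ((\<Prod>i\<in>J. \<psi> i s) * \<Phi> s))"
    by blast
  then show ?case
    using insert.hyps by (simp add: mult.assoc)
qed

lemma tame_gamma_weights:
  assumes g: "locally_integrable_orthant P g" and p: "p \<in> P" and tame: "tame p g C (\<lambda>_. 1)" and e: "0 < e"
  shows "tame p g ((\<Prod>j\<in>UNIV. 2 / e ^ (m $ j)) * C) (\<lambda>s. \<Prod>j\<in>UNIV. gamma_weight e (m $ j) (s $ j))"
  using tame_prod[OF finite tame, of UNIV "\<lambda>j. 2 / e ^ (m $ j)" "\<lambda>j s. gamma_weight e (m $ j) (s $ j)"]
    tame_gamma_weight[OF g p _ e] by simp

text \<open>By \<open>1 - x y = (1 - x) + x (1 - y)\<close> the complement of a cube splits into one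
  piece per coordinate, each a half-space tail that is cut further by half-spaces at no
  cost.\<close>

lemma tame_box_complement:
  assumes g: "locally_integrable_orthant P g" and p: "p \<in> P" and "finite J" and a: "0 \<le> a"
    and adm: "admissible \<Phi>"
    and tail: "\<And>i. i \<in> J \<Longrightarrow> tame p g D (\<lambda>s. (1 - of_real (indicator {..a} (s $ i))) * \<Phi> s)"
  shows "tame p g (real (card J) * D) (\<lambda>s. (1 - (\<Prod>i\<in>J. of_real (indicator {..a} (s $ i)))) * \<Phi> s)"
  using assms(3) tail
proof (induction J)
  case empty
  have "box_integral g (\<lambda>s. 0 * \<Phi> s) t = 0" for t
    using box_integral_scale[OF g adm, of 0 t] by simp
  then show ?case
    by (simp add: tame_def admissible_const seminorm_zero[OF p])
next
  case (insert i J)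
  have eq: "(1 - x * y) * z = (1 - x) * z + x * ((1 - y) * z)" for x y z :: complex
    by (simp add: algebra_simps)
  have "tame p g (D + real (card J) * D) (\<lambda>s. (1 - of_real (indicator {..a} (s $ i))) * \<Phi> s
      + of_real (indicator {..a} (s $ i)) * ((1 - (\<Prod>i\<in>J. of_real (indicator {..a} (s $ i)))) * \<Phi> s))"
    using insert by (intro tame_add tame_halfspace g p a) auto
  then show ?case
    using insert.hyps by (simp add: eq algebra_simps del: left_diff_distrib right_diff_distrib)
qed

section \<open>Joint limits over boxes\<close>

text \<open>Completeness is available for sequences only, whereas the limit runs over a directed set
  of vectors. The limit is found along the cofinal diagonal sequence and the rest is compared with
  it.\<close>

lemma tendsto_at_top_vecI:
  fixes H :: "real^'n \<Rightarrow> 'x"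
  assumes "\<And>p. p \<in> P \<Longrightarrow> \<exists>D. D \<longlonglongrightarrow> 0 \<and>
    (\<forall>k t. diagonal (real k) \<le> t \<longrightarrow> p (H t - H (diagonal (real k))) \<le> D k)"
  shows "\<exists>L. (H \<longlongrightarrow> L) at_top"
proof -
  have "\<exists>L. (\<lambda>k. H (diagonal (real k))) \<longlonglongrightarrow> L"
  proof (rule sequentially_complete, intro ballI allI impI)
    fix p and e :: real assume p: "p \<in> P" and e: "e > 0"
    obtain D where D: "D \<longlonglongrightarrow> 0" "\<And>k t. diagonal (real k) \<le> t \<Longrightarrow> p (H t - H (diagonal (real k))) \<le> D k"
      using assms[OF p] by blast
    have "\<forall>\<^sub>F k in sequentially. D k < e / 2"
      using order_tendstoD(2)[OF D(1), of "e / 2"] e by simp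
    then obtain N where N: "D N < e / 2"
      by (auto simp: eventually_sequentially)
    have "p (H (diagonal (real k)) - H (diagonal (real m))) < e" if "k \<ge> N" "m \<ge> N" for k m
    proof -
      have "p (H (diagonal (real k)) - H (diagonal (real N))) \<le> D N"
        "p (H (diagonal (real m)) - H (diagonal (real N))) \<le> D N"
        using that by (intro D(2); simp add: less_eq_vec_def)+
      then show ?thesis
        using N seminorm_diff_triangle[OF p, of "H (diagonal (real k))" "H (diagonal (real m))" "H (diagonal (real N))"]
          seminorm_commute[OF p, of "H (diagonal (real m))" "H (diagonal (real N))"] by simp
    qed
    then show "\<exists>N. \<forall>k\<ge>N. \<forall>m\<ge>N. p (H (diagonal (real k)) - H (diagonal (real m))) < e"
      by blast
  qed
  then obtain L where L: "(\<lambda>k. H (diagonal (real k))) \<longlonglongrightarrow> L" by blast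
  have "(H \<longlongrightarrow> L) at_top"
    unfolding tendsto_iff_seminorms
  proof (intro ballI allI impI)
    fix p and e :: real assume p: "p \<in> P" and e: "e > 0"
    obtain D where D: "D \<longlonglongrightarrow> 0" "\<And>k t. diagonal (real k) \<le> t \<Longrightarrow> p (H t - H (diagonal (real k))) \<le> D k"
      using assms[OF p] by blast
    have "\<forall>\<^sub>F k in sequentially. D k < e / 2 \<and> p (H (diagonal (real k)) - L) < e / 2"
      using order_tendstoD(2)[OF D(1) half_gt_zero[OF e]] L half_gt_zero[OF e] p
      unfolding tendsto_iff_seminorms by (intro eventually_conj) blast+
    then obtain N where N: "D N < e / 2" "p (H (diagonal (real N)) - L) < e / 2"
      by (auto simp: eventually_sequentially)
    have "p (H t - L) < e" if "diagonal (real N) \<le> t" for t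
      using D(2)[OF that] N seminorm_diff_triangle[OF p, of "H t" L "H (diagonal (real N))"] by simp
    then show "\<forall>\<^sub>F t in at_top. p (H t - L) < e"
      unfolding eventually_at_top_vec
      by (intro exI[of _ "real N"]) (auto simp: less_eq_vec_def intro: less_imp_le)
  qed
  then show ?thesis by blast
qed

lemma box_integral_gamma_convergent:
  fixes g :: "real^'n \<Rightarrow> 'x"
  assumes g: "locally_integrable_orthant P g" and e: "0 < e"
    and tame: "\<And>p. p \<in> P \<Longrightarrow> \<exists>C. tame p g C (\<lambda>_. 1)"
  shows "\<exists>L. (box_integral g (\<lambda>s. \<Prod>j\<in>UNIV. gamma_weight e (m $ j) (s $ j)) \<longlongrightarrow> L) at_top"
proof (rule tendsto_at_top_vecI)
  fix p assume p: "p \<in> P"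
  define W where "W = (\<lambda>s::real^'n. \<Prod>j\<in>UNIV. gamma_weight e (m $ j) (s $ j))"
  obtain C where C: "tame p g C (\<lambda>_. 1)"
    using tame[OF p] by blast
  have admW: "admissible W"
    unfolding W_def by (rule tame_admissible[OF tame_gamma_weights[OF g p C e]])
  \<comment> \<open>The constant of the gamma weights of rate \<open>e / 2\<close>; the other half
    of the decay is reserved for the tail.\<close>
  define C' where "C' = (\<Prod>j\<in>UNIV. 2 / (e / 2) ^ (m $ j)) * C"
  have tail: "tame p g (2 * exp (- (e / 2 * a)) * C') (\<lambda>s. (1 - of_real (indicator {..a} (s $ i))) * W s)"
    if a: "0 \<le> a" for a i
  proof -
    \<comment> \<open>Coordinate \<open>i\<close> is left out of the first product since
      \<open>tame_exp_tail\<close> contributes its exponential together with the cut-off.\<close>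
    define \<Phi> where "\<Phi> = (\<lambda>s::real^'n. (\<Prod>j\<in>UNIV - {i}. of_real (exp (- (e / 2 * s $ j)))) *
      (\<Prod>j\<in>UNIV. gamma_weight (e / 2) (m $ j) (s $ j)))"
    have "tame p g C' (\<lambda>s. \<Prod>j\<in>UNIV. gamma_weight (e / 2) (m $ j) (s $ j))"
      unfolding C'_def using e by (intro tame_gamma_weights g p C) simp
    from tame_prod[OF finite_Diff[OF finite] this, of "UNIV" "{i}" "\<lambda>_. 1" "\<lambda>j s. of_real (exp (- (e / 2 * s $ j)))"]
    have "tame p g C' \<Phi>"
      using tame_exp[OF g p, of _ _ "e / 2"] e by (simp add: \<Phi>_def)
    from tame_exp_tail[OF g p this, of "e / 2" a i]
    have "tame p g (2 * exp (- (e / 2 * a)) * C')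
        (\<lambda>s. (1 - of_real (indicator {..a} (s $ i))) * (of_real (exp (- (e / 2 * s $ i))) * \<Phi> s))"
      using e a by simp
    moreover have "of_real (exp (- (e / 2 * s $ i))) * \<Phi> s = W s" for s
    proof -
      have "W s = (\<Prod>j\<in>UNIV. of_real (exp (- (e / 2 * s $ j)))) * (\<Prod>j\<in>UNIV. gamma_weight (e / 2) (m $ j) (s $ j))"
        unfolding W_def by (subst gamma_weight_half) (rule prod.distrib)
      also have "(\<Prod>j\<in>UNIV. complex_of_real (exp (- (e / 2 * s $ j))))
          = of_real (exp (- (e / 2 * s $ i))) * (\<Prod>j\<in>UNIV - {i}. of_real (exp (- (e / 2 * s $ j))))"
        by (rule prod.remove) auto
      finally show ?thesis
        by (simp only: \<Phi>_def mult.assoc)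
    qed
    ultimately show ?thesis by simp
  qed
  define D where "D k = real CARD('n) * (2 * exp (- (e / 2 * real k)) * C')" for k :: nat
  have "((\<lambda>k. exp (- (e / 2 * real k))) \<longlonglongrightarrow> 0)"
  proof -
    have "filterlim (\<lambda>k. e / 2 * real k) at_top sequentially"
      using e by (intro filterlim_tendsto_pos_mult_at_top[OF tendsto_const _ filterlim_real_sequentially]) simp
    then have "filterlim (\<lambda>k. - (e / 2 * real k)) at_bot sequentially"
      by (simp add: filterlim_uminus_at_top)
    then show ?thesis
      by (rule filterlim_compose[OF exp_at_bot])
  qed
  then have "D \<longlonglongrightarrow> real CARD('n) * (2 * 0 * C')"
    unfolding D_def by (intro tendsto_intros)
  then have D0: "D \<longlonglongrightarrow> 0" by simp
  have D1: "p (box_integral g W t - box_integral g W (diagonal (real k))) \<le> D k"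
    if t: "diagonal (real k) \<le> t" for k t
  proof -
    \<comment> \<open>On the orthant this is the indicator of the cube of side \<open>k\<close>. As
      \<open>t\<close> dominates the corner of the cube, cutting the box by it leaves the whole
      cube.\<close>
    let ?I = "\<lambda>s::real^'n. \<Prod>i\<in>UNIV. complex_of_real (indicator {..real k} (s $ i))"
    have "tame p g (real CARD('n) * (2 * exp (- (e / 2 * real k)) * C')) (\<lambda>s. (1 - ?I s) * W s)"
      by (intro tame_box_complement g p admW tail) auto
    then have t1: "tame p g (D k) (\<lambda>s. (1 - ?I s) * W s)"
      by (simp add: D_def)
    have "(0::real^'n) \<le> diagonal (real k)"
      by (simp add: less_eq_vec_def)
    then have "0 \<le> t"
      using t by (rule order.trans)
    then have b: "p (box_integral g (\<lambda>s. (1 - ?I s) * W s) t) \<le> D k"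
      by (rule tame_bound[OF t1])
    have admI: "admissible ?I"
    proof -
      have "admissible (\<lambda>s. \<Prod>i\<in>J. complex_of_real (indicator {..real k} (s $ i)))" if "finite J" for J :: "'n set"
        using that by induction (simp_all add: admissible_const admissible_mult admissible_halfspace)
      then show ?thesis by simp
    qed
    have "box_integral g (\<lambda>s. ?I s * W s) t = box_integral g W (diagonal (real k))"
    proof (rule box_integral_indicator[OF g admW t])
      fix s assume s: "s \<in> {0..t}"
      show "?I s = indicator {0..diagonal (real k)} s"
      proof (cases "s \<in> {0..diagonal (real k)}")
        case True
        then show ?thesis by (auto simp: less_eq_vec_def)
      next
        case False
        then obtain j where "\<not> s $ j \<le> real k"
          using s by (auto simp: less_eq_vec_def)
        then have "?I s = 0"
          by (intro prod_zero bexI[of _ j]) (auto simp: indicator_def)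
        then show ?thesis using False by simp
      qed
    qed
    moreover have "box_integral g (\<lambda>s. (1 - ?I s) * W s) t
        = box_integral g W t - box_integral g (\<lambda>s. ?I s * W s) t"
      using box_integral_diff[OF g admW admissible_mult[OF admI admW]] by (simp add: left_diff_distrib)
    ultimately show ?thesis
      using b by simp
  qed
  show "\<exists>D. D \<longlonglongrightarrow> 0 \<and> (\<forall>k t. diagonal (real k) \<le> t \<longrightarrow>
      p (box_integral g (\<lambda>s. \<Prod>j\<in>UNIV. gamma_weight e (m $ j) (s $ j)) t -
         box_integral g (\<lambda>s. \<Prod>j\<in>UNIV. gamma_weight e (m $ j) (s $ j)) (diagonal (real k))) \<le> D k)"
    using D0 D1 unfolding W_def by blast
qed

end

section \<open>Products of series over multi-indices\<close>

text \<open>A finite set of multi-indices lies in a cube, and over a cube the sum of products is a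
  product of partial sums.\<close>

lemma summable_on_prod_vec:
  fixes a :: "'n::finite \<Rightarrow> nat \<Rightarrow> real"
  assumes nonneg: "\<And>j k. 0 \<le> a j k" and sum: "\<And>j. summable (a j)"
  shows "(\<lambda>m::nat^'n. \<Prod>j\<in>UNIV. a j (m $ j)) summable_on UNIV"
proof (rule nonneg_bdd_above_summable_on)
  show "0 \<le> (\<Prod>j\<in>UNIV. a j (m $ j))" for m :: "nat^'n"
    by (intro prod_nonneg nonneg)
  have "(\<Sum>m\<in>F. \<Prod>j\<in>UNIV. a j (m $ j)) \<le> (\<Prod>j\<in>UNIV. suminf (a j))" if "finite F" for F :: "(nat^'n) set"
  proof -
    define N where "N = Max ((\<lambda>(m, j). m $ j) ` (F \<times> UNIV))"
    have N: "m $ j \<le> N" if "m \<in> F" for m j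
      unfolding N_def using that \<open>finite F\<close> by (intro Max_ge) (auto simp: image_iff intro!: bexI[of _ m])
    have "(\<Sum>m\<in>F. \<Prod>j\<in>UNIV. a j (m $ j)) = (\<Sum>h\<in>vec_nth ` F. \<Prod>j\<in>UNIV. a j (h j))"
      by (subst sum.reindex) (auto simp: inj_on_def vec_eq_iff)
    also have "\<dots> \<le> (\<Sum>h\<in>PiE UNIV (\<lambda>_. {..N}). \<Prod>j\<in>UNIV. a j (h j))"
      using N by (intro sum_mono2 finite_PiE prod_nonneg nonneg) auto
    also have "\<dots> = (\<Prod>j\<in>UNIV. \<Sum>k\<le>N. a j k)"
      by (rule prod_sum_PiE[symmetric]) auto
    also have "\<dots> \<le> (\<Prod>j\<in>UNIV. suminf (a j))"
      by (intro prod_mono conjI sum_nonneg nonneg sum_le_suminf sum) auto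
    finally show ?thesis .
  qed
  then show "bdd_above (sum (\<lambda>m::nat^'n. \<Prod>j\<in>UNIV. a j (m $ j)) ` {F. F \<subseteq> UNIV \<and> finite F})"
    by (intro bdd_aboveI) auto
qed

lemma has_sum_prod_vec:
  fixes a :: "'n::finite \<Rightarrow> nat \<Rightarrow> complex"
  assumes sum: "\<And>j. summable (\<lambda>k. cmod (a j k))"
  shows "((\<lambda>m::nat^'n. \<Prod>j\<in>UNIV. a j (m $ j)) has_sum (\<Prod>j\<in>UNIV. suminf (a j))) UNIV"
proof -
  have "(\<lambda>m::nat^'n. \<Prod>j\<in>UNIV. cmod (a j (m $ j))) summable_on UNIV"
    by (rule summable_on_prod_vec) (auto intro: sum)
  then have "(\<lambda>m::nat^'n. \<Prod>j\<in>UNIV. a j (m $ j)) summable_on UNIV"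
    unfolding prod_norm by (rule abs_summable_summable)
  then have "((\<lambda>m::nat^'n. \<Prod>j\<in>UNIV. a j (m $ j)) has_sum
      infsum (\<lambda>m::nat^'n. \<Prod>j\<in>UNIV. a j (m $ j)) UNIV) UNIV"
    by (rule has_sum_infsum)
  moreover have "infsum (\<lambda>m::nat^'n. \<Prod>j\<in>UNIV. a j (m $ j)) UNIV = (\<Prod>j\<in>UNIV. suminf (a j))"
  proof -
    have abs: "(\<lambda>k. norm (a j k)) summable_on UNIV" for j
      using sum[of j] by (intro norm_summable_imp_summable_on) simp
    have "infsum (\<lambda>m::nat^'n. \<Prod>j\<in>UNIV. a j (m $ j)) UNIV
        = infsum ((\<lambda>h. \<Prod>j\<in>UNIV. a j (h j)) \<circ> vec_nth) (UNIV :: (nat^'n) set)"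
      by (simp add: o_def)
    also have "\<dots> = infsum (\<lambda>h. \<Prod>j\<in>UNIV. a j (h j)) (range (vec_nth :: nat^'n \<Rightarrow> _))"
      by (rule infsum_reindex[symmetric]) (auto simp: inj_on_def vec_eq_iff)
    also have "range (vec_nth :: nat^'n \<Rightarrow> _) = PiE UNIV (\<lambda>_. UNIV)"
      using surjI[of vec_nth vec_lambda] by (auto simp: vec_lambda_inverse)
    also have "infsum (\<lambda>h. \<Prod>j\<in>UNIV. a j (h j)) (PiE UNIV (\<lambda>_. UNIV)) = (\<Prod>j\<in>UNIV. infsum (a j) UNIV)"
      by (rule infsum_prod_PiE_abs) (auto intro: abs)
    also have "\<dots> = (\<Prod>j\<in>UNIV. suminf (a j))"
      using norm_summable_imp_has_sum[OF sum summable_sums[OF summable_norm_cancel[OF sum]]]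
      by (intro prod.cong refl infsumI)
    finally show ?thesis .
  qed
  ultimately show ?thesis by simp
qed

text \<open>Cauchy's criterion for unordered sums. Speaking of sets disjoint from \<open>A\<close>
  lets it bound the difference of any two partial sums beyond \<open>A\<close>.\<close>

lemma summable_on_tail:
  fixes b :: "'a \<Rightarrow> real"
  assumes b: "b summable_on UNIV" and nonneg: "\<And>x. 0 \<le> b x" and e: "0 < e"
  shows "\<exists>A. finite A \<and> (\<forall>F. finite F \<and> F \<inter> A = {} \<longrightarrow> sum b F < e)"
proof -
  obtain S where S: "(b has_sum S) UNIV"
    using b by (auto simp: summable_on_def)
  then have "\<forall>\<^sub>F A in finite_subsets_at_top UNIV. S - e < sum b A"
    unfolding has_sum_def using e by (intro order_tendstoD(1)[where y = S]) auto
  then obtain A where A: "finite A" "S - e < sum b A"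
    unfolding eventually_finite_subsets_at_top by auto
  have "sum b F < e" if F: "finite F" "F \<inter> A = {}" for F
  proof -
    have "sum b (F \<union> A) \<le> S"
      by (rule finite_sum_le_has_sum[OF S]) (use F A nonneg in auto)
    then show ?thesis
      using A F by (simp add: sum.union_disjoint)
  qed
  then show ?thesis using A by blast
qed

text \<open>The terms are dominated by those at the radii \<open>R\<close>, so the tail set
  \<open>A\<close> of the dominating series works for all \<open>x\<close> at once. Later
  \<open>x\<close> depends on a point of a box and \<open>R\<close> on its corner.\<close>

lemma exp_multi_series_uniform:
  fixes R :: "'n::finite \<Rightarrow> real"
  assumes d: "0 < d"
  shows "\<exists>A::(nat^'n) set. finite A \<and> (\<forall>B x. finite B \<and> A \<subseteq> B \<and> (\<forall>j. cmod (x j) \<le> R j) \<longrightarrow>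
    cmod ((\<Prod>j\<in>UNIV. exp (x j)) - (\<Sum>m\<in>B. \<Prod>j\<in>UNIV. x j ^ (m $ j) / fact (m $ j))) \<le> d)"
proof (cases "\<forall>j. 0 \<le> R j")
  case R: True
  have "summable (\<lambda>k. R j ^ k / fact k)" for j
    using summable_exp[of "R j"] by (simp add: divide_inverse mult.commute)
  then have "(\<lambda>m::nat^'n. \<Prod>j\<in>UNIV. R j ^ (m $ j) / fact (m $ j)) summable_on UNIV"
    using R by (intro summable_on_prod_vec) auto
  from summable_on_tail[OF this _ d] obtain A :: "(nat^'n) set" where A: "finite A"
    "\<And>F. finite F \<Longrightarrow> F \<inter> A = {} \<Longrightarrow> (\<Sum>m\<in>F. \<Prod>j\<in>UNIV. R j ^ (m $ j) / fact (m $ j)) < d"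
    using R by (auto simp: prod_nonneg)
  have "cmod ((\<Prod>j\<in>UNIV. exp (x j)) - (\<Sum>m\<in>B. \<Prod>j\<in>UNIV. x j ^ (m $ j) / fact (m $ j))) \<le> d"
    if B: "finite B" "A \<subseteq> B" and x: "\<And>j. cmod (x j) \<le> R j" for B x
  proof -
    let ?f = "\<lambda>m::nat^'n. \<Prod>j\<in>UNIV. x j ^ (m $ j) / fact (m $ j)"
    have ex: "suminf (\<lambda>k. x j ^ k / fact k) = exp (x j)" for j
      by (simp add: exp_def scaleR_conv_of_real divide_inverse mult.commute)
    have "summable (\<lambda>k. cmod (x j ^ k / fact k))" for j
      using summable_norm_exp[of "x j"] by (simp add: norm_divide norm_power norm_mult norm_inverse divide_inverse mult.commute)
    from has_sum_prod_vec[OF this] have "(?f has_sum (\<Prod>j\<in>UNIV. exp (x j))) UNIV"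
      by (simp add: ex)
    then have "((\<lambda>C. cmod (sum ?f C - sum ?f B)) \<longlongrightarrow> cmod ((\<Prod>j\<in>UNIV. exp (x j)) - sum ?f B))
        (finite_subsets_at_top UNIV)"
      unfolding has_sum_def by (intro tendsto_intros)
    moreover have "\<forall>\<^sub>F C in finite_subsets_at_top UNIV. cmod (sum ?f C - sum ?f B) \<le> d"
      unfolding eventually_finite_subsets_at_top
    proof (intro exI[of _ B] conjI allI impI B(1) subset_UNIV)
      fix C :: "(nat^'n) set" assume C: "finite C \<and> B \<subseteq> C \<and> C \<subseteq> UNIV"
      have "sum ?f C - sum ?f B = sum ?f (C - B)"
        using C by (simp add: sum_diff)
      also have "cmod \<dots> \<le> (\<Sum>m\<in>C - B. \<Prod>j\<in>UNIV. R j ^ (m $ j) / fact (m $ j))"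
        using x by (intro order.trans[OF norm_sum] sum_mono)
          (auto simp: prod_norm[symmetric] norm_divide norm_power intro!: prod_mono divide_right_mono power_mono)
      also have "\<dots> < d"
        using C B by (intro A(2)) auto
      finally show "cmod (sum ?f C - sum ?f B) \<le> d" by simp
    qed
    ultimately show ?thesis
      by (rule tendsto_upperbound) simp
  qed
  then show ?thesis using A(1) by blast
next
  \<comment> \<open>A negative radius leaves no admissible \<open>x\<close>. This occurs for corners
    outside the orthant, whose boxes are empty.\<close>
  case False
  then obtain j where "R j < 0" by (auto simp: not_le)
  then have "\<not> (\<forall>j. cmod (x j) \<le> R j)" for x :: "'n \<Rightarrow> complex"
    using norm_ge_zero[of "x j"] by (meson not_le order.trans order.strict_trans2)
  then show ?thesis by (intro exI[of _ "{}"]) auto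
qed

section \<open>Laplace transforms and their power series\<close>

lemma laplace_kernel_prod: "laplace_kernel l s = (\<Prod>j\<in>UNIV. exp (- (l $ j * of_real (s $ j))))"
  by (simp add: laplace_kernel_def exp_sum sum_negf[symmetric])

lemma laplace_kernel_add: "laplace_kernel (l + u) s = laplace_kernel l s * laplace_kernel u s"
  by (simp add: laplace_kernel_def sum.distrib distrib_right exp_add[symmetric])

lemma laplace_kernel_continuous: "continuous_on UNIV (laplace_kernel l)"
  unfolding laplace_kernel_def by (intro continuous_intros)

definition multi_monomial :: "nat^'n \<Rightarrow> real^'n \<Rightarrow> complex" where
  "multi_monomial m s = of_real (\<Prod>j\<in>UNIV. s $ j ^ (m $ j) / fact (m $ j))"

lemma multi_monomial_continuous: "continuous_on UNIV (multi_monomial m)"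
  unfolding multi_monomial_def by (intro continuous_intros) auto

text \<open>The diagonal shift supplies one exponential per coordinate, just what each monomial
  factor lacks to be a gamma weight.\<close>

lemma laplace_kernel_times_monomial:
  "laplace_kernel (\<mu> + diagonal (of_real e)) s * multi_monomial m s
    = (\<Prod>j\<in>UNIV. gamma_weight e (m $ j) (s $ j)) * laplace_kernel \<mu> s"
  unfolding laplace_kernel_add laplace_kernel_prod[of "diagonal _"] multi_monomial_def of_real_prod
  by (simp add: gamma_weight_def prod.distrib[symmetric] exp_of_real[symmetric] mult_ac)

context sclcs
begin

lemma monomial_weight_eq: "monomial_weight smul m f = (\<lambda>s. smul (multi_monomial m s) (f s))"
  by (simp add: fun_eq_iff monomial_weight_def multi_monomial_def)

lemma locally_integrable_times:
  fixes f :: "real^'n \<Rightarrow> 'x"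
  assumes f: "locally_integrable_orthant P f" and cont: "continuous_on UNIV \<phi>"
  shows "locally_integrable_orthant P (\<lambda>s. smul (\<phi> s) (f s))"
  unfolding locally_integrable_orthant_def
proof (intro allI impI)
  fix K :: "(real^'n) set" assume K: "compact K \<and> K \<subseteq> {0..}"
  have c: "compact (\<phi> ` K)"
    using K by (intro compact_continuous_image continuous_on_subset[OF cont]) auto
  obtain B where B: "\<And>s. s \<in> K \<Longrightarrow> cmod (\<phi> s) \<le> B"
    using compact_imp_bounded[OF c] unfolding bounded_iff by auto
  show "integrable_over P K (\<lambda>s. smul (\<phi> s) (f s))"
    using f K admissible_continuous[OF cont] B
    by (intro integrable_over_times[where B = B])
      (auto simp: locally_integrable_orthant_def admissible_def lmeasurable_compact)
qed

lemma locally_integrable_monomial_weight: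
  "locally_integrable_orthant P f \<Longrightarrow> locally_integrable_orthant P (monomial_weight smul m f)"
  unfolding monomial_weight_eq by (intro locally_integrable_times multi_monomial_continuous)

lemma partial_laplace_eq: "partial_laplace smul P f l = box_integral f (laplace_kernel l)"
  by (simp add: fun_eq_iff partial_laplace_def box_integral_def)

lemma box_integral_times: "box_integral (\<lambda>s. smul (\<psi> s) (f s)) \<phi> t = box_integral f (\<lambda>s. \<phi> s * \<psi> s) t"
  by (simp add: box_integral_def)

lemma partial_laplace_monomial:
  "partial_laplace smul P (monomial_weight smul m f) l t
    = box_integral f (\<lambda>s. laplace_kernel l s * multi_monomial m s) t"
  by (simp add: partial_laplace_eq monomial_weight_eq box_integral_times)

lemma partial_laplace_shift:
  "partial_laplace smul P (monomial_weight smul m f) (\<mu> + diagonal (of_real e)) t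
    = box_integral (\<lambda>s. smul (laplace_kernel \<mu> s) (f s)) (\<lambda>s. \<Prod>j\<in>UNIV. gamma_weight e (m $ j) (s $ j)) t"
  by (simp add: partial_laplace_monomial box_integral_times laplace_kernel_times_monomial)

text \<open>With the kernel at \<mu> absorbed into the integrand, boundedness of the partial
  integrals becomes tameness of the constant weight.\<close>

lemma tame_laplace_kernel:
  fixes f :: "real^'n \<Rightarrow> 'x"
  assumes "\<mu> \<in> laplace_region_bounded smul P f" "p \<in> P"
  shows "\<exists>C. tame p (\<lambda>s. smul (laplace_kernel \<mu> s) (f s)) C (\<lambda>_. 1)"
proof -
  have "\<exists>C. \<forall>t\<in>{0..}. p (partial_laplace smul P f \<mu> t) \<le> C"
    using assms unfolding laplace_region_bounded_def seminorm_bounded_def bdd_above_def by simp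
  then obtain C where "\<And>t. 0 \<le> t \<Longrightarrow> p (partial_laplace smul P f \<mu> t) \<le> C"
    by auto
  then show ?thesis
    by (intro exI[of _ C]) (simp add: tame_def admissible_const box_integral_times partial_laplace_eq)
qed

text \<open>Cauchy estimates for a polydisc of radius \<open>e\<close>: \<open>C\<close> may depend
  on \<open>p\<close>, but not on the multi-index or the box.\<close>

lemma partial_laplace_monomial_bound:
  fixes f :: "real^'n \<Rightarrow> 'x"
  assumes f: "locally_integrable_orthant P f" and mu: "\<mu> \<in> laplace_region_bounded smul P f"
    and e: "0 < e" and p: "p \<in> P"
  shows "\<exists>C\<ge>0. \<forall>m t. 0 \<le> t \<longrightarrow> p (partial_laplace smul P (monomial_weight smul m f) (\<mu> + diagonal (of_real e)) t)
    \<le> C * (\<Prod>j\<in>UNIV. 2 / e ^ (m $ j))"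
proof -
  obtain C where C: "tame p (\<lambda>s. smul (laplace_kernel \<mu> s) (f s)) C (\<lambda>_. 1)"
    using tame_laplace_kernel[OF mu p] by blast
  show ?thesis
    unfolding partial_laplace_shift
    using tame_bound[OF tame_gamma_weights[OF locally_integrable_times[OF f laplace_kernel_continuous] p C e]]
      tame_nonneg[OF C p]
    by (intro exI[of _ C]) (simp add: mult.commute)
qed

lemma monomial_weight_regions:
  fixes f :: "real^'n \<Rightarrow> 'x"
  assumes f: "locally_integrable_orthant P f" and mu: "\<mu> \<in> laplace_region_bounded smul P f"
    and e: "0 < e"
  shows "\<mu> + diagonal (of_real e) \<in> laplace_region smul P (monomial_weight smul m f)"
    and "\<mu> + diagonal (of_real e) \<in> laplace_region_bounded smul P (monomial_weight smul m f)"
proof -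
  have eq: "partial_laplace smul P (monomial_weight smul m f) (\<mu> + diagonal (of_real e))
      = box_integral (\<lambda>s. smul (laplace_kernel \<mu> s) (f s)) (\<lambda>s. \<Prod>j\<in>UNIV. gamma_weight e (m $ j) (s $ j))"
    by (simp add: fun_eq_iff partial_laplace_shift)
  show "\<mu> + diagonal (of_real e) \<in> laplace_region smul P (monomial_weight smul m f)"
    unfolding laplace_region_def mem_Collect_eq eq
    by (intro box_integral_gamma_convergent locally_integrable_times[OF f laplace_kernel_continuous] e
        tame_laplace_kernel[OF mu])
  show "\<mu> + diagonal (of_real e) \<in> laplace_region_bounded smul P (monomial_weight smul m f)"
    unfolding laplace_region_bounded_def seminorm_bounded_def mem_Collect_eq
  proof
    fix p assume "p \<in> P"
    from partial_laplace_monomial_bound[OF f mu e this] show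
      "bdd_above (p ` partial_laplace smul P (monomial_weight smul m f) (\<mu> + diagonal (of_real e)) ` {0..})"
      unfolding bdd_above_def by auto
  qed
qed

lemma at_top_vec_neq_bot: "(at_top :: (real^'n) filter) \<noteq> bot"
proof -
  have "\<exists>t::real^'n. \<forall>j. M < t $ j" for M
    by (intro exI[of _ "diagonal (M + 1)"]) simp
  then show ?thesis
    unfolding trivial_limit_def eventually_at_top_vec by simp
qed

lemma tendsto_laplace:
  fixes f :: "real^'n \<Rightarrow> 'x"
  assumes "l \<in> laplace_region smul P f"
  shows "(partial_laplace smul P f l \<longlongrightarrow> laplace smul P f l) at_top"
  using assms tendsto_Lim[OF at_top_vec_neq_bot]
  unfolding laplace_region_def laplace_def by auto

text \<open>The factorials of Taylor's formula sit in the weights, so only signs remain. The two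
  nested scalings match the form of the series in \<open>analytic_vec_on\<close>.\<close>

definition taylor_term :: "(nat^'n \<Rightarrow> 'x) \<Rightarrow> complex^'n \<Rightarrow> nat^'n \<Rightarrow> 'x" where
  "taylor_term c u m = smul (\<Prod>j\<in>UNIV. (u $ j) ^ (m $ j)) (smul (\<Prod>j\<in>UNIV. (-1) ^ (m $ j)) (c m))"

lemma seminorm_taylor_term:
  "p \<in> P \<Longrightarrow> p (taylor_term c u m) = (\<Prod>j\<in>UNIV. cmod (u $ j) ^ (m $ j)) * p (c m)"
  by (simp add: taylor_term_def seminorm_scale norm_mult norm_power prod_norm[symmetric])

text \<open>On a fixed box the exponential series converges uniformly, and
  \<open>box_integral_bound\<close> carries this to the integrals. The set \<open>A\<close> depends
  on \<open>t\<close> and \<open>p\<close>.\<close>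

lemma partial_laplace_expansion:
  fixes f :: "real^'n \<Rightarrow> 'x"
  assumes f: "locally_integrable_orthant P f" and p: "p \<in> P" and d: "0 < d"
  shows "\<exists>A. finite A \<and> (\<forall>B. finite B \<and> A \<subseteq> B \<longrightarrow>
    p (partial_laplace smul P f (z + u) t
       - (\<Sum>m\<in>B. taylor_term (\<lambda>m. partial_laplace smul P (monomial_weight smul m f) z t) u m)) \<le> d)"
proof -
  define g where "g = (\<lambda>s. smul (laplace_kernel z s) (f s))"
  have g: "locally_integrable_orthant P g"
    unfolding g_def by (intro locally_integrable_times f laplace_kernel_continuous)
  obtain N where N: "N \<ge> 0" "\<And>\<Phi> B. admissible \<Phi> \<Longrightarrow> 0 \<le> B \<Longrightarrow> (\<And>s. s \<in> {0..t} \<Longrightarrow> cmod (\<Phi> s) \<le> B) \<Longrightarrow>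
      p (box_integral g \<Phi> t) \<le> B * N"
    using box_integral_bound[OF g p, of t] by meson
  \<comment> \<open>The mass \<open>N\<close> may vanish, hence \<open>N + 1\<close>.\<close>
  define d' where "d' = d / (N + 1)"
  have d': "d' > 0" "d' * N \<le> d"
    using d N(1) by (auto simp: d'_def field_simps)
  obtain A :: "(nat^'n) set" where A: "finite A" "\<forall>B x. finite B \<and> A \<subseteq> B \<and> (\<forall>j. cmod (x j) \<le> cmod (u $ j) * t $ j) \<longrightarrow>
      cmod ((\<Prod>j\<in>UNIV. exp (x j)) - (\<Sum>m\<in>B. \<Prod>j\<in>UNIV. x j ^ (m $ j) / fact (m $ j))) \<le> d'"
    using exp_multi_series_uniform[OF d'(1), of "\<lambda>j. cmod (u $ j) * t $ j"] by blast
  have "p (partial_laplace smul P f (z + u) t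
       - (\<Sum>m\<in>B. taylor_term (\<lambda>m. partial_laplace smul P (monomial_weight smul m f) z t) u m)) \<le> d"
    if B: "finite B" "A \<subseteq> B" for B
  proof -
    define c where "c m = (\<Prod>j\<in>UNIV. (u $ j) ^ (m $ j)) * (\<Prod>j\<in>UNIV. (-1) ^ (m $ j))" for m :: "nat^'n"
    have 1: "partial_laplace smul P f (z + u) t = box_integral g (laplace_kernel u) t"
      unfolding partial_laplace_eq g_def box_integral_times
      by (rule box_integral_cong) (simp add: laplace_kernel_add mult.commute)
    have "partial_laplace smul P (monomial_weight smul m f) z t = box_integral g (multi_monomial m) t" for m
      by (simp add: partial_laplace_monomial g_def box_integral_times mult.commute)
    then have 2: "(\<Sum>m\<in>B. taylor_term (\<lambda>m. partial_laplace smul P (monomial_weight smul m f) z t) u m)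
        = box_integral g (\<lambda>s. \<Sum>m\<in>B. c m * multi_monomial m s) t"
      using box_integral_sum[OF g B(1) admissible_continuous[OF multi_monomial_continuous],
          where c = c and t = t]
      by (simp add: taylor_term_def c_def)
    have adm: "admissible (laplace_kernel u)" "admissible (\<lambda>s. \<Sum>m\<in>B. c m * multi_monomial m s)"
      by (intro admissible_sum admissible_mult admissible_const admissible_continuous
          multi_monomial_continuous laplace_kernel_continuous)+
    have "p (box_integral g (\<lambda>s. laplace_kernel u s - (\<Sum>m\<in>B. c m * multi_monomial m s)) t) \<le> d' * N"
    proof (rule N(2))
      fix s assume s: "s \<in> {0..t}"
      have cm: "c m * multi_monomial m s = (\<Prod>j\<in>UNIV. (- (u $ j * of_real (s $ j))) ^ (m $ j) / fact (m $ j))" for m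
        unfolding c_def multi_monomial_def of_real_prod prod.distrib[symmetric]
        by (intro prod.cong refl) (simp add: power_mult_distrib[symmetric])
      have "cmod (- (u $ j * of_real (s $ j))) \<le> cmod (u $ j) * t $ j" for j
        using s by (auto simp: norm_mult less_eq_vec_def intro!: mult_left_mono)
      then have "finite B \<and> A \<subseteq> B \<and> (\<forall>j. cmod (- (u $ j * of_real (s $ j))) \<le> cmod (u $ j) * t $ j)"
        using B by blast
      from A(2)[rule_format, OF this] show "cmod (laplace_kernel u s - (\<Sum>m\<in>B. c m * multi_monomial m s)) \<le> d'"
        unfolding cm laplace_kernel_prod .
    qed (use adm d' in \<open>auto intro: admissible_diff\<close>)
    then show ?thesis
      unfolding 1 2 using box_integral_diff[OF g adm, of t] d'(2) by simp
  qed
  then show ?thesis using A(1) by blast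
qed

text \<open>The limit over boxes and the sum over multi-indices are exchanged by a summable majorant
  \<open>b\<close> that does not depend on \<open>t\<close> and passes to the limit terms.\<close>

lemma laplace_power_series:
  fixes f :: "real^'n \<Rightarrow> 'x"
  assumes f: "locally_integrable_orthant P f" and mu: "\<mu> \<in> laplace_region_bounded smul P f"
    and e: "0 < e" and z: "z = \<mu> + diagonal (of_real e)" and u: "\<And>j. cmod (u $ j) < e"
    and w: "z + u \<in> laplace_region smul P f"
  defines "T \<equiv> taylor_term (\<lambda>m. laplace smul P (monomial_weight smul m f) z) u"
  shows "p \<in> P \<Longrightarrow> (\<lambda>m. p (T m)) summable_on UNIV" and "(T has_sum laplace smul P f (z + u)) UNIV"
proof -
  define c where "c t m = partial_laplace smul P (monomial_weight smul m f) z t" for t m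
  have lim: "((\<lambda>t. c t m) \<longlongrightarrow> laplace smul P (monomial_weight smul m f) z) at_top" for m
    unfolding c_def z by (intro tendsto_laplace monomial_weight_regions[OF f mu e])
  have limT: "((\<lambda>t. taylor_term (c t) u m) \<longlongrightarrow> T m) at_top" for m
    unfolding T_def taylor_term_def by (intro tendsto_scale_sclcs tendsto_const lim)
  have pos: "\<forall>\<^sub>F t in at_top. (0::real^'n) \<le> t"
    unfolding eventually_at_top_vec by (intro exI[of _ 0]) (auto simp: less_eq_vec_def intro: less_imp_le)
  define dom where "dom p b \<longleftrightarrow> b summable_on UNIV \<and> (\<forall>m. 0 \<le> b m) \<and> (\<forall>m. p (T m) \<le> b m) \<and>
      (\<forall>m t. 0 \<le> t \<longrightarrow> p (taylor_term (c t) u m) \<le> b m)" for p :: "'x \<Rightarrow> real" and b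
  have main: "\<exists>b. dom p b" if p: "p \<in> P" for p
  proof -
    obtain C where C: "C \<ge> 0" "\<And>m t. 0 \<le> t \<Longrightarrow> p (c t m) \<le> C * (\<Prod>j\<in>UNIV. 2 / e ^ (m $ j))"
      using partial_laplace_monomial_bound[OF f mu e p] unfolding c_def z by blast
    \<comment> \<open>Cauchy estimate times monomial: a product of geometric series whose ratios
      \<open>cmod (u $ j) / e\<close> are below 1.\<close>
    define b where "b m = C * (\<Prod>j\<in>UNIV. 2 * (cmod (u $ j) / e) ^ (m $ j))" for m :: "nat^'n"
    have "summable (\<lambda>k. 2 * (cmod (u $ j) / e) ^ k)" for j
      using u[of j] e by (intro summable_mult summable_geometric) simp
    then have "(\<lambda>m::nat^'n. \<Prod>j\<in>UNIV. 2 * (cmod (u $ j) / e) ^ (m $ j)) summable_on UNIV"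
      using e by (intro summable_on_prod_vec) auto
    then have "b summable_on UNIV"
      unfolding b_def by (intro summable_on_cmult_right)
    moreover have b0: "0 \<le> b m" for m
      unfolding b_def using C(1) e by (intro mult_nonneg_nonneg prod_nonneg) auto
    moreover have bt: "p (taylor_term (c t) u m) \<le> b m" if "0 \<le> t" for t m
    proof -
      have "p (taylor_term (c t) u m) \<le> (\<Prod>j\<in>UNIV. cmod (u $ j) ^ (m $ j)) * (C * (\<Prod>j\<in>UNIV. 2 / e ^ (m $ j)))"
        unfolding seminorm_taylor_term[OF p] by (intro mult_left_mono C(2) that prod_nonneg) simp
      also have "\<dots> = C * (\<Prod>j\<in>UNIV. cmod (u $ j) ^ (m $ j) * (2 / e ^ (m $ j)))"
        unfolding prod.distrib by simp
      also have "\<dots> = b m"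
        by (simp add: b_def power_divide mult.commute)
      finally show ?thesis .
    qed
    moreover have "p (T m) \<le> b m" for m
      by (rule tendsto_upperbound[OF tendsto_seminorm[OF limT p] _ at_top_vec_neq_bot])
        (use bt in \<open>auto intro: eventually_mono[OF pos]\<close>)
    ultimately have "dom p b"
      by (simp add: dom_def)
    then show ?thesis by blast
  qed
  show "(\<lambda>m. p (T m)) summable_on UNIV" if p: "p \<in> P"
  proof -
    obtain b where "dom p b"
      using main[OF p] by blast
    then have b: "b summable_on UNIV" "\<And>m. p (T m) \<le> b m"
      by (simp_all add: dom_def)
    show ?thesis
      by (rule summable_on_comparison_test[OF b(1)]) (simp_all add: b(2) seminorm_nonneg[OF p])
  qed
  show "(T has_sum laplace smul P f (z + u)) UNIV"
    unfolding has_sum_def tendsto_iff_seminorms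
  proof (intro ballI allI impI)
    fix p and r :: real assume p: "p \<in> P" and r: "r > 0"
    obtain b where "dom p b"
      using main[OF p] by blast
    then have b: "b summable_on UNIV" "\<And>m. 0 \<le> b m"
      "\<And>m t. 0 \<le> t \<Longrightarrow> p (taylor_term (c t) u m) \<le> b m"
      by (simp_all add: dom_def)
    obtain A where A: "finite A" "\<And>F. finite F \<Longrightarrow> F \<inter> A = {} \<Longrightarrow> sum b F < r / 3"
      using summable_on_tail[OF b(1,2), of "r / 3"] r by auto
    have "p (sum T F - laplace smul P f (z + u)) < r" if F: "finite F" "A \<subseteq> F" for F
    proof -
      have bound: "p ((\<Sum>m\<in>F. taylor_term (c t) u m) - partial_laplace smul P f (z + u) t) \<le> r / 3 + r / 3"
        if t: "0 \<le> t" for t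
      proof -
        \<comment> \<open>\<open>A'\<close> varies with \<open>t\<close>, while \<open>F\<close>
          must stay fixed as \<open>t\<close> grows. The terms added to reach the union with
          \<open>A'\<close> lie outside \<open>A\<close>, so the tail of \<open>b\<close> bounds
          them whatever \<open>A'\<close> is.\<close>
        obtain A' where A': "finite A'" "\<And>B. finite B \<Longrightarrow> A' \<subseteq> B \<Longrightarrow>
            p (partial_laplace smul P f (z + u) t - (\<Sum>m\<in>B. taylor_term (c t) u m)) \<le> r / 3"
          using partial_laplace_expansion[OF f p, of "r / 3" z u t] r unfolding c_def by auto
        let ?B = "F \<union> A'"
        have "p ((\<Sum>m\<in>?B. taylor_term (c t) u m) - (\<Sum>m\<in>F. taylor_term (c t) u m)) \<le> r / 3"
        proof -
          have "(\<Sum>m\<in>?B. taylor_term (c t) u m) - (\<Sum>m\<in>F. taylor_term (c t) u m)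
              = (\<Sum>m\<in>?B - F. taylor_term (c t) u m)"
            using F A' by (subst sum_diff) auto
          also have "p \<dots> \<le> sum b (?B - F)"
            by (intro order.trans[OF seminorm_sum[OF p]] sum_mono b(3) t)
          also have "\<dots> < r / 3"
            using F A' by (intro A(2)) auto
          finally show ?thesis by simp
        qed
        moreover have "p (partial_laplace smul P f (z + u) t - (\<Sum>m\<in>?B. taylor_term (c t) u m)) \<le> r / 3"
          using F A' by (intro A'(2)) auto
        ultimately show ?thesis
          using seminorm_diff_triangle[OF p, of "partial_laplace smul P f (z + u) t"
              "\<Sum>m\<in>F. taylor_term (c t) u m" "\<Sum>m\<in>?B. taylor_term (c t) u m"]
            seminorm_commute[OF p, of "partial_laplace smul P f (z + u) t" "\<Sum>m\<in>F. taylor_term (c t) u m"]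
          by linarith
      qed
      have "((\<lambda>t. \<Sum>m\<in>F. taylor_term (c t) u m) \<longlongrightarrow> sum T F) at_top"
        using F(1)
      proof induction
        case (insert m F)
        then show ?case
          using tendsto_add_sclcs[OF limT insert.IH] by simp
      qed simp
      then have "((\<lambda>t. (\<Sum>m\<in>F. taylor_term (c t) u m) - partial_laplace smul P f (z + u) t)
          \<longlongrightarrow> sum T F - laplace smul P f (z + u)) at_top"
        by (rule tendsto_diff_sclcs) (rule tendsto_laplace[OF w])
      then have "p (sum T F - laplace smul P f (z + u)) \<le> r / 3 + r / 3"
        by (rule tendsto_upperbound[OF tendsto_seminorm[OF _ p] _ at_top_vec_neq_bot])
          (use bound in \<open>auto intro: eventually_mono[OF pos]\<close>)
      then show ?thesis using r by simp
    qed
    then show "\<forall>\<^sub>F F in finite_subsets_at_top UNIV. p (sum T F - laplace smul P f (z + u)) < r"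
      unfolding eventually_finite_subsets_at_top using A(1) by blast
  qed
qed

end

section \<open>Derivatives\<close>

lemma open_contains_polydisc:
  fixes U :: "(complex^'n) set"
  assumes "open U" "z \<in> U"
  shows "\<exists>r>0. polydisc z r \<subseteq> U"
proof -
  obtain e where e: "e > 0" "ball z e \<subseteq> U"
    using assms by (auto simp: open_contains_ball)
  \<comment> \<open>The Euclidean norm is at most the sum of the coordinate moduli.\<close>
  define r where "r = e / real CARD('n)"
  have "polydisc z r \<subseteq> U"
  proof
    fix w assume "w \<in> polydisc z r"
    then have w: "cmod ((w - z) $ j) < r" for j
      by (simp add: polydisc_def)
    have "norm (w - z) \<le> (\<Sum>j\<in>UNIV. cmod ((w - z) $ j))"
      unfolding norm_vec_def by (rule L2_set_le_sum) simp
    also have "\<dots> < (\<Sum>j\<in>(UNIV :: 'n set). r)"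
      by (rule sum_strict_mono) (use w in auto)
    also have "\<dots> = e"
      by (simp add: r_def)
    finally show "w \<in> U"
      using e(2) by (auto simp: dist_norm norm_minus_commute)
  qed
  then show ?thesis
    using e(1) by (intro exI[of _ r]) (simp add: r_def)
qed

text \<open>A Poisson probability is at most 1. This pointwise companion of
  \<open>tame_gamma_weight\<close> serves absolute convergence.\<close>

lemma gamma_weight_norm_le:
  assumes "0 < e" "0 \<le> x"
  shows "cmod (gamma_weight e m x) \<le> 1 / e ^ m"
proof -
  have le1: "poisson_cdf e k x \<le> 1" for k
    using monotone_onD[OF poisson_cdf_antimono, of e 0 x k] assms by (simp add: poisson_cdf_0)
  have "exp (- (e * x)) * (e * x) ^ m / fact m \<le> 1"
  proof (cases m)
    case 0
    then show ?thesis using assms by simp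
  next
    case (Suc k)
    have "poisson_cdf e (Suc k) x - poisson_cdf e k x \<le> 1"
      using le1[of "Suc k"] poisson_cdf_nonneg[of e x k] assms by simp
    then show ?thesis
      unfolding Suc poisson_cdf_Suc .
  qed
  then show ?thesis
    using assms by (simp add: gamma_weight_def norm_mult norm_divide norm_power power_mult_distrib field_simps)
qed

lemma prod_power_axis:
  fixes x :: "'a::comm_semiring_1"
  shows "(\<Prod>i\<in>UNIV. y i ^ ((axis j k :: nat^'n) $ i)) = y j ^ k"
  by (subst prod.remove[of _ j]) (auto simp: axis_def)

context sclcs
begin

text \<open>The Hausdorff property: the zero sequence converges to \<open>x\<close> as well as to
  0.\<close>

lemma seminorm_eq_0_imp_eq_0:
  assumes "\<And>p. p \<in> P \<Longrightarrow> p x = 0"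
  shows "x = 0"
proof -
  have "(\<lambda>_::nat. 0) \<longlonglongrightarrow> x"
    unfolding tendsto_iff_seminorms
  proof (intro ballI allI impI always_eventually)
    fix p and e :: real assume "p \<in> P" "0 < e"
    then show "p (0 - x) < e"
      using assms[of p] seminorm_minus[of p x] by simp
  qed
  then show ?thesis
    by (rule LIMSEQ_unique) simp
qed

text \<open>The derivative is taken at the centre, where along the axis only the constant and the
  linear term count: every other term is at most \<open>(cmod h / \<rho>)\<^sup>2\<close> times the
  corresponding term at radius \<rho>. The minus sign is that of \<open>taylor_term\<close>.\<close>

lemma has_partial_derivative_power_series:
  fixes F :: "complex^'n \<Rightarrow> 'x"
  assumes r: "0 < r"
    and summable: "\<And>u p. (\<And>j. cmod (u $ j) < r) \<Longrightarrow> p \<in> P \<Longrightarrow> (\<lambda>m. p (taylor_term c u m)) summable_on UNIV"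
    and series: "\<And>u. (\<And>j. cmod (u $ j) < r) \<Longrightarrow> (taylor_term c u has_sum F (z + u)) UNIV"
  shows "has_partial_derivative smul j F z (- c (axis j 1))"
proof -
  \<comment> \<open>Any radius strictly inside works; the series of seminorms at the diagonal point
    of radius \<rho> must be summable.\<close>
  define \<rho> where "\<rho> = r / 2"
  have rho: "0 < \<rho>" "\<rho> < r"
    using r by (simp_all add: \<rho>_def)
  define S where "S p = infsum (\<lambda>m. p (taylor_term c (diagonal (of_real \<rho>)) m)) UNIV"
    for p :: "'x \<Rightarrow> real"
  have T0: "taylor_term c u 0 = c 0" for u
    by (simp add: taylor_term_def)
  have T1: "taylor_term c (axis j h) (axis j 1) = smul h (- c (axis j 1))" for h
    by (simp add: taylor_term_def prod_power_axis)
  have bound: "p (F (z + axis j h) - (c 0 + smul h (- c (axis j 1)))) \<le> (cmod h / \<rho>)\<^sup>2 * S p"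
    if p: "p \<in> P" and h: "cmod h \<le> \<rho>" for p h
  proof -
    let ?T = "taylor_term c (axis j h)" and ?R = "taylor_term c (diagonal (of_real \<rho>))"
    have R: "((\<lambda>m. p (?R m)) has_sum S p) UNIV"
      unfolding S_def using rho p by (intro has_sum_infsum summable) auto
    have q: "0 \<le> cmod h / \<rho>" "cmod h / \<rho> \<le> 1"
      using h rho by auto
    \<comment> \<open>A multi-index that involves another coordinate gives 0 on the axis; the others
      have exponent at least 2 in coordinate \<open>j\<close>, and the ratio
      \<open>cmod h / \<rho>\<close> is at most 1.\<close>
    have term_le: "p (?T m) \<le> (cmod h / \<rho>)\<^sup>2 * p (?R m)" if m: "m \<noteq> 0" "m \<noteq> axis j 1" for m
    proof (cases "\<exists>i. i \<noteq> j \<and> m $ i \<noteq> 0")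
      case True
      then obtain i where "i \<noteq> j" "m $ i \<noteq> 0" by blast
      then have "(\<Prod>i\<in>UNIV. cmod (axis j h $ i) ^ (m $ i)) = 0"
        by (intro prod_zero bexI[of _ i]) (auto simp: axis_def)
      then have "p (?T m) = 0"
        by (simp only: seminorm_taylor_term[OF p] mult_zero_left)
      then show ?thesis
        using seminorm_nonneg[OF p, of "?R m"] by simp
    next
      case False
      then have m': "m = axis j (m $ j)"
        by (auto simp: vec_eq_iff axis_def)
      have "m $ j \<noteq> 0"
      proof
        assume "m $ j = 0"
        then have "m = 0" using m' by (simp add: vec_eq_iff axis_def)
        then show False using m by simp
      qed
      moreover have "m $ j \<noteq> 1"
        using m m' by metis
      ultimately have k: "2 \<le> m $ j" by simp
      have "cmod h ^ (m $ j) = (cmod h / \<rho>) ^ (m $ j) * \<rho> ^ (m $ j)"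
        using rho by (simp add: power_divide)
      also have "\<dots> \<le> (cmod h / \<rho>)\<^sup>2 * \<rho> ^ (m $ j)"
        using rho q k by (intro mult_right_mono power_decreasing) auto
      finally have "cmod h ^ (m $ j) * p (c m) \<le> (cmod h / \<rho>)\<^sup>2 * \<rho> ^ (m $ j) * p (c m)"
        by (rule mult_right_mono) (rule seminorm_nonneg[OF p])
      moreover have "(\<Prod>i\<in>UNIV. cmod (axis j h $ i) ^ (m $ i)) = cmod h ^ (m $ j)"
        by (subst m') (simp add: prod_power_axis)
      moreover have "(\<Prod>i\<in>UNIV. cmod (diagonal (complex_of_real \<rho>) $ i) ^ (m $ i)) = \<rho> ^ (m $ j)"
        by (subst m') (use rho in \<open>simp add: prod_power_axis\<close>)
      ultimately show ?thesis
        by (simp only: seminorm_taylor_term[OF p] mult.assoc)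
    qed
    have partial: "p (sum ?T A - (c 0 + smul h (- c (axis j 1)))) \<le> (cmod h / \<rho>)\<^sup>2 * S p"
      if A: "finite A" "{0, axis j 1} \<subseteq> A" for A
    proof -
      have ne: "(0 :: nat^'n) \<noteq> axis j 1"
        by (auto simp: vec_eq_iff axis_def)
      have "sum ?T A = sum ?T (A - {0, axis j 1}) + sum ?T {0, axis j 1}"
        using A by (intro sum.subset_diff) auto
      then have "sum ?T A - (c 0 + smul h (- c (axis j 1))) = sum ?T (A - {0, axis j 1})"
        using ne T0 T1[of h] by simp
      then have "p (sum ?T A - (c 0 + smul h (- c (axis j 1)))) = p (sum ?T (A - {0, axis j 1}))"
        by simp
      also have "\<dots> \<le> (\<Sum>m\<in>A - {0, axis j 1}. (cmod h / \<rho>)\<^sup>2 * p (?R m))"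
        by (rule order.trans[OF seminorm_sum[OF p]], rule sum_mono, rule term_le) auto
      also have "\<dots> = (cmod h / \<rho>)\<^sup>2 * (\<Sum>m\<in>A - {0, axis j 1}. p (?R m))"
        by (simp add: sum_distrib_left)
      also have "\<dots> \<le> (cmod h / \<rho>)\<^sup>2 * S p"
        by (intro mult_left_mono finite_sum_le_has_sum[OF R]) (use A seminorm_nonneg[OF p] in auto)
      finally show ?thesis .
    qed
    have "(taylor_term c (axis j h) has_sum F (z + axis j h)) UNIV"
      using h rho by (intro series) (auto simp: axis_def)
    then have "((\<lambda>A. sum ?T A - (c 0 + smul h (- c (axis j 1)))) \<longlongrightarrow>
        F (z + axis j h) - (c 0 + smul h (- c (axis j 1)))) (finite_subsets_at_top UNIV)"
      unfolding has_sum_def by (rule tendsto_diff_sclcs) simp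
    from tendsto_seminorm[OF this p] show ?thesis
    proof (rule tendsto_upperbound)
      show "\<forall>\<^sub>F A in finite_subsets_at_top UNIV. p (sum ?T A - (c 0 + smul h (- c (axis j 1)))) \<le> (cmod h / \<rho>)\<^sup>2 * S p"
        unfolding eventually_finite_subsets_at_top
        by (intro exI[of _ "{0, axis j 1}"]) (use partial in auto)
    qed simp
  qed
  \<comment> \<open>The quadratic bound at \<open>h = 0\<close> identifies the constant
    coefficient.\<close>
  have "F z - c 0 = 0"
  proof (rule seminorm_eq_0_imp_eq_0)
    fix p assume p: "p \<in> P"
    have axis0: "z + axis j 0 = z"
      by (simp add: vec_eq_iff axis_def)
    have "p (F z - c 0) \<le> 0"
      using bound[OF p, of 0] rho unfolding axis0 by simp
    then show "p (F z - c 0) = 0"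
      using seminorm_nonneg[OF p, of "F z - c 0"] by simp
  qed
  then have Fz: "F z = c 0" by simp
  show ?thesis
    unfolding has_partial_derivative_def
  proof (rule tendsto_seminormI[where g = "\<lambda>p h. cmod h * (S p / \<rho>\<^sup>2)"])
    fix p assume p: "p \<in> P"
    have "((\<lambda>h. cmod h * (S p / \<rho>\<^sup>2)) \<longlongrightarrow> cmod 0 * (S p / \<rho>\<^sup>2)) (at 0)"
      by (intro tendsto_intros)
    then show "((\<lambda>h. cmod h * (S p / \<rho>\<^sup>2)) \<longlongrightarrow> 0) (at 0)"
      by simp
    have "p (smul (inverse h) (F (z + axis j h) - F z) - - c (axis j 1)) \<le> cmod h * (S p / \<rho>\<^sup>2)"
      if h: "h \<noteq> 0" "cmod h < \<rho>" for h
    proof -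
      have "smul (inverse h) (F (z + axis j h) - F z) - - c (axis j 1)
          = smul (inverse h) (F (z + axis j h) - (c 0 + smul h (- c (axis j 1))))"
        using h(1) unfolding Fz by (simp add: scale_right_diff_distrib scale_right_distrib)
      then have "p (smul (inverse h) (F (z + axis j h) - F z) - - c (axis j 1))
          \<le> inverse (cmod h) * ((cmod h / \<rho>)\<^sup>2 * S p)"
        using bound[OF p, of h] h by (simp add: seminorm_scale[OF p] norm_inverse mult_left_mono)
      also have "\<dots> = cmod h * (S p / \<rho>\<^sup>2)"
        using h by (simp add: power2_eq_square field_simps)
      finally show ?thesis .
    qed
    then show "\<forall>\<^sub>F h in at 0. p (smul (inverse h) (F (z + axis j h) - F z) - - c (axis j 1)) \<le> cmod h * (S p / \<rho>\<^sup>2)"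
      unfolding eventually_at using rho(1) by (intro exI[of _ \<rho>]) (auto simp: dist_norm)
  qed
qed

section \<open>Derivatives of arbitrary order\<close>

lemma monomial_weight_0: "monomial_weight smul 0 f = f"
  by (simp add: monomial_weight_def fun_eq_iff)

text \<open>Normalised monomials do not multiply to normalised monomials: the product picks up
  \<open>v $ j + 1\<close>. These factors accumulate to the factorials in the derivatives.\<close>

lemma monomial_weight_axis:
  fixes v :: "nat^'n"
  shows "monomial_weight smul (axis j 1) (monomial_weight smul v f)
    = (\<lambda>s. smul (of_nat (v $ j + 1)) (monomial_weight smul (v + axis j 1) f s))"
proof
  fix s :: "real^'n"
  have 1: "(\<Prod>i\<in>UNIV. s $ i ^ ((axis j 1 :: nat^'n) $ i) / fact ((axis j 1 :: nat^'n) $ i)) = s $ j"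
    by (subst prod.remove[of _ j]) (auto simp: axis_def)
  have "(\<Prod>i\<in>UNIV. s $ i ^ ((v + axis j 1) $ i) / fact ((v + axis j 1) $ i))
      = (s $ j ^ (v $ j + 1) / fact (v $ j + 1)) * (\<Prod>i\<in>UNIV - {j}. s $ i ^ (v $ i) / fact (v $ i))"
    by (subst prod.remove[of _ j]) (auto simp: axis_def intro!: prod.cong)
  also have "s $ j ^ (v $ j + 1) / fact (v $ j + 1) = s $ j * (s $ j ^ (v $ j) / fact (v $ j)) / real (v $ j + 1)"
    by (simp add: field_simps)
  finally have "real (v $ j + 1) * (\<Prod>i\<in>UNIV. s $ i ^ ((v + axis j 1) $ i) / fact ((v + axis j 1) $ i))
      = s $ j * ((s $ j ^ (v $ j) / fact (v $ j)) * (\<Prod>i\<in>UNIV - {j}. s $ i ^ (v $ i) / fact (v $ i)))"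
    by simp
  also have "(s $ j ^ (v $ j) / fact (v $ j)) * (\<Prod>i\<in>UNIV - {j}. s $ i ^ (v $ i) / fact (v $ i))
      = (\<Prod>i\<in>UNIV. s $ i ^ (v $ i) / fact (v $ i))"
    by (rule prod.remove[symmetric]) auto
  finally have "complex_of_real (s $ j * (\<Prod>i\<in>UNIV. s $ i ^ (v $ i) / fact (v $ i)))
      = complex_of_real (real (v $ j + 1) * (\<Prod>i\<in>UNIV. s $ i ^ ((v + axis j 1) $ i) / fact ((v + axis j 1) $ i)))"
    by (rule arg_cong[OF sym])
  then show "monomial_weight smul (axis j 1) (monomial_weight smul v f) s
      = smul (of_nat (v $ j + 1)) (monomial_weight smul (v + axis j 1) f s)"
    unfolding monomial_weight_def scale_scale 1 of_real_mult by (simp only: of_real_of_nat_eq)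
qed

lemma laplace_scale:
  fixes f :: "real^'n \<Rightarrow> 'x"
  assumes f: "locally_integrable_orthant P f" and l: "l \<in> laplace_region smul P f"
  shows "laplace smul P (\<lambda>s. smul c (f s)) l = smul c (laplace smul P f l)"
proof -
  have "partial_laplace smul P (\<lambda>s. smul c (f s)) l t = smul c (partial_laplace smul P f l t)" for t
    using box_integral_scale[OF f admissible_continuous[OF laplace_kernel_continuous], of c l t]
    by (simp add: partial_laplace_eq box_integral_def mult.commute)
  then have "partial_laplace smul P (\<lambda>s. smul c (f s)) l = (\<lambda>t. smul c (partial_laplace smul P f l t))"
    by (simp add: fun_eq_iff)
  then have "(partial_laplace smul P (\<lambda>s. smul c (f s)) l \<longlongrightarrow> smul c (laplace smul P f l)) at_top"
    using tendsto_scale_sclcs[OF tendsto_const tendsto_laplace[OF l]] by simp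
  then show ?thesis
    unfolding laplace_def by (intro tendsto_Lim at_top_vec_neq_bot)
qed

text \<open>Supplies the base point \<mu>. The polydisc is open, so the shift is by half its
  radius.\<close>

lemma shifted_point:
  fixes z :: "complex^'n"
  assumes "polydisc z r \<subseteq> U" "0 < r"
  shows "z - diagonal (of_real (r / 2)) \<in> U"
  using assms by (auto simp: polydisc_def)

text \<open>Each point of \<open>U\<close> is a diagonal shift of another point of \<open>U\<close>.
  The set is the same before and after weighting, so the statement can be reapplied to the weighted
  function.\<close>

lemma laplace_regions_open:
  fixes f :: "real^'n \<Rightarrow> 'x"
  assumes f: "locally_integrable_orthant P f" and U: "open U" "U \<subseteq> laplace_region_bounded smul P f"
  shows "U \<subseteq> laplace_region smul P (monomial_weight smul m f)"
    and "U \<subseteq> laplace_region_bounded smul P (monomial_weight smul m f)"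
proof -
  have "z \<in> laplace_region smul P (monomial_weight smul m f) \<and>
      z \<in> laplace_region_bounded smul P (monomial_weight smul m f)" if z: "z \<in> U" for z
  proof -
    obtain r where r: "r > 0" "polydisc z r \<subseteq> U"
      using open_contains_polydisc[OF U(1) z] by blast
    have "z - diagonal (of_real (r / 2)) \<in> laplace_region_bounded smul P f"
      using shifted_point[OF r(2,1)] U(2) by blast
    from monomial_weight_regions[OF f this half_gt_zero[OF r(1)], of m] show ?thesis
      by simp
  qed
  then show "U \<subseteq> laplace_region smul P (monomial_weight smul m f)"
    "U \<subseteq> laplace_region_bounded smul P (monomial_weight smul m f)"
    by auto
qed

lemma laplace_taylor:
  fixes f :: "real^'n \<Rightarrow> 'x"
  assumes f: "locally_integrable_orthant P f" and U: "open U" "U \<subseteq> laplace_region_bounded smul P f"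
    and z: "z \<in> U"
  shows "\<exists>r>0. polydisc z r \<subseteq> U \<and> (\<forall>u. (\<forall>j. cmod (u $ j) < r) \<longrightarrow>
    (\<forall>p\<in>P. (\<lambda>m. p (taylor_term (\<lambda>m. laplace smul P (monomial_weight smul m f) z) u m)) summable_on UNIV) \<and>
    (taylor_term (\<lambda>m. laplace smul P (monomial_weight smul m f) z) u has_sum laplace smul P f (z + u)) UNIV)"
proof -
  obtain r where r: "r > 0" "polydisc z r \<subseteq> U"
    using open_contains_polydisc[OF U(1) z] by blast
  have mu: "z - diagonal (of_real (r / 2)) \<in> laplace_region_bounded smul P f"
    using shifted_point[OF r(2,1)] U(2) by blast
  \<comment> \<open>\<open>r / 2\<close> is both the length of the shift and the radius of the
    polydisc of convergence.\<close>
  have e: "0 < r / 2" using r by simp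
  have zeq: "z = (z - diagonal (of_real (r / 2))) + diagonal (of_real (r / 2))"
    by simp
  have "polydisc z (r / 2) \<subseteq> polydisc z r"
    unfolding polydisc_def using e by (intro Collect_mono) (smt (verit) field_sum_of_halves)
  then have sub: "polydisc z (r / 2) \<subseteq> U"
    using r(2) by (rule order.trans)
  have w: "z + u \<in> laplace_region smul P f" if "\<And>j. cmod (u $ j) < r / 2" for u
  proof -
    have "z + u \<in> U"
      using that sub by (auto simp: polydisc_def)
    then show ?thesis
      using laplace_regions_open(1)[OF f U, of 0] by (auto simp: monomial_weight_0)
  qed
  show ?thesis
    using e sub laplace_power_series[OF f mu e zeq _ w] by (intro exI[of _ "r / 2"]) blast
qed

lemma laplace_analytic:
  fixes f :: "real^'n \<Rightarrow> 'x"
  assumes f: "locally_integrable_orthant P f" and U: "open U" "U \<subseteq> laplace_region_bounded smul P f"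
  shows "analytic_vec_on smul P U (laplace smul P f)"
  unfolding analytic_vec_on_def
proof
  fix z assume z: "z \<in> U"
  define c where "c m = laplace smul P (monomial_weight smul m f) z" for m
  obtain r where r: "r > 0" "polydisc z r \<subseteq> U" and T: "\<And>u. (\<And>j. cmod (u $ j) < r) \<Longrightarrow>
    (\<forall>p\<in>P. (\<lambda>m. p (taylor_term c u m)) summable_on UNIV) \<and>
    (taylor_term c u has_sum laplace smul P f (z + u)) UNIV"
    using laplace_taylor[OF f U z] unfolding c_def by blast
  show "\<exists>r>0. polydisc z r \<subseteq> U \<and> (\<exists>a. \<forall>w\<in>polydisc z r.
      let u = \<lambda>m. smul (\<Prod>j\<in>UNIV. (w $ j - z $ j) ^ (m $ j)) (a m)
      in (\<forall>p\<in>P. (\<lambda>m. p (u m)) summable_on UNIV) \<and> (u has_sum laplace smul P f w) UNIV)"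
  proof (intro exI[of _ r] conjI r exI[of _ "\<lambda>m. smul (\<Prod>j\<in>UNIV. (-1) ^ (m $ j)) (c m)"] ballI)
    fix w assume "w \<in> polydisc z r"
    then have "cmod ((w - z) $ j) < r" for j
      by (simp add: polydisc_def)
    from T[OF this] show "let u = \<lambda>m. smul (\<Prod>j\<in>UNIV. (w $ j - z $ j) ^ (m $ j)) (smul (\<Prod>j\<in>UNIV. (-1) ^ (m $ j)) (c m))
      in (\<forall>p\<in>P. (\<lambda>m. p (u m)) summable_on UNIV) \<and> (u has_sum laplace smul P f w) UNIV"
      unfolding taylor_term_def[abs_def] Let_def by simp
  qed
qed

lemma has_partial_derivative_laplace:
  fixes f :: "real^'n \<Rightarrow> 'x"
  assumes f: "locally_integrable_orthant P f" and U: "open U" "U \<subseteq> laplace_region_bounded smul P f"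
    and z: "z \<in> U"
  shows "has_partial_derivative smul j (laplace smul P f) z (- laplace smul P (monomial_weight smul (axis j 1) f) z)"
proof -
  define c where "c m = laplace smul P (monomial_weight smul m f) z" for m
  obtain r where r: "r > 0" and T: "\<And>u. (\<And>j. cmod (u $ j) < r) \<Longrightarrow>
    (\<forall>p\<in>P. (\<lambda>m. p (taylor_term c u m)) summable_on UNIV) \<and>
    (taylor_term c u has_sum laplace smul P f (z + u)) UNIV"
    using laplace_taylor[OF f U z] unfolding c_def by blast
  have "has_partial_derivative smul j (laplace smul P f) z (- c (axis j 1))"
    by (rule has_partial_derivative_power_series[OF r]) (use T in blast)+
  then show ?thesis
    by (simp add: c_def)
qed

lemma has_partial_derivative_scale:
  assumes "has_partial_derivative smul j F z D"
  shows "has_partial_derivative smul j (\<lambda>w. smul c (F w)) z (smul c D)"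
proof -
  have "smul (inverse h) (smul c (F (z + axis j h)) - smul c (F z))
      = smul c (smul (inverse h) (F (z + axis j h) - F z))" for h
    by (simp add: scale_right_diff_distrib mult.commute)
  then show ?thesis
    using tendsto_scale_sclcs[OF tendsto_const assms[unfolded has_partial_derivative_def]]
    by (simp add: has_partial_derivative_def)
qed

text \<open>The candidate for the mixed derivative as a function of the point, so that it can be the
  intermediate function \<open>G\<close> in \<open>has_iterated_partial\<close>.\<close>

definition laplace_deriv :: "(real^'n \<Rightarrow> 'x) \<Rightarrow> nat^'n \<Rightarrow> complex^'n \<Rightarrow> 'x" where
  "laplace_deriv f v w = smul ((-1) ^ (\<Sum>j\<in>UNIV. v $ j) * (\<Prod>j\<in>UNIV. fact (v $ j)))
    (laplace smul P (monomial_weight smul v f) w)"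

text \<open>The first-order result for the function weighted by \<open>v\<close>: its minus sign
  raises the power of -1, and the factor \<open>v $ j + 1\<close> completes the factorial.\<close>

lemma has_partial_derivative_laplace_deriv:
  fixes f :: "real^'n \<Rightarrow> 'x"
  assumes f: "locally_integrable_orthant P f" and U: "open U" "U \<subseteq> laplace_region_bounded smul P f"
    and z: "z \<in> U"
  shows "has_partial_derivative smul j (laplace_deriv f v) z (laplace_deriv f (v + axis j 1) z)"
proof -
  have "has_partial_derivative smul j (laplace_deriv f v) z
      (smul ((-1) ^ (\<Sum>j\<in>UNIV. v $ j) * (\<Prod>j\<in>UNIV. fact (v $ j)))
        (- laplace smul P (monomial_weight smul (axis j 1) (monomial_weight smul v f)) z))"
    unfolding laplace_deriv_def[abs_def]
    by (intro has_partial_derivative_scale has_partial_derivative_laplace[OF _ U(1) _ z]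
        locally_integrable_monomial_weight f laplace_regions_open(2) U)
  also have "laplace smul P (monomial_weight smul (axis j 1) (monomial_weight smul v f)) z
      = smul (of_nat (v $ j + 1)) (laplace smul P (monomial_weight smul (v + axis j 1) f) z)"
    unfolding monomial_weight_axis using laplace_regions_open(1)[OF f U] z
    by (intro laplace_scale locally_integrable_monomial_weight f) auto
  also have "smul ((-1) ^ (\<Sum>j\<in>UNIV. v $ j) * (\<Prod>j\<in>UNIV. fact (v $ j)))
        (- smul (of_nat (v $ j + 1)) (laplace smul P (monomial_weight smul (v + axis j 1) f) z))
      = laplace_deriv f (v + axis j 1) z"
  proof -
    have s: "(\<Sum>i\<in>UNIV. (v + axis j 1) $ i) = (\<Sum>i\<in>UNIV. v $ i) + 1"
      by (simp add: sum.distrib axis_def)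
    have "(\<Prod>i\<in>UNIV. fact ((v + axis j 1) $ i)) = fact (v $ j + 1) * (\<Prod>i\<in>UNIV - {j}. fact (v $ i) :: complex)"
      by (subst prod.remove[of _ j]) (auto simp: axis_def intro!: prod.cong)
    also have "\<dots> = of_nat (v $ j + 1) * (fact (v $ j) * (\<Prod>i\<in>UNIV - {j}. fact (v $ i)))"
      by simp
    also have "fact (v $ j) * (\<Prod>i\<in>UNIV - {j}. fact (v $ i)) = (\<Prod>i\<in>UNIV. fact (v $ i) :: complex)"
      by (rule prod.remove[symmetric]) auto
    finally have p: "(\<Prod>i\<in>UNIV. fact ((v + axis j 1) $ i)) = of_nat (v $ j + 1) * (\<Prod>i\<in>UNIV. fact (v $ i) :: complex)" .
    show ?thesis
      unfolding laplace_deriv_def s p by (simp add: mult_ac del: of_nat_Suc of_nat_add)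
  qed
  finally show ?thesis .
qed

text \<open>The value depends on the list through its counts alone, so all orders of differentiation
  agree. The claim is for all points of the open \<open>U\<close>, as the intermediate derivatives
  must exist nearby.\<close>

lemma has_iterated_partial_laplace:
  fixes f :: "real^'n \<Rightarrow> 'x"
  assumes f: "locally_integrable_orthant P f" and U: "open U" "U \<subseteq> laplace_region_bounded smul P f"
  shows "z \<in> U \<Longrightarrow> has_iterated_partial smul js (laplace smul P f) z (laplace_deriv f (\<chi> j. count_list js j) z)"
proof (induction js arbitrary: z)
  case Nil
  have "(\<chi> j. count_list [] j) = (0 :: nat^'n)"
    by (simp add: vec_eq_iff)
  then show ?case
    by (simp add: laplace_deriv_def monomial_weight_0)
next
  case (Cons j js)
  have "(\<chi> i. count_list (j # js) i) = (\<chi> i. count_list js i) + axis j 1"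
    by (auto simp: vec_eq_iff axis_def)
  moreover have "\<forall>\<^sub>F w in nhds z. has_iterated_partial smul js (laplace smul P f) w
      (laplace_deriv f (\<chi> i. count_list js i) w)"
    using U(1) Cons by (auto simp: eventually_nhds)
  ultimately show ?case
    using has_partial_derivative_laplace_deriv[OF f U Cons.prems, of j "\<chi> i. count_list js i"]
    by (auto simp: simp del: count_list.simps)
qed

lemma has_mixed_partial_laplace:
  fixes f :: "real^'n \<Rightarrow> 'x"
  assumes f: "locally_integrable_orthant P f" and U: "open U" "U \<subseteq> laplace_region_bounded smul P f"
    and z: "z \<in> U"
  shows "has_mixed_partial smul v (laplace smul P f) z (laplace_deriv f v z)"
  unfolding has_mixed_partial_def
proof (intro allI impI)
  fix js assume "\<forall>j. count_list js j = v $ j"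
  then have "v = (\<chi> j. count_list js j)"
    by (simp add: vec_eq_iff)
  then show "has_iterated_partial smul js (laplace smul P f) z (laplace_deriv f v z)"
    using has_iterated_partial_laplace[OF f U z, of js] by simp
qed

section \<open>Absolute convergence\<close>

lemma laplace_region_abs_bounded:
  fixes f :: "real^'n \<Rightarrow> 'x"
  assumes f: "locally_integrable_orthant P f"
  shows "laplace_region_abs smul P f \<subseteq> laplace_region_bounded smul P f"
proof
  fix l assume l: "l \<in> laplace_region_abs smul P f"
  show "l \<in> laplace_region_bounded smul P f"
    unfolding laplace_region_bounded_def seminorm_bounded_def mem_Collect_eq
  proof
    fix p assume p: "p \<in> P"
    let ?I = "\<integral>\<^sup>+t\<in>{0..}. ennreal (p (smul (laplace_kernel l t) (f t))) \<partial>lebesgue"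
    have fin: "?I < top"
      using l p by (simp add: laplace_region_abs_def)
    have "p (partial_laplace smul P f l t) \<le> enn2real ?I" for t
    proof -
      have "ennreal (p (partial_laplace smul P f l t))
          \<le> (\<integral>\<^sup>+s\<in>{0..t}. ennreal (p (smul (laplace_kernel l s) (f s))) \<partial>lebesgue)"
        unfolding partial_laplace_def
        by (intro seminorm_integral_le integrable_box_times f admissible_continuous
            laplace_kernel_continuous lmeasurable_box p)
      also have "\<dots> \<le> ?I"
        by (intro nn_integral_mono) (auto simp: indicator_def)
      also have "\<dots> = ennreal (enn2real ?I)"
        using fin by simp
      finally show ?thesis
        by (simp add: ennreal_le_iff)
    qed
    then show "bdd_above (p ` partial_laplace smul P f l ` {0..})"
      by (intro bdd_aboveI[of _ "enn2real ?I"]) auto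
  qed
qed

text \<open>Local integrability speaks of compact sets; the orthant is exhausted by cubes, and at
  each point the sequence is eventually constant.\<close>

lemma seminorm_orthant_measurable:
  fixes g :: "real^'n \<Rightarrow> 'x"
  assumes g: "locally_integrable_orthant P g" and p: "p \<in> P"
  shows "(\<lambda>t. ennreal (p (g t)) * indicator {0..} t) \<in> borel_measurable lebesgue"
proof (rule borel_measurable_LIMSEQ_order)
  show "(\<lambda>t. ennreal (p (g t)) * indicator {0..diagonal (real k)} t) \<in> borel_measurable lebesgue" for k
    by (rule integrable_seminorm_measurable[OF integrable_box[OF g] p])
  fix t :: "real^'n"
  obtain N where N: "(\<Sum>j\<in>UNIV. \<bar>t $ j\<bar>) \<le> real N"
    using real_arch_simple by blast
  have "t \<le> diagonal (real k)" if "N \<le> k" for k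
  proof -
    have "t $ j \<le> real k" for j
    proof -
      have "t $ j \<le> (\<Sum>j\<in>UNIV. \<bar>t $ j\<bar>)"
        using abs_ge_self[of "t $ j"] member_le_sum[of j UNIV "\<lambda>j. \<bar>t $ j\<bar>"] by simp
      then show ?thesis using N that by linarith
    qed
    then show ?thesis by (simp add: less_eq_vec_def)
  qed
  then have "\<forall>\<^sub>F k in sequentially. ennreal (p (g t)) * indicator {0..diagonal (real k)} t = ennreal (p (g t)) * indicator {0..} t"
    unfolding eventually_sequentially by (intro exI[of _ N]) (auto simp: indicator_def)
  then show "(\<lambda>k. ennreal (p (g t)) * indicator {0..diagonal (real k)} t) \<longlonglongrightarrow> ennreal (p (g t)) * indicator {0..} t"
    by (rule tendsto_eventually)
qed

text \<open>Bounded partial integrals say nothing about integrals of seminorms, so this case needs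
  its own estimate; here a pointwise bound on the weights does it.\<close>

lemma laplace_region_abs_monomial:
  fixes f :: "real^'n \<Rightarrow> 'x"
  assumes f: "locally_integrable_orthant P f" and mu: "\<mu> \<in> laplace_region_abs smul P f" and e: "0 < e"
  shows "\<mu> + diagonal (of_real e) \<in> laplace_region_abs smul P (monomial_weight smul m f)"
  unfolding laplace_region_abs_def mem_Collect_eq
proof
  fix p assume p: "p \<in> P"
  define C where "C = (\<Prod>j\<in>UNIV. 1 / e ^ (m $ j))"
  have C: "0 \<le> C"
    unfolding C_def using e by (intro prod_nonneg) simp
  define g where "g = (\<lambda>s. smul (laplace_kernel \<mu> s) (f s))"
  have fin: "(\<integral>\<^sup>+t\<in>{0..}. ennreal (p (g t)) \<partial>lebesgue) < \<infinity>"
    using mu p by (simp add: laplace_region_abs_def g_def)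
  have le: "p (smul (laplace_kernel (\<mu> + diagonal (of_real e)) s) (monomial_weight smul m f s)) \<le> C * p (g s)"
    if s: "0 \<le> s" for s
  proof -
    have "smul (laplace_kernel (\<mu> + diagonal (of_real e)) s) (monomial_weight smul m f s)
        = smul (\<Prod>j\<in>UNIV. gamma_weight e (m $ j) (s $ j)) (g s)"
      unfolding g_def monomial_weight_eq scale_scale laplace_kernel_times_monomial ..
    moreover have "cmod (\<Prod>j\<in>UNIV. gamma_weight e (m $ j) (s $ j)) \<le> C"
      unfolding C_def prod_norm[symmetric] using s
      by (intro prod_mono conjI norm_ge_zero gamma_weight_norm_le e) (simp add: less_eq_vec_def)
    ultimately show ?thesis
      by (simp add: seminorm_scale[OF p] mult_right_mono seminorm_nonneg[OF p])
  qed
  have "(\<integral>\<^sup>+t\<in>{0..}. ennreal (p (smul (laplace_kernel (\<mu> + diagonal (of_real e)) t) (monomial_weight smul m f t))) \<partial>lebesgue)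
      \<le> (\<integral>\<^sup>+t. ennreal C * (ennreal (p (g t)) * indicator {0..} t) \<partial>lebesgue)"
    using le C by (intro nn_integral_mono)
      (auto simp: indicator_def ennreal_mult[symmetric] seminorm_nonneg[OF p] intro!: ennreal_leI)
  also have "\<dots> = ennreal C * (\<integral>\<^sup>+t\<in>{0..}. ennreal (p (g t)) \<partial>lebesgue)"
    unfolding g_def by (intro nn_integral_cmult seminorm_orthant_measurable p locally_integrable_times f
        laplace_kernel_continuous)
  also have "\<dots> < \<infinity>"
    using fin by (simp add: ennreal_mult_less_top)
  finally show "(\<integral>\<^sup>+t\<in>{0..}. ennreal (p (smul (laplace_kernel (\<mu> + diagonal (of_real e)) t) (monomial_weight smul m f t))) \<partial>lebesgue) < \<infinity>" .
qed

lemma laplace_region_abs_open: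
  fixes f :: "real^'n \<Rightarrow> 'x"
  assumes f: "locally_integrable_orthant P f" and U: "open U" "U \<subseteq> laplace_region_abs smul P f"
  shows "U \<subseteq> laplace_region_abs smul P (monomial_weight smul m f)"
proof
  fix z assume z: "z \<in> U"
  obtain r where r: "r > 0" "polydisc z r \<subseteq> U"
    using open_contains_polydisc[OF U(1) z] by blast
  have "z - diagonal (of_real (r / 2)) \<in> laplace_region_abs smul P f"
    using shifted_point[OF r(2,1)] U(2) by blast
  from laplace_region_abs_monomial[OF f this half_gt_zero[OF r(1)], of m]
  show "z \<in> laplace_region_abs smul P (monomial_weight smul m f)"
    by simp
qed

end

section \<open>Integer boxes and the two statements\<close>

lemma filterlim_real_vec_at_top: "filterlim (\<lambda>k :: nat^'n. \<chi> j. real (k $ j)) at_top at_top"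
  unfolding filterlim_iff
proof (intro allI impI)
  fix Q :: "real^'n \<Rightarrow> bool" assume "eventually Q at_top"
  then obtain M where M: "\<And>t. (\<forall>j. M < t $ j) \<Longrightarrow> Q t"
    unfolding eventually_at_top_vec by blast
  obtain N where "M < real N"
    using reals_Archimedean2 by blast
  then show "\<forall>\<^sub>F k :: nat^'n in at_top. Q (\<chi> j. real (k $ j))"
    unfolding eventually_at_top_vec by (intro exI[of _ N] allI impI M) (auto intro: order.strict_trans)
qed

theorem proposition2p15:
  fixes smul :: "complex \<Rightarrow> 'x::{ab_group_add,t2_space} \<Rightarrow> 'x"
    and P :: "('x \<Rightarrow> real) set"
    and f :: "real^'n \<Rightarrow> 'x"
    and v :: "nat^'n"
  assumes X: "sclcs smul P"
    and n: "CARD('n) \<ge> 2"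
    and f: "locally_integrable_orthant P f"
  shows
    "(\<forall>\<Omega> l. \<Omega> \<noteq> {} \<and> \<Omega> \<subseteq> laplace_region smul P f \<inter> laplace_region_bounded smul P f \<and>
        open \<Omega> \<and> l \<in> \<Omega> \<longrightarrow>
        analytic_vec_on smul P \<Omega> (laplace smul P f) \<and>
        l \<in> laplace_region smul P (monomial_weight smul v f) \<and>
        (\<exists>L. ((\<lambda>k :: nat^'n. partial_laplace smul P (monomial_weight smul v f) l (\<chi> j. real (k $ j)))
                \<longlongrightarrow> L) at_top \<and>
             has_mixed_partial smul v (laplace smul P f) l
               (smul ((-1) ^ (\<Sum>j\<in>UNIV. v $ j) * (\<Prod>j\<in>UNIV. fact (v $ j))) L))) \<and>
     (\<forall>\<Omega> l. \<Omega> \<noteq> {} \<and> \<Omega> \<subseteq> laplace_region_abs smul P f \<and> open \<Omega> \<and> l \<in> \<Omega> \<longrightarrow>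
        analytic_vec_on smul P \<Omega> (laplace smul P f) \<and>
        l \<in> laplace_region_abs smul P (monomial_weight smul v f) \<and>
        has_mixed_partial smul v (laplace smul P f) l
          (smul ((-1) ^ (\<Sum>j\<in>UNIV. v $ j) * (\<Prod>j\<in>UNIV. fact (v $ j)))
            (laplace smul P (monomial_weight smul v f) l)))"
proof (intro conjI allI impI)
  interpret sclcs smul P by (rule X)
  fix \<Omega> :: "(complex^'n) set" and l
  {
    assume "\<Omega> \<noteq> {} \<and> \<Omega> \<subseteq> laplace_region smul P f \<inter> laplace_region_bounded smul P f \<and> open \<Omega> \<and> l \<in> \<Omega>"
    then have U: "open \<Omega>" "\<Omega> \<subseteq> laplace_region_bounded smul P f" and l: "l \<in> \<Omega>"
      by auto
    show "analytic_vec_on smul P \<Omega> (laplace smul P f)"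
      by (rule laplace_analytic[OF f U])
    show region: "l \<in> laplace_region smul P (monomial_weight smul v f)"
      using laplace_regions_open(1)[OF f U] l by blast
    show "\<exists>L. ((\<lambda>k :: nat^'n. partial_laplace smul P (monomial_weight smul v f) l (\<chi> j. real (k $ j)))
              \<longlongrightarrow> L) at_top \<and>
           has_mixed_partial smul v (laplace smul P f) l
             (smul ((-1) ^ (\<Sum>j\<in>UNIV. v $ j) * (\<Prod>j\<in>UNIV. fact (v $ j))) L)"
      using filterlim_compose[OF tendsto_laplace[OF region] filterlim_real_vec_at_top]
        has_mixed_partial_laplace[OF f U l, of v] unfolding laplace_deriv_def by blast
  }
  {
    assume "\<Omega> \<noteq> {} \<and> \<Omega> \<subseteq> laplace_region_abs smul P f \<and> open \<Omega> \<and> l \<in> \<Omega>"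
    then have A: "open \<Omega>" "\<Omega> \<subseteq> laplace_region_abs smul P f" and l: "l \<in> \<Omega>"
      by auto
    \<comment> \<open>Reduces analyticity and the derivative formula to bounded partial integrals;
      only the absolute convergence for the weighted function is argued separately.\<close>
    then have U: "open \<Omega>" "\<Omega> \<subseteq> laplace_region_bounded smul P f"
      using laplace_region_abs_bounded[OF f] by auto
    show "analytic_vec_on smul P \<Omega> (laplace smul P f)"
      by (rule laplace_analytic[OF f U])
    show "l \<in> laplace_region_abs smul P (monomial_weight smul v f)"
      using laplace_region_abs_open[OF f A] l by blast
    show "has_mixed_partial smul v (laplace smul P f) l
        (smul ((-1) ^ (\<Sum>j\<in>UNIV. v $ j) * (\<Prod>j\<in>UNIV. fact (v $ j)))
          (laplace smul P (monomial_weight smul v f) l))"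
      using has_mixed_partial_laplace[OF f U l, of v] unfolding laplace_deriv_def .
  }
qed

end
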